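(* Let $d\ge 1$, let $\phi:\mathbb{R}\to\mathbb{R}$ be a normalized activation function (see context), and let $m_n$ denote the infinitely wide and deep network classifier with activation $\phi$ trained on $n$ examples, i.e. $$m_n(x)=\lim_{L\to\infty}\operatorname{sign}\Big(y\,\big(K_n^{(L)}\big)^{-1}K^{(L)}(X,x)\Big).$$ For $z\sim\mathcal{N}(0,1)$ define $A=\mathbb{E}[\phi(z)]$, $A'=\mathbb{E}[\phi'(z)]$, $B'=\mathbb{E}[\phi'(z)^2]$. If $$A=0,\qquad A'\neq 0,\qquad -\frac{\log\big((A')^2\big)}{\log(B')}=\frac{d}{2},$$ then $m_n$ is Bayes optimal: whenever the $n$ training examples are drawn i.i.d. from a distribution of $(x,y)$ on $\mathcal{S}_+^{d}\times\{-1,1\}$ whose marginal on $\mathcal{S}_+^{d}$ has a density, then for almost all $x\in\mathcal{S}_+^{d}$ and every $\epsilon>0$, $$\lim_{n\to\infty}\mathbb{P}_X\Big(\Big|m_n(x)-\operatorname*{argmax}_{\tilde{y}\in\{-1,1\}}\mathbb{P}(y=\tilde{y}\mid x)\Big|>\epsilon\Big)=0,$$ where the probability is over the training sample.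
   Context: $\mathcal{S}_+^{d}$ is the intersection of the unit sphere $\mathcal{S}^d\subset\mathbb{R}^{d+1}$ with the non-negative orthant; densities are with respect to surface measure. "Almost all $x$" is with respect to the marginal distribution of $x$ (where $\mathbb{P}(y=\tilde y\mid x)$ is determined). If both labels maximize $\mathbb{P}(y=\tilde y\mid x)$, the absolute difference is read as the distance of $m_n(x)$ to the set of maximizers. Normalized activation function: a (weakly) differentiable $\phi:\mathbb{R}\to\mathbb{R}$ with $\mathbb{E}[\phi(z)^2]=1$ and $\mathbb{E}[\phi'(z)^2]<\infty$ for $z\sim\mathcal{N}(0,1)$. Dual activation: $\check{\phi}:[-1,1]\to\mathbb{R}$, $\check{\phi}(z)=\mathbb{E}[\phi(u)\phi(v)]$ where $(u,v)$ is a centered Gaussian vector with covariance $\begin{pmatrix} 1 & z \\ z & 1 \end{pmatrix}$; $\check{\phi}'$ is its derivative. One has $A^2=\check\phi(0)$, $(A')^2=\check\phi'(0)$, $B'=\check\phi'(1)$. Write $\check{\phi}^{(0)}(z)=z$ and $\check{\phi}^{(L)}=\check{\phi}\circ\check{\phi}^{(L-1)}$. Neural Tangent Kernel (NTK) of the (infinitely wide, bias-free) fully connected network with $L$ hidden layers and activation $\phi$, on the unit sphere: $K^{(L)}(x,\tilde{x})=K^{(L)}(z)$ with $z=x^T\tilde{x}$, where $$K^{(0)}(z)=z,\qquad K^{(L)}(z)=\check{\phi}^{(L)}(z)+K^{(L-1)}(z)\,\check{\phi}'\big(\check{\phi}^{(L-1)}(z)\big).$$ Kernel machine notation: training inputs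 $X=[x^{(1)}|\dots|x^{(n)}]$ with $x^{(i)}\in\mathcal{S}_+^d$, labels $y=[y^{(1)},\dots,y^{(n)}]\in\{-1,1\}^{1\times n}$, $(K_n^{(L)})_{i,j}=K^{(L)}(x^{(i)},x^{(j)})$, and $K^{(L)}(X,x)\in\mathbb{R}^n$ with $i$-th entry $K^{(L)}(x^{(i)},x)$. *)

theory Defs
  imports "HOL-Probability.Probability" "Jordan_Normal_Form.Gauss_Jordan_Elimination"
begin

section \<open>Activation functions and their duals\<close>

text \<open>Test functions are the compactly supported C1 functions, which for first-order weak
  derivatives gives the same notion as smooth test functions (mollify). Every function that is
  differentiable everywhere with a locally integrable derivative is covered.\<close>

definition weak_derivative :: "(real \<Rightarrow> real) \<Rightarrow> (real \<Rightarrow> real) \<Rightarrow> bool" where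
  "weak_derivative f f' \<longleftrightarrow>
     (\<forall>a b. set_integrable lborel {a..b} f \<and> set_integrable lborel {a..b} f') \<and>
     (\<forall>\<psi>. \<psi> C1_differentiable_on UNIV \<and> bounded {t. \<psi> t \<noteq> 0} \<longrightarrow>
        (\<integral>t. f t * deriv \<psi> t \<partial>lborel) = - (\<integral>t. f' t * \<psi> t \<partial>lborel))"

definition normalized_activation :: "(real \<Rightarrow> real) \<Rightarrow> (real \<Rightarrow> real) \<Rightarrow> bool" where
  "normalized_activation \<phi> \<phi>' \<longleftrightarrow>
     weak_derivative \<phi> \<phi>' \<and>
     integrable std_normal_distribution (\<lambda>z. (\<phi> z)\<^sup>2) \<and>
     (\<integral>z. (\<phi> z)\<^sup>2 \<partial>std_normal_distribution) = 1 \<and>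
     integrable std_normal_distribution (\<lambda>z. (\<phi>' z)\<^sup>2)"

text \<open>For \<open>\<rho> \<in> {-1..1}\<close> this is the law of the centered Gaussian vector \<open>(u, v)\<close> with unit
  variances and covariance \<open>\<rho>\<close>, realised as \<open>v = \<rho> u + sqrt (1 - \<rho>\<^sup>2) w\<close> with \<open>u, w\<close> independent
  standard normal; this includes the degenerate cases \<open>\<rho> = 1\<close> and \<open>\<rho> = -1\<close>. Outside \<open>{-1..1}\<close>
  it has no meaning and is never used.\<close>

definition gaussian_pair :: "real \<Rightarrow> (real \<times> real) measure" where
  "gaussian_pair \<rho> =
     distr (std_normal_distribution \<Otimes>\<^sub>M std_normal_distribution) (borel \<Otimes>\<^sub>M borel)
       (\<lambda>(u, w). (u, \<rho> * u + sqrt (1 - \<rho>\<^sup>2) * w))"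

definition dual_activation :: "(real \<Rightarrow> real) \<Rightarrow> real \<Rightarrow> real" where
  "dual_activation \<phi> z = (\<integral>(u, v). \<phi> u * \<phi> v \<partial>gaussian_pair z)"

text \<open>The dual activation lives on \<open>{-1..1}\<close>, so its derivative is one-sided at the end points;
  the value at \<open>1\<close> enters the diagonal of the kernel matrix.\<close>

definition dual_activation_deriv :: "(real \<Rightarrow> real) \<Rightarrow> real \<Rightarrow> real" where
  "dual_activation_deriv \<phi> z = vector_derivative (dual_activation \<phi>) (at z within {-1..1})"

primrec ntk :: "(real \<Rightarrow> real) \<Rightarrow> nat \<Rightarrow> real \<Rightarrow> real" where
  "ntk \<phi> 0 z = z"
| "ntk \<phi> (Suc L) z =
     (dual_activation \<phi> ^^ Suc L) z
     + ntk \<phi> L z * dual_activation_deriv \<phi> ((dual_activation \<phi> ^^ L) z)"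


section \<open>The non-negative part of the sphere\<close>

definition nonneg_sphere :: "(real^'k) set" where
  "nonneg_sphere = {x. norm x = 1 \<and> (\<forall>i. 0 \<le> vec_nth x i)}"

text \<open>Surface measure of the unit sphere in polar coordinates: the area of \<open>A\<close> is the dimension of
  the ambient space times the Lebesgue measure of the cone \<open>{t x | 0 < t \<le> 1, x \<in> A}\<close>. Note that
  \<open>sgn x = x / norm x\<close>; the origin, with \<open>sgn 0 = 0\<close>, is a null set.\<close>

definition sphere_surface_measure :: "(real^'k) measure" where
  "sphere_surface_measure =
     distr (density lborel (\<lambda>x. of_nat CARD('k) * indicator (cball 0 1) x)) borel sgn"

definition nonneg_sphere_measure :: "(real^'k) measure" where
  "nonneg_sphere_measure = restrict_space sphere_surface_measure nonneg_sphere"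


section \<open>Data distribution and Bayes classifier\<close>

definition data_space :: "((real^'k) \<times> real) measure" where
  "data_space = nonneg_sphere_measure \<Otimes>\<^sub>M count_space {-1, 1}"

definition input_marginal :: "((real^'k) \<times> real) measure \<Rightarrow> (real^'k) measure" where
  "input_marginal D = distr D nonneg_sphere_measure fst"

text \<open>\<open>\<eta> l x\<close> is a version of the conditional probability of the label \<open>l\<close> given the input \<open>x\<close>,
  that is, of the conditional expectation with respect to the sigma-algebra generated by \<open>fst\<close>.
  Only the sets of \<open>nonneg_sphere_measure\<close> matter for \<open>vimage_algebra\<close>.\<close>

definition is_label_posterior ::
    "((real^'k) \<times> real) measure \<Rightarrow> (real \<Rightarrow> real^'k \<Rightarrow> real) \<Rightarrow> bool" where
  "is_label_posterior D \<eta> \<longleftrightarrow>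
     (\<forall>l\<in>{-1, 1}.
        \<eta> l \<in> borel_measurable nonneg_sphere_measure \<and>
        (AE s in D.
           real_cond_exp D (vimage_algebra (space D) fst nonneg_sphere_measure)
             (indicator {s. snd s = l}) s = \<eta> l (fst s)))"

definition bayes_labels :: "(real \<Rightarrow> real^'k \<Rightarrow> real) \<Rightarrow> real^'k \<Rightarrow> real set" where
  "bayes_labels \<eta> x = {l. is_arg_max (\<lambda>l. \<eta> l x) (\<lambda>l. l \<in> {-1, 1}) l}"

definition training_measure ::
    "((real^'k) \<times> real) measure \<Rightarrow> nat \<Rightarrow> (nat \<Rightarrow> (real^'k) \<times> real) measure" where
  "training_measure D n = Pi\<^sub>M {..<n} (\<lambda>_. D)"


section \<open>The infinitely wide and deep classifier\<close>

definition ntk_matrix ::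
    "(real \<Rightarrow> real) \<Rightarrow> nat \<Rightarrow> nat \<Rightarrow> (nat \<Rightarrow> (real^'k) \<times> real) \<Rightarrow> real mat" where
  "ntk_matrix \<phi> L n S = mat n n (\<lambda>(i, j). ntk \<phi> L (inner (fst (S i)) (fst (S j))))"

definition ntk_predictor ::
    "(real \<Rightarrow> real) \<Rightarrow> nat \<Rightarrow> nat \<Rightarrow> (nat \<Rightarrow> (real^'k) \<times> real) \<Rightarrow> real^'k \<Rightarrow> real" where
  "ntk_predictor \<phi> L n S x =
     scalar_prod (Matrix.vec n (\<lambda>i. snd (S i)))
       (the (mat_inverse (ntk_matrix \<phi> L n S))
          *\<^sub>v Matrix.vec n (\<lambda>i. ntk \<phi> L (inner (fst (S i)) x)))"

definition deep_classifier ::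
    "(real \<Rightarrow> real) \<Rightarrow> nat \<Rightarrow> (nat \<Rightarrow> (real^'k) \<times> real) \<Rightarrow> real^'k \<Rightarrow> real" where
  "deep_classifier \<phi> n S x = lim (\<lambda>L. sgn (ntk_predictor \<phi> L n S x))"

text \<open>The kernel matrix may be singular for small depth (for depth \<open>0\<close> it is a Gram matrix of rank
  at most the ambient dimension), so invertibility is only asked for all large depths.\<close>

definition deep_classifier_defined ::
    "(real \<Rightarrow> real) \<Rightarrow> nat \<Rightarrow> (nat \<Rightarrow> (real^'k) \<times> real) \<Rightarrow> real^'k \<Rightarrow> bool" where
  "deep_classifier_defined \<phi> n S x \<longleftrightarrow>
     (\<forall>\<^sub>F L in sequentially. invertible_mat (ntk_matrix \<phi> L n S)) \<and>
     convergent (\<lambda>L. sgn (ntk_predictor \<phi> L n S x))"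

text \<open>The event that the classifier is farther than \<open>\<epsilon>\<close> from the set of maximising labels. Samples
  for which the limit defining the classifier does not exist are counted as errors.\<close>

definition error_event ::
    "(real \<Rightarrow> real) \<Rightarrow> ((real^'k) \<times> real) measure \<Rightarrow> (real \<Rightarrow> real^'k \<Rightarrow> real) \<Rightarrow> nat \<Rightarrow> real^'k
      \<Rightarrow> real \<Rightarrow> (nat \<Rightarrow> (real^'k) \<times> real) set" where
  "error_event \<phi> D \<eta> n x \<epsilon> =
     {S \<in> space (training_measure D n).
        deep_classifier_defined \<phi> n S x \<longrightarrow>
          infdist (deep_classifier \<phi> n S x) (bayes_labels \<eta> x) > \<epsilon>}"

end

theory Submission
  imports Defs "Jordan_Normal_Form.Determinant"
begin

text \<open>The dual activation is the power series whose coefficients are the squared Hermite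
  coefficients of \<open>\<phi>\<close>, so it attracts \<open>{0..<1}\<close> to \<open>0\<close> with multiplier \<open>a = A'\<^sup>2 < 1\<close> and repels
  from \<open>1\<close> with multiplier \<open>b = B' > 1\<close>. The kernel of depth \<open>L\<close> divided by \<open>(L + 1) a ^ L\<close> tends to
  the Koenigs function \<open>K\<close> of the dual, which satisfies \<open>K (f z) = a * K z\<close>, whereas its diagonal
  stays above \<open>1\<close>; the classifier is therefore the sign of the vote \<open>\<Sum> y\<^sub>i * K (x\<^sub>i \<bullet> x)\<close>.

  Since \<open>a = b powr (- d / 2)\<close>, at a Lebesgue point \<open>x\<close> the functional equation makes the tail of
  \<open>K (x\<^sub>i \<bullet> x)\<close> vary almost regularly with index \<open>-1\<close> along powers of \<open>a\<close>. This is the borderline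
  case in which the truncated mean diverges and dominates the truncation level times the tail: a weak
  law with truncation holds, and the vote takes the sign of the conditional mean of the label.\<close>

section \<open>Hermite expansion of the dual activation\<close>

text \<open>Why the exponent is critical: near 1 the dual turns the distance t into about b t and
  multiplies \<open>koenigs\<close> by a, so an example at overlap 1 - t has a weight of order t
  powr (- d / 2), that is, its distance to the power -d, while the cap of such examples has
  probability of order t powr (d / 2).

  The obstacle is that these orders are heuristic. A finite B' gives the derivative of the dual at 1
  but no rate, so slowly varying factors may accumulate along the orbit, and only the one-sided
  estimate \<open>koenigs_growth\<close> is uniform. The tail is therefore compared at finitely many
  scales at a time, with a loss factor as close to 1 as desired.

  Absence of atoms disposes of coinciding inputs and of a vanishing vote.\<close>

lemma Cauchy_Schwarz_integral:
  fixes f g :: "'a \<Rightarrow> real"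
  assumes [measurable]: "f \<in> borel_measurable M" "g \<in> borel_measurable M"
    and f: "integrable M (\<lambda>x. (f x)\<^sup>2)" and g: "integrable M (\<lambda>x. (g x)\<^sup>2)"
  shows "integrable M (\<lambda>x. f x * g x)"
    and "(\<integral>x. f x * g x \<partial>M)\<^sup>2 \<le> (\<integral>x. (f x)\<^sup>2 \<partial>M) * (\<integral>x. (g x)\<^sup>2 \<partial>M)"
proof -
  have "\<bar>f x * g x\<bar> \<le> (f x)\<^sup>2 + (g x)\<^sup>2" for x
  proof -
    have "2 * (\<bar>f x\<bar> * \<bar>g x\<bar>) \<le> (f x)\<^sup>2 + (g x)\<^sup>2"
      using sum_squares_bound[of "\<bar>f x\<bar>" "\<bar>g x\<bar>"] by simp
    moreover have "0 \<le> \<bar>f x\<bar> * \<bar>g x\<bar>" by simp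
    ultimately show ?thesis unfolding abs_mult by linarith
  qed
  then show i: "integrable M (\<lambda>x. f x * g x)"
    by (intro Bochner_Integration.integrable_bound[OF Bochner_Integration.integrable_add[OF f g]]) auto
  define A B C where "A = (\<integral>x. (f x)\<^sup>2 \<partial>M)" and "B = (\<integral>x. f x * g x \<partial>M)" and "C = (\<integral>x. (g x)\<^sup>2 \<partial>M)"
  have *: "0 \<le> A - 2 * t * B + t\<^sup>2 * C" for t
  proof -
    have "0 \<le> (\<integral>x. (f x - t * g x)\<^sup>2 \<partial>M)" by simp
    also have "\<dots> = (\<integral>x. (f x)\<^sup>2 - 2 * t * (f x * g x) + t\<^sup>2 * (g x)\<^sup>2 \<partial>M)"
      by (rule Bochner_Integration.integral_cong) (auto simp: power2_eq_square algebra_simps)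
    also have "\<dots> = A - 2 * t * B + t\<^sup>2 * C"
      unfolding A_def B_def C_def using f g i by simp
    finally show ?thesis .
  qed
  have C0: "C \<ge> 0" and A0: "A \<ge> 0" by (auto simp: C_def A_def)
  show "B\<^sup>2 \<le> A * C"
  proof (cases "C = 0")
    case True
    have "B = 0"
    proof (rule ccontr)
      assume "B \<noteq> 0"
      \<comment> \<open>With C = 0 the quadratic is linear in t, and this t gives it the value
        -1.\<close>
      then have "0 \<le> A - 2 * ((A + 1) / (2 * B)) * B" using *[of "(A + 1) / (2 * B)"] True by simp
      then show False using \<open>B \<noteq> 0\<close> by simp
    qed
    then show ?thesis using True by simp
  next
    case False
    then have "C > 0" using C0 by simp
    with *[of "B / C"] show ?thesis by (simp add: power2_eq_square field_simps)
  qed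
qed

lemma std_normal_moment_poly_integrable:
  "integrable std_normal_distribution (poly p)"
proof -
  have "integrable std_normal_distribution (\<lambda>x. \<Sum>i\<le>degree p. coeff p i * x ^ i)"
    by (intro Bochner_Integration.integrable_sum integrable_mult_right
        integrable_std_normal_distribution_moment)
  then show ?thesis by (simp add: poly_altdef[abs_def])
qed

lemma poly_sq_integrable: "integrable std_normal_distribution (\<lambda>x. (poly p x)\<^sup>2)"
  using std_normal_moment_poly_integrable[of "p^2"] by (simp add: poly_power[abs_def])

lemma borel_measurable_poly[measurable]: "poly (p :: real poly) \<in> borel_measurable borel"
  by (intro borel_measurable_continuous_onI continuous_intros)

lemma prob_space_std_normal: "prob_space std_normal_distribution"
  using prob_space_normal_density by auto

section \<open>Gaussian integration by parts for weak derivatives\<close>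

lemma max_square_deriv:
  "((\<lambda>u::real. (max 0 u)\<^sup>2) has_real_derivative 2 * max 0 u) (at u)"
proof -
  consider "u > 0" | "u < 0" | "u = 0" by linarith
  then show ?thesis
  proof cases
    case 1
    have "((\<lambda>u::real. u\<^sup>2) has_real_derivative 2 * max 0 u) (at u)"
      using 1 by (auto intro!: derivative_eq_intros)
    then show ?thesis
      by (rule has_field_derivative_transform_within_open[where S="{0<..}"]) (use 1 in auto)
  next
    case 2
    have "((\<lambda>u::real. 0) has_real_derivative 2 * max 0 u) (at u)"
      using 2 by (auto intro!: derivative_eq_intros)
    then show ?thesis
      by (rule has_field_derivative_transform_within_open[where S="{..<0}"]) (use 2 in auto)
  next
    case 3
    have "(\<lambda>h::real. (max 0 h)\<^sup>2 / h) \<midarrow>0\<rightarrow> 0"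
    proof (rule Lim_null_comparison)
      show "\<forall>\<^sub>F h in at 0. norm ((max 0 h)\<^sup>2 / h) \<le> \<bar>h\<bar>" for h :: real
        by (rule always_eventually) (auto simp: max_def power2_eq_square)
      show "((\<lambda>h. \<bar>h\<bar>) \<longlongrightarrow> (0::real)) (at 0)" by (auto intro!: tendsto_eq_intros)
    qed
    then show ?thesis unfolding 3 DERIV_def by simp
  qed
qed

text \<open>\<open>normalized_activation\<close> does not mention measurability; it is inherited
  from local integrability through the truncations to growing intervals, which agree with the
  function from some index on.\<close>

lemma weak_derivative_measurable:
  assumes "weak_derivative f f'"
  shows "f \<in> borel_measurable borel" "f' \<in> borel_measurable borel"
proof -
  have *: "h \<in> borel_measurable borel"
    if "\<And>a b. set_integrable lborel {a..b} h" for h :: "real \<Rightarrow> real"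
  proof (rule borel_measurable_LIMSEQ_metric)
    show "(\<lambda>x. indicator {- real n .. real n} x *\<^sub>R h x) \<in> borel_measurable borel" for n
      using that[of "- real n" "real n"] by (auto simp: set_integrable_def)
    fix x :: real assume "x \<in> space borel"
    have "\<forall>\<^sub>F n in sequentially. indicator {- real n .. real n} x *\<^sub>R h x = h x"
      using eventually_ge_at_top[of "nat \<lceil>\<bar>x\<bar>\<rceil>"]
    proof eventually_elim
      case (elim n)
      then have "\<bar>x\<bar> \<le> real n" by linarith
      then show ?case by (auto simp: abs_le_iff)
    qed
    then show "(\<lambda>n. indicator {- real n .. real n} x *\<^sub>R h x) \<longlonglongrightarrow> h x"
      by (rule tendsto_eventually)
  qed
  show "f \<in> borel_measurable borel" "f' \<in> borel_measurable borel"
    using assms by (auto intro!: * simp: weak_derivative_def)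
qed

text \<open>A parabola clipped at 0 has a kink at the radius R. Its square has a continuous
  derivative by \<open>max_square_deriv\<close>, and that square is what enters the test
  functions.\<close>

definition cutoff :: "real \<Rightarrow> real \<Rightarrow> real" where
  "cutoff R t = max 0 (1 - (t / R)\<^sup>2)"

lemma cutoff_bounds: "0 \<le> cutoff R t" "cutoff R t \<le> 1"
  by (auto simp: cutoff_def)

lemma cutoff_tendsto: "(\<lambda>n. cutoff (real (Suc n)) t) \<longlonglongrightarrow> 1"
proof -
  have "(\<lambda>n. 1 - (t / real (Suc n))\<^sup>2) \<longlonglongrightarrow> 1 - 0\<^sup>2"
    by (intro tendsto_intros real_tendsto_divide_at_top[OF tendsto_const] filterlim_compose[OF filterlim_real_sequentially filterlim_Suc])
  then have "(\<lambda>n. max 0 (1 - (t / real (Suc n))\<^sup>2)) \<longlonglongrightarrow> max 0 1"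
    by (intro tendsto_max tendsto_const) simp
  then show ?thesis by (simp add: cutoff_def)
qed

lemma std_normal_density_deriv:
  "(std_normal_density has_real_derivative - t * std_normal_density t) (at t)"
  unfolding std_normal_density_def[abs_def]
  by (auto intro!: derivative_eq_intros simp: field_simps)

text \<open>Integration by parts against \<open>p\<close> times the Gaussian density: the test function is cut off
  at radius \<open>R\<close> and \<open>R\<close> tends to infinity.\<close>

lemma weak_derivative_Stein:
  assumes w: "weak_derivative f f'"
    and f2: "integrable std_normal_distribution (\<lambda>x. (f x)\<^sup>2)"
    and f'2: "integrable std_normal_distribution (\<lambda>x. (f' x)\<^sup>2)"
  shows "(\<integral>x. f x * (x * poly p x - poly (pderiv p) x) \<partial>std_normal_distribution)
       = (\<integral>x. f' x * poly p x \<partial>std_normal_distribution)"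
proof -
  note [measurable] = weak_derivative_measurable[OF w]
  let ?g = std_normal_density
  have intf: "integrable lborel (\<lambda>x. ?g x * (f x * poly q x))" for q
    using Cauchy_Schwarz_integral(1)[OF _ _ f2 poly_sq_integrable[of q]]
    by (auto simp: integrable_density normal_density_nonneg)
  have intf': "integrable lborel (\<lambda>x. ?g x * (f' x * poly q x))" for q
    using Cauchy_Schwarz_integral(1)[OF _ _ f'2 poly_sq_integrable[of q]]
    by (auto simp: integrable_density normal_density_nonneg)
  define \<psi> where "\<psi> R t = poly p t * ?g t * (cutoff R t)\<^sup>2" for R t
  define \<psi>' where "\<psi>' R t = (poly (pderiv p) t - t * poly p t) * ?g t * (cutoff R t)\<^sup>2
      - poly p t * ?g t * (4 * t / R\<^sup>2 * cutoff R t)" for R t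
  have cd: "((\<lambda>t. (cutoff R t)\<^sup>2) has_real_derivative - (4 * t / R\<^sup>2 * cutoff R t)) (at t)" for R t
  proof -
    have "((\<lambda>t. 1 - (t / R)\<^sup>2) has_real_derivative - (2 * t / R\<^sup>2)) (at t)"
      \<comment> \<open>Division by 0 yields 0, so for R = 0 the cutoff is constantly 1 and the
        formula gives the derivative 0.\<close>
      by (cases "R = 0") (auto intro!: derivative_eq_intros simp: power2_eq_square)
    from DERIV_chain2[OF max_square_deriv this]
    show ?thesis unfolding cutoff_def by (simp add: algebra_simps)
  qed
  have \<psi>_deriv: "(\<psi> R has_real_derivative \<psi>' R t) (at t)" for R t
    unfolding \<psi>_def[abs_def] \<psi>'_def
    by (rule derivative_eq_intros cd std_normal_density_deriv refl | simp add: algebra_simps)+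
  have C1: "\<psi> R C1_differentiable_on UNIV" for R
    unfolding C1_differentiable_on_def
  proof (intro exI conjI ballI)
    show "(\<psi> R has_vector_derivative \<psi>' R t) (at t)" for t
      using \<psi>_deriv by (simp add: has_real_derivative_iff_has_vector_derivative)
    have "continuous_on UNIV ?g"
      using std_normal_density_deriv DERIV_isCont continuous_at_imp_continuous_on by blast
    then show "continuous_on UNIV (\<psi>' R)"
      unfolding \<psi>'_def[abs_def] cutoff_def
      by (cases "R = 0") (auto intro!: continuous_intros)
  qed
  have bdd: "bounded {t. \<psi> (real (Suc n)) t \<noteq> 0}" for n
  proof (rule bounded_subset[OF bounded_cbox[of "- real (Suc n)" "real (Suc n)"]], safe)
    fix t assume "\<psi> (real (Suc n)) t \<noteq> 0"
    then have "(t / real (Suc n))\<^sup>2 \<le> 1" by (auto simp: \<psi>_def cutoff_def max_def split: if_splits)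
    then have "\<bar>t\<bar> \<le> real (Suc n)" by (simp add: abs_square_le_1 del: of_nat_Suc)
    then show "t \<in> cbox (- real (Suc n)) (real (Suc n))" by auto
  qed
  have dpsi: "deriv (\<psi> R) = \<psi>' R" for R
    using \<psi>_deriv DERIV_imp_deriv by blast
  have eq: "(\<integral>t. f t * \<psi>' (real (Suc n)) t \<partial>lborel) = - (\<integral>t. f' t * \<psi> (real (Suc n)) t \<partial>lborel)" for n
    using w C1 bdd unfolding weak_derivative_def dpsi[symmetric] by blast
  have m[measurable]: "(\<lambda>t. cutoff R t) \<in> borel_measurable borel" for R
    unfolding cutoff_def by measurable
  have l1: "(\<lambda>n. \<integral>t. f' t * \<psi> (real (Suc n)) t \<partial>lborel) \<longlonglongrightarrow> (\<integral>t. ?g t * (f' t * poly p t) \<partial>lborel)"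
  proof (rule integral_dominated_convergence[where w="\<lambda>t. \<bar>?g t * (f' t * poly p t)\<bar>"])
    show "AE x in lborel. (\<lambda>i. f' x * \<psi> (real (Suc i)) x) \<longlonglongrightarrow> ?g x * (f' x * poly p x)"
    proof (intro AE_I2)
      fix x
      have "(\<lambda>i. f' x * (poly p x * ?g x * (cutoff (real (Suc i)) x)\<^sup>2)) \<longlonglongrightarrow> f' x * (poly p x * ?g x * 1\<^sup>2)"
        by (intro tendsto_intros cutoff_tendsto)
      then show "(\<lambda>i. f' x * \<psi> (real (Suc i)) x) \<longlonglongrightarrow> ?g x * (f' x * poly p x)"
        by (simp add: \<psi>_def mult_ac)
    qed
    show "AE x in lborel. norm (f' x * \<psi> (real (Suc i)) x) \<le> \<bar>?g x * (f' x * poly p x)\<bar>" for i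
    proof (intro AE_I2)
      fix x
      have "\<bar>?g x * (f' x * poly p x)\<bar> * (cutoff (real (Suc i)) x)\<^sup>2 \<le> \<bar>?g x * (f' x * poly p x)\<bar> * 1"
        using cutoff_bounds[of "real (Suc i)" x] by (intro mult_left_mono) (auto simp: power_le_one)
      then show "norm (f' x * \<psi> (real (Suc i)) x) \<le> \<bar>?g x * (f' x * poly p x)\<bar>"
        by (simp add: \<psi>_def abs_mult mult_ac)
    qed
  qed (use intf'[of p] in \<open>auto simp: \<psi>_def[abs_def]\<close>)
  have l2: "(\<lambda>n. \<integral>t. f t * \<psi>' (real (Suc n)) t \<partial>lborel)
      \<longlonglongrightarrow> (\<integral>t. ?g t * (f t * (poly (pderiv p) t - t * poly p t)) \<partial>lborel)"
  \<comment> \<open>The second summand dominates the term from differentiating the cutoff: its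
    factor 4 t / R^2 is at most 4 |t| in modulus, since the radii \<open>Suc n\<close> are at least
    1.\<close>
  proof (rule integral_dominated_convergence[where w="\<lambda>t. \<bar>?g t * (f t * poly (pderiv p - [:0,1:] * p) t)\<bar>
        + 4 * \<bar>?g t * (f t * poly ([:0,1:] * p) t)\<bar>"])
    show "AE x in lborel. (\<lambda>i. f x * \<psi>' (real (Suc i)) x) \<longlonglongrightarrow> ?g x * (f x * (poly (pderiv p) x - x * poly p x))"
    proof (intro AE_I2)
      fix x
      have z: "(\<lambda>i. 4 * x / (real (Suc i))\<^sup>2) \<longlonglongrightarrow> 0"
        by (intro real_tendsto_divide_at_top[OF tendsto_const] filterlim_pow_at_top
            filterlim_compose[OF filterlim_real_sequentially filterlim_Suc]) auto
      have "(\<lambda>i. f x * ((poly (pderiv p) x - x * poly p x) * ?g x * (cutoff (real (Suc i)) x)\<^sup>2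
      - poly p x * ?g x * (4 * x / (real (Suc i))\<^sup>2 * cutoff (real (Suc i)) x)))
         \<longlonglongrightarrow> f x * ((poly (pderiv p) x - x * poly p x) * ?g x * 1\<^sup>2 - poly p x * ?g x * (0 * 1))"
        by (intro tendsto_intros cutoff_tendsto z)
      then show "(\<lambda>i. f x * \<psi>' (real (Suc i)) x) \<longlonglongrightarrow> ?g x * (f x * (poly (pderiv p) x - x * poly p x))"
        by (simp add: \<psi>'_def mult_ac)
    qed
    show "AE x in lborel. norm (f x * \<psi>' (real (Suc i)) x) \<le> \<bar>?g x * (f x * poly (pderiv p - [:0,1:] * p) x)\<bar>
        + 4 * \<bar>?g x * (f x * poly ([:0,1:] * p) x)\<bar>" for i
    proof (intro AE_I2)
      fix x
      define c where "c = cutoff (real (Suc i)) x"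
      have c: "0 \<le> c" "c \<le> 1" using cutoff_bounds by (auto simp: c_def)
      have r: "1 \<le> (real (Suc i))\<^sup>2" by (intro one_le_power) simp
      have "\<bar>(poly (pderiv p) x - x * poly p x) * c\<^sup>2\<bar> \<le> \<bar>poly (pderiv p) x - x * poly p x\<bar> * 1"
        unfolding abs_mult using c by (intro mult_left_mono) (auto simp: power_le_one)
      moreover have "\<bar>poly p x * (4 * x / (real (Suc i))\<^sup>2 * c)\<bar> \<le> \<bar>poly p x\<bar> * (4 * \<bar>x\<bar> * 1)"
      proof -
        have "\<bar>4 * x\<bar> / (real (Suc i))\<^sup>2 \<le> \<bar>4 * x\<bar> / 1"
          using r by (intro divide_left_mono) auto
        then have "\<bar>4 * x\<bar> / (real (Suc i))\<^sup>2 * c \<le> \<bar>4 * x\<bar> * 1"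
          using c by (intro mult_mono) auto
        then show ?thesis unfolding abs_mult abs_divide using c by (intro mult_left_mono) auto
      qed
      ultimately have *: "\<bar>(poly (pderiv p) x - x * poly p x) * c\<^sup>2 - poly p x * (4 * x / (real (Suc i))\<^sup>2 * c)\<bar>
          \<le> \<bar>poly (pderiv p) x - x * poly p x\<bar> + 4 * \<bar>x * poly p x\<bar>"
        by (intro order_trans[OF abs_triangle_ineq4] add_mono) (auto simp: abs_mult mult_ac)
      have "norm (f x * \<psi>' (real (Suc i)) x) =
          \<bar>f x * ?g x\<bar> * \<bar>(poly (pderiv p) x - x * poly p x) * c\<^sup>2 - poly p x * (4 * x / (real (Suc i))\<^sup>2 * c)\<bar>"
        unfolding abs_mult[symmetric] \<psi>'_def c_def by (simp add: algebra_simps del: of_nat_Suc)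
      also have "\<dots> \<le> \<bar>f x * ?g x\<bar> * (\<bar>poly (pderiv p) x - x * poly p x\<bar> + 4 * \<bar>x * poly p x\<bar>)"
        by (intro mult_left_mono *) auto
      also have "\<dots> = \<bar>?g x * (f x * poly (pderiv p - [:0,1:] * p) x)\<bar>
        + 4 * \<bar>?g x * (f x * poly ([:0,1:] * p) x)\<bar>"
        by (simp add: abs_mult distrib_left mult_ac)
      finally show "norm (f x * \<psi>' (real (Suc i)) x) \<le> \<dots>" .
    qed
    show "integrable lborel (\<lambda>t. \<bar>?g t * (f t * poly (pderiv p - [:0,1:] * p) t)\<bar>
        + 4 * \<bar>?g t * (f t * poly ([:0,1:] * p) t)\<bar>)"
      by (intro Bochner_Integration.integrable_add integrable_abs integrable_mult_right intf)
  qed (auto simp: \<psi>'_def[abs_def])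
  have "(\<integral>t. ?g t * (f t * (poly (pderiv p) t - t * poly p t)) \<partial>lborel) = - (\<integral>t. ?g t * (f' t * poly p t) \<partial>lborel)"
    using LIMSEQ_unique[OF l2 tendsto_minus[OF l1, folded eq]] .
  also have "(\<integral>t. ?g t * (f t * (poly (pderiv p) t - t * poly p t)) \<partial>lborel)
     = - (\<integral>t. ?g t * (f t * (t * poly p t - poly (pderiv p) t)) \<partial>lborel)"
    by (subst Bochner_Integration.integral_minus[symmetric])
       (auto intro!: Bochner_Integration.integral_cong simp: algebra_simps)
  finally show ?thesis by (subst (1 2) integral_density) auto
qed

section \<open>Probabilists' Hermite polynomials\<close>

fun hermite :: "nat \<Rightarrow> real poly" where
  "hermite 0 = 1"
| "hermite (Suc n) = [:0, 1:] * hermite n - pderiv (hermite n)"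

text \<open>\<open>hermite\<close> iterates the raising operator x - d/dx, whose commutator with
  d/dx is the identity; each of the n + 1 raisings in \<open>hermite (Suc n)\<close> therefore
  contributes one copy of \<open>hermite n\<close>.\<close>

lemma pderiv_hermite: "pderiv (hermite (Suc n)) = Polynomial.smult (real (Suc n)) (hermite n)"
proof (induction n)
  case 0
  show ?case by (simp add: pderiv_pCons)
next
  case (Suc n)
  have "pderiv (hermite (Suc (Suc n))) =
      hermite (Suc n) + [:0, 1:] * pderiv (hermite (Suc n)) - pderiv (pderiv (hermite (Suc n)))"
    by (simp only: hermite.simps(2)[of "Suc n"] pderiv_diff pderiv_mult) (simp add: pderiv_pCons)
  also have "\<dots> = hermite (Suc n) + Polynomial.smult (real (Suc n)) ([:0, 1:] * hermite n - pderiv (hermite n))"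
    unfolding Suc.IH by (simp only: pderiv_smult smult_diff_right mult_smult_right)
  also have "\<dots> = Polynomial.smult (real (Suc (Suc n))) (hermite (Suc n))"
    using smult_add_left[of 1 "real (Suc n)" "hermite (Suc n)"] by simp
  finally show ?case .
qed

lemma poly_hermite_Suc:
  "poly (hermite (Suc n)) x = x * poly (hermite n) x - real n * poly (hermite (n - 1)) x"
proof (cases n)
  case (Suc m)
  have "poly (hermite (Suc n)) x = x * poly (hermite n) x - poly (pderiv (hermite n)) x"
    by (simp only: hermite.simps(2)) simp
  then show ?thesis unfolding Suc pderiv_hermite by simp
qed simp

abbreviation gauss_E :: "(real \<Rightarrow> real) \<Rightarrow> real" where
  "gauss_E f \<equiv> integral\<^sup>L std_normal_distribution f"

text \<open>Makes \<open>weak_derivative_Stein\<close> applicable to a constant, which is how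
  \<open>Stein_poly\<close> obtains Stein's identity for polynomials.\<close>

lemma weak_derivative_1: "weak_derivative (\<lambda>_. 1) (\<lambda>_. 0)"
  unfolding weak_derivative_def
proof (intro conjI allI impI)
  show "set_integrable lborel {a..b} (\<lambda>_. 1::real)" for a b :: real
    using borel_integrable_compact[of "{a..b}" "\<lambda>_. 1::real"] by (simp add: set_integrable_def)
  show "set_integrable lborel {a..b} (\<lambda>_. 0::real)" for a b :: real
    by (simp add: set_integrable_def)
  fix \<psi> :: "real \<Rightarrow> real"
  assume \<psi>: "\<psi> C1_differentiable_on UNIV \<and> bounded {t. \<psi> t \<noteq> 0}"
  then obtain D where D: "\<And>x. (\<psi> has_real_derivative D x) (at x)" "continuous_on UNIV D"
    unfolding C1_differentiable_on_def by (auto simp: has_real_derivative_iff_has_vector_derivative)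
  obtain R where R: "R > 0" "\<And>t. \<psi> t \<noteq> 0 \<Longrightarrow> \<bar>t\<bar> \<le> R"
    using \<psi> bounded_pos by (auto simp: bounded_pos)
  have z: "\<psi> t = 0" if "\<bar>t\<bar> > R" for t using R(2)[of t] that by force
  have Dz: "D t = 0" if "\<bar>t\<bar> > R" for t
  proof -
    have "((\<lambda>_. 0) has_real_derivative D t) (at t)"
    proof (rule has_field_derivative_transform_within_open[OF D(1)])
      show "open (- {-R..R})" by (intro open_Compl closed_real_atLeastAtMost)
    qed (use that z in auto)
    then show ?thesis using DERIV_unique[OF _ DERIV_const] by blast
  qed
  have Dz': "- R \<le> t \<and> t \<le> R" if "D t \<noteq> 0" for t
  proof -
    have "\<bar>t\<bar> \<le> R" using Dz[of t] that by (meson not_le)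
    then show ?thesis by (auto simp: abs_le_iff)
  qed
  have "deriv \<psi> = D" using D(1) DERIV_imp_deriv by blast
  have "(\<integral>t. 1 * deriv \<psi> t \<partial>lborel) = (\<integral>t. D t * indicator {-R..R} t \<partial>lborel)"
    unfolding \<open>deriv \<psi> = D\<close> using Dz'
    by (intro Bochner_Integration.integral_cong) (auto simp: indicator_def)
  also have "\<dots> = \<psi> R - \<psi> (-R)"
    using R D by (intro integral_FTC_Icc_real) (auto simp: continuous_on_eq_continuous_at)
  also have "\<dots> = 0"
  proof -
    have c: "isCont \<psi> t" for t using D(1) DERIV_isCont by blast
    \<comment> \<open>The bound on the support gives zeros only strictly beyond R, hence the passage
      to a one-sided limit.\<close>
    have "\<psi> R = 0"
    proof (rule tendsto_unique)
      show "(\<psi> \<longlongrightarrow> \<psi> R) (at_right R)"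
        using c[of R] by (auto simp: isCont_def intro: tendsto_within_subset)
      show "(\<psi> \<longlongrightarrow> 0) (at_right R)"
        by (rule tendsto_eventually, rule eventually_at_rightI[of R "R+1"]) (use z R in auto)
    qed simp
    moreover have "\<psi> (-R) = 0"
    proof (rule tendsto_unique)
      show "(\<psi> \<longlongrightarrow> \<psi> (-R)) (at_left (-R))"
        using c[of "-R"] by (auto simp: isCont_def intro: tendsto_within_subset)
      show "(\<psi> \<longlongrightarrow> 0) (at_left (-R))"
        by (rule tendsto_eventually, rule eventually_at_leftI[of "-R-1" "-R"]) (use z R in auto)
    qed simp
    ultimately show ?thesis by simp
  qed
  finally show "(\<integral>t. 1 * deriv \<psi> t \<partial>lborel) = - (\<integral>t. 0 * \<psi> t \<partial>lborel)" by simp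
qed

lemma poly_integrable': "integrable std_normal_distribution (\<lambda>x. poly p x * poly q x)"
proof -
  have "(\<lambda>x. poly p x * poly q x) = poly (p * q)" by (simp add: fun_eq_iff)
  then show ?thesis by (simp only: std_normal_moment_poly_integrable)
qed

lemma poly_integrable_x: "integrable std_normal_distribution (\<lambda>x. x * poly p x)"
  using poly_integrable'[of "[:0, 1:]" p] by simp

lemma Stein_poly: "gauss_E (\<lambda>x. x * poly p x) = gauss_E (poly (pderiv p))"
proof -
  interpret prob_space std_normal_distribution by (rule prob_space_std_normal)
  have "gauss_E (\<lambda>x. 1 * (x * poly p x - poly (pderiv p) x)) = gauss_E (\<lambda>x. 0 * poly p x)"
    by (rule weak_derivative_Stein[OF weak_derivative_1]) auto
  moreover have "gauss_E (\<lambda>x. 1 * (x * poly p x - poly (pderiv p) x))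
      = gauss_E (\<lambda>x. x * poly p x) - gauss_E (poly (pderiv p))"
    using Bochner_Integration.integral_diff[OF poly_integrable_x[of p] std_normal_moment_poly_integrable[of "pderiv p"]]
    by simp
  ultimately show ?thesis by simp
qed

text \<open>The raising operator is the adjoint of d/dx in the Gaussian L2 space: Stein's identity
  for the product \<open>p * hermite n\<close> yields two terms, one of which cancels against the
  derivative in \<open>hermite (Suc n)\<close>.\<close>

lemma hermite_shift:
  "gauss_E (\<lambda>x. poly p x * poly (hermite (Suc n)) x) = gauss_E (\<lambda>x. poly (pderiv p) x * poly (hermite n) x)"
proof -
  have "gauss_E (\<lambda>x. poly p x * poly (hermite (Suc n)) x)
     = gauss_E (\<lambda>x. x * poly (p * hermite n) x - poly p x * poly (pderiv (hermite n)) x)"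
    by (simp add: algebra_simps)
  also have "\<dots> = gauss_E (poly (pderiv (p * hermite n))) - gauss_E (\<lambda>x. poly p x * poly (pderiv (hermite n)) x)"
    using Bochner_Integration.integral_diff[OF poly_integrable_x[of "p * hermite n"] poly_integrable'[of p "pderiv (hermite n)"]]
    by (simp only: Stein_poly)
  also have "\<dots> = gauss_E (\<lambda>x. poly (pderiv p) x * poly (hermite n) x)"
    using poly_integrable'[of p "pderiv (hermite n)"] poly_integrable'[of "hermite n" "pderiv p"]
  proof -
    have "poly (pderiv (p * hermite n)) = (\<lambda>x. poly p x * poly (pderiv (hermite n)) x + poly (pderiv p) x * poly (hermite n) x)"
      by (simp add: fun_eq_iff pderiv_mult mult.commute)
    then show ?thesis
      using Bochner_Integration.integral_add[OF poly_integrable'[of p "pderiv (hermite n)"] poly_integrable'[of "pderiv p" "hermite n"]]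
      by simp
  qed
  finally show ?thesis .
qed

text \<open>By \<open>hermite_shift\<close> both indices drop together, with a factor equal to the
  index, until one of them is 0; a further shift differentiates a constant.\<close>

lemma hermite_orth:
  "gauss_E (\<lambda>x. poly (hermite j) x * poly (hermite k) x) = (if j = k then fact k else 0)"
proof (induction k arbitrary: j)
  case 0
  interpret prob_space std_normal_distribution by (rule prob_space_std_normal)
  show ?case
  proof (cases j)
    case 0 then show ?thesis using prob_space by simp
  next
    case (Suc i)
    then show ?thesis using hermite_shift[of 1 i] by (simp del: hermite.simps(2))
  qed
next
  case (Suc k)
  show ?case
  proof (cases j)
    case 0 then show ?thesis using hermite_shift[of 1 k] by (simp del: hermite.simps(2))
  next
    case (Suc i)
    then show ?thesis using hermite_shift[of "hermite (Suc i)" k] Suc.IH[of i]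
      by (simp add: pderiv_hermite mult.assoc del: hermite.simps(2))
  qed
qed

text \<open>Hermite polynomials are eigenfunctions of the Ornstein-Uhlenbeck noise operator. In the
  three-term recurrence, Stein's identity in w turns \<open>\<sigma> * w\<close> into
  \<open>\<sigma>\<^sup>2\<close> times a derivative, and
  \<open>\<sigma>\<^sup>2 - 1 = - \<rho>\<^sup>2\<close> restores the recurrence with the required
  powers of \<rho>.\<close>

lemma gauss_noise_hermite:
  assumes \<rho>: "\<bar>\<rho>\<bar> \<le> 1"
  shows "gauss_E (\<lambda>w. poly (hermite k) (\<rho> * u + sqrt (1 - \<rho>\<^sup>2) * w)) = \<rho> ^ k * poly (hermite k) u"
proof (induction k rule: less_induct)
  case (less k)
  interpret prob_space std_normal_distribution by (rule prob_space_std_normal)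
  define \<sigma> where "\<sigma> = sqrt (1 - \<rho>\<^sup>2)"
  have \<sigma>: "\<sigma>\<^sup>2 = 1 - \<rho>\<^sup>2" using \<rho> by (simp add: \<sigma>_def abs_square_le_1)
  let ?l = "[:\<rho> * u, \<sigma>:]"
  let ?Q = "\<lambda>p. gauss_E (\<lambda>w. poly p (\<rho> * u + \<sigma> * w))"
  have Qc: "poly p (\<rho> * u + \<sigma> * w) = poly (pcompose p ?l) w" for p w
    by (simp add: poly_pcompose algebra_simps)
  have i: "integrable std_normal_distribution (\<lambda>w. poly p (\<rho> * u + \<sigma> * w))" for p
    unfolding Qc by (rule std_normal_moment_poly_integrable)
  have i2: "integrable std_normal_distribution (\<lambda>w. w * poly p (\<rho> * u + \<sigma> * w))" for p
    using poly_integrable_x[of "pcompose p ?l"] by (simp only: Qc)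
  have S: "gauss_E (\<lambda>w. w * poly p (\<rho> * u + \<sigma> * w)) = \<sigma> * ?Q (pderiv p)" for p
  proof -
    have "gauss_E (\<lambda>w. w * poly p (\<rho> * u + \<sigma> * w)) = gauss_E (poly (pderiv (pcompose p ?l)))"
      unfolding Qc by (rule Stein_poly)
    also have "poly (pderiv (pcompose p ?l)) = (\<lambda>w. \<sigma> * poly (pderiv p) (\<rho> * u + \<sigma> * w))"
      unfolding Qc by (simp add: fun_eq_iff pderiv_pcompose pderiv_pCons)
    finally show ?thesis by simp
  qed
  show ?case
  proof (cases k)
    case 0 then show ?thesis using prob_space by simp
  next
    case (Suc n)
    have IH: "?Q (hermite n) = \<rho> ^ n * poly (hermite n) u"
      using less[of n] Suc by (simp add: \<sigma>_def)
    have IH': "real n * ?Q (hermite (n - 1)) = real n * (\<rho> ^ (n - 1) * poly (hermite (n - 1)) u)"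
      using less[of "n - 1"] Suc by (simp add: \<sigma>_def)
    have pd: "pderiv (hermite n) = Polynomial.smult (real n) (hermite (n - 1))"
      by (cases n) (simp_all add: pderiv_hermite del: hermite.simps(2))
    have "?Q (hermite (Suc n)) = gauss_E (\<lambda>w. \<rho> * u * poly (hermite n) (\<rho> * u + \<sigma> * w)
        + \<sigma> * (w * poly (hermite n) (\<rho> * u + \<sigma> * w)) - real n * poly (hermite (n - 1)) (\<rho> * u + \<sigma> * w))"
      unfolding poly_hermite_Suc by (simp add: algebra_simps)
    also have "\<dots> = \<rho> * u * ?Q (hermite n) + \<sigma> * (\<sigma> * ?Q (pderiv (hermite n))) - real n * ?Q (hermite (n - 1))"
      using i i2 S by simp
    also have "\<dots> = \<rho> * u * ?Q (hermite n) + (\<sigma>\<^sup>2 - 1) * (real n * ?Q (hermite (n - 1)))"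
      unfolding pd by (simp add: algebra_simps power2_eq_square)
    also have "\<dots> = \<rho> * u * \<rho> ^ n * poly (hermite n) u - \<rho>\<^sup>2 * (real n * (\<rho> ^ (n - 1) * poly (hermite (n - 1)) u))"
      unfolding IH IH' \<sigma> by simp
    also have "\<dots> = \<rho> ^ Suc n * poly (hermite (Suc n)) u"
      unfolding poly_hermite_Suc by (cases n) (simp_all add: algebra_simps power2_eq_square)
    finally show ?thesis unfolding Suc \<sigma>_def .
  qed
qed

section \<open>Completeness of the polynomials in the Gaussian L2 space\<close>

lemma integrable_exp_gauss: "integrable std_normal_distribution (\<lambda>x. exp (c * x))"
proof -
  have "std_normal_density x * exp (c * x) = exp (c\<^sup>2 / 2) * normal_density c 1 x" for x
    by (simp add: normal_density_def exp_add[symmetric] power2_eq_square field_simps)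
  moreover have "integrable lborel (\<lambda>x. exp (c\<^sup>2 / 2) * normal_density c 1 x)"
    by simp
  ultimately show ?thesis by (simp add: integrable_density normal_density_nonneg)
qed

lemma integrable_exp_abs_gauss: "integrable std_normal_distribution (\<lambda>x. exp (c * \<bar>x\<bar>))"
proof (rule Bochner_Integration.integrable_bound[OF Bochner_Integration.integrable_add[OF
        integrable_exp_gauss[of c] integrable_exp_gauss[of "-c"]]])
  have "exp (c * \<bar>x\<bar>) \<le> exp (c * x) + exp (- c * x)" for x by (simp add: abs_if)
  then show "AE x in std_normal_distribution. norm (exp (c * \<bar>x\<bar>)) \<le> norm (exp (c * x) + exp (- c * x))"
    by (auto intro!: AE_I2 order_trans[OF _ abs_ge_self])
qed simp

text \<open>Expanding the exponential, the Fourier transform of a function orthogonal to all monomials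
  vanishes; the uniqueness theorem for characteristic functions applies to its two signed parts.\<close>

lemma gauss_orthogonal_monomials:
  fixes g :: "real \<Rightarrow> real"
  assumes [measurable]: "g \<in> borel_measurable borel"
    and g2: "integrable std_normal_distribution (\<lambda>x. (g x)\<^sup>2)"
    and orth: "\<And>n. gauss_E (\<lambda>x. g x * x ^ n) = 0"
  shows "AE x in std_normal_distribution. g x = 0"
proof -
  interpret G: prob_space std_normal_distribution by (rule prob_space_std_normal)
  have gi: "integrable std_normal_distribution g"
    using Cauchy_Schwarz_integral(1)[OF _ _ g2 poly_sq_integrable[of 1]] by simp
  have gpow: "integrable std_normal_distribution (\<lambda>x. g x * x ^ n)" for n
    using Cauchy_Schwarz_integral(1)[OF _ _ g2 poly_sq_integrable[of "monom 1 n"]] by (simp add: poly_monom)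
  have F0: "(LINT x|std_normal_distribution. complex_of_real (g x) * iexp (t * x)) = 0" for t
  proof -
    let ?s = "\<lambda>N x. \<Sum>n<N. complex_of_real (g x * x ^ n) * ((\<i> * t) ^ n / fact n)"
    have "(\<lambda>N. LINT x|std_normal_distribution. ?s N x) \<longlonglongrightarrow>
        (LINT x|std_normal_distribution. complex_of_real (g x) * iexp (t * x))"
    \<comment> \<open>The majorant is integrable by Cauchy-Schwarz, because g and the exponential
      are both square integrable.\<close>
    proof (rule integral_dominated_convergence[where w="\<lambda>x. \<bar>g x\<bar> * exp (\<bar>t\<bar> * \<bar>x\<bar>)"])
      show "integrable std_normal_distribution (\<lambda>x. \<bar>g x\<bar> * exp (\<bar>t\<bar> * \<bar>x\<bar>))"
        using integrable_exp_abs_gauss[of "2 * \<bar>t\<bar>"] g2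
        by (intro Cauchy_Schwarz_integral(1)) (auto simp: exp_double[symmetric] mult.assoc)
      show "AE x in std_normal_distribution. (\<lambda>N. ?s N x) \<longlonglongrightarrow> complex_of_real (g x) * iexp (t * x)"
      proof (intro AE_I2)
        fix x
        have "(\<lambda>n. complex_of_real (g x) * ((\<i> * complex_of_real (t * x)) ^ n / fact n)) sums
           (complex_of_real (g x) * iexp (t * x))"
          by (intro sums_mult exp_converges[THEN sums_cong[THEN iffD1, rotated]])
             (simp add: scaleR_conv_of_real field_simps)
        then show "(\<lambda>N. ?s N x) \<longlonglongrightarrow> complex_of_real (g x) * iexp (t * x)"
          by (simp add: sums_def power_mult_distrib mult_ac)
      qed
      show "AE x in std_normal_distribution. norm (?s N x) \<le> \<bar>g x\<bar> * exp (\<bar>t\<bar> * \<bar>x\<bar>)" for N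
      proof (intro AE_I2)
        fix x
        have "norm (?s N x) \<le> (\<Sum>n<N. \<bar>g x\<bar> * ((\<bar>t\<bar> * \<bar>x\<bar>) ^ n / fact n))"
          by (intro order_trans[OF norm_sum] sum_mono)
             (simp add: norm_mult norm_divide norm_power abs_mult power_mult_distrib power_abs mult_ac)
        also have "\<dots> = \<bar>g x\<bar> * (\<Sum>n<N. (\<bar>t\<bar> * \<bar>x\<bar>) ^ n / fact n)" by (simp add: sum_distrib_left)
        also have "\<dots> \<le> \<bar>g x\<bar> * exp (\<bar>t\<bar> * \<bar>x\<bar>)"
        proof (intro mult_left_mono)
          have s: "(\<lambda>n. (\<bar>t\<bar> * \<bar>x\<bar>) ^ n / fact n) sums exp (\<bar>t\<bar> * \<bar>x\<bar>)"
            using exp_converges[of "\<bar>t\<bar> * \<bar>x\<bar>"] by (simp add: scaleR_conv_of_real field_simps)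
          show "(\<Sum>n<N. (\<bar>t\<bar> * \<bar>x\<bar>) ^ n / fact n) \<le> exp (\<bar>t\<bar> * \<bar>x\<bar>)"
            unfolding sums_unique[OF s] by (rule sum_le_suminf) (use s in \<open>auto simp: sums_iff\<close>)
        qed auto
        finally show "norm (?s N x) \<le> \<bar>g x\<bar> * exp (\<bar>t\<bar> * \<bar>x\<bar>)" .
      qed
    qed measurable
    moreover have "(LINT x|std_normal_distribution. ?s N x) = 0" for N
    proof -
      have "integrable std_normal_distribution (\<lambda>x. complex_of_real (g x * x ^ n) * ((\<i> * t) ^ n / fact n))" for n
        by (intro integrable_mult_left integrable_of_real gpow)
      then have "(LINT x|std_normal_distribution. ?s N x)
          = (\<Sum>n<N. LINT x|std_normal_distribution. complex_of_real (g x * x ^ n) * ((\<i> * t) ^ n / fact n))"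
        by (intro Bochner_Integration.integral_sum)
      also have "\<dots> = (\<Sum>n<N. complex_of_real (gauss_E (\<lambda>x. g x * x ^ n)) * ((\<i> * t) ^ n / fact n))"
        by (simp only: integral_mult_left_zero integral_complex_of_real)
      finally show ?thesis by (simp only: orth) simp
    qed
    ultimately show ?thesis by (simp add: LIMSEQ_const_iff)
  qed
  define gp gm where "gp x = max 0 (g x)" and "gm x = max 0 (- g x)" for x
  have [measurable]: "gp \<in> borel_measurable borel" "gm \<in> borel_measurable borel"
    unfolding gp_def[abs_def] gm_def[abs_def] by measurable
  have gpi: "integrable std_normal_distribution gp" and gmi: "integrable std_normal_distribution gm"
    unfolding gp_def[abs_def] gm_def[abs_def] using gi by auto
  have nn: "0 \<le> gp x" "0 \<le> gm x" and gd: "g x = gp x - gm x" for x by (auto simp: gp_def gm_def)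
  \<comment> \<open>Orthogonality to the constant 1 gives both signed parts the same mass m;
    dividing by m turns them into probability laws, to which Levy's uniqueness theorem
    applies.\<close>
  define m where "m = gauss_E gp"
  have m': "m = gauss_E gm"
  proof -
    have "gauss_E g = gauss_E gp - gauss_E gm" unfolding gd[abs_def] using gpi gmi by simp
    moreover have "gauss_E g = 0" using orth[of 0] by simp
    ultimately show ?thesis by (simp add: m_def)
  qed
  have "0 \<le> m" unfolding m_def using nn by simp
  show ?thesis
  proof (cases "m = 0")
    case True
    have "AE x in std_normal_distribution. gp x = 0" "AE x in std_normal_distribution. gm x = 0"
      using True integral_nonneg_eq_0_iff_AE[OF gpi] integral_nonneg_eq_0_iff_AE[OF gmi] nn
      by (auto simp: m_def m'[symmetric] simp flip: m')
    then show ?thesis by eventually_elim (simp add: gd)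
  next
    case False
    then have m0: "0 < m" using \<open>0 \<le> m\<close> by simp
    define Q where "Q h = density std_normal_distribution (\<lambda>x. ennreal (h x / m))" for h
    have rd: "real_distribution (Q h)" if [measurable]: "h \<in> borel_measurable borel"
      and "\<And>x. 0 \<le> h x" "gauss_E h = m" "integrable std_normal_distribution h" for h
    proof -
      have "(\<integral>\<^sup>+x. ennreal (h x / m) \<partial>std_normal_distribution) = ennreal (gauss_E (\<lambda>x. h x / m))"
        by (rule nn_integral_eq_integral) (use that m0 in auto)
      then have "emeasure (Q h) (space (Q h)) = ennreal (gauss_E (\<lambda>x. h x / m))"
        unfolding Q_def by (subst emeasure_density) auto
      then have "prob_space (Q h)" using that m0 by (intro prob_spaceI) simp
      then show ?thesis
        by (auto simp: real_distribution_def real_distribution_axioms_def Q_def)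
    qed
    have ch: "char (Q h) t = (LINT x|std_normal_distribution. complex_of_real (h x) * iexp (t * x)) / m"
      if [measurable]: "h \<in> borel_measurable borel" and h0: "\<And>x. 0 \<le> h x" for h t
    proof -
      have "char (Q h) t = (LINT x|std_normal_distribution. (h x / m) *\<^sub>R iexp (t * x))"
        unfolding char_def Q_def using m0 h0 by (subst integral_density) auto
      also have "\<dots> = (LINT x|std_normal_distribution. complex_of_real (h x) * iexp (t * x) / m)"
        by (intro Bochner_Integration.integral_cong) (auto simp: scaleR_conv_of_real)
      finally show ?thesis by simp
    qed
    have ii: "integrable std_normal_distribution (\<lambda>x. complex_of_real (h x) * iexp (t * x))"
      if "integrable std_normal_distribution h" for h t
      by (rule Bochner_Integration.integrable_bound[OF that])
         (use borel_measurable_integrable[OF that] in \<open>auto simp: norm_mult\<close>)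
    have "char (Q gp) t = char (Q gm) t" for t
    proof -
      have "(LINT x|std_normal_distribution. complex_of_real (gp x) * iexp (t * x)) -
          (LINT x|std_normal_distribution. complex_of_real (gm x) * iexp (t * x)) =
          (LINT x|std_normal_distribution. complex_of_real (g x) * iexp (t * x))"
        unfolding Bochner_Integration.integral_diff[OF ii[OF gpi] ii[OF gmi], symmetric]
        by (intro Bochner_Integration.integral_cong) (auto simp: gd algebra_simps)
      then show ?thesis using F0[of t] by (simp add: ch nn)
    qed
    then have "Q gp = Q gm"
      by (intro Levy_uniqueness rd) (auto simp: nn gpi gmi m_def[symmetric] m'[symmetric])
    then have "AE x in std_normal_distribution. ennreal (gp x / m) = ennreal (gm x / m)"
      unfolding Q_def by (intro G.density_unique) auto
    then show ?thesis by eventually_elim (use m0 nn in \<open>simp add: gd\<close>)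
  qed
qed

section \<open>Hermite coefficients and Parseval's identity\<close>

definition hermite_coeff :: "(real \<Rightarrow> real) \<Rightarrow> nat \<Rightarrow> real" where
  "hermite_coeff \<phi> k = gauss_E (\<lambda>x. \<phi> x * poly (hermite k) x) / sqrt (fact k)"

definition hermite_sum :: "(real \<Rightarrow> real) \<Rightarrow> nat \<Rightarrow> real poly" where
  "hermite_sum \<phi> N = (\<Sum>k<N. Polynomial.smult (hermite_coeff \<phi> k / sqrt (fact k)) (hermite k))"

locale gauss_L2 =
  fixes \<phi> :: "real \<Rightarrow> real"
  assumes meas[measurable]: "\<phi> \<in> borel_measurable borel"
    and sq: "integrable std_normal_distribution (\<lambda>x. (\<phi> x)\<^sup>2)"
begin

abbreviation "c \<equiv> hermite_coeff \<phi>"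
abbreviation "P \<equiv> hermite_sum \<phi>"

lemma mult_poly: "integrable std_normal_distribution (\<lambda>x. \<phi> x * poly p x)"
  using Cauchy_Schwarz_integral(1)[OF _ _ sq poly_sq_integrable[of p]] by simp

lemma E_smult_sum:
  assumes "\<And>p. integrable std_normal_distribution (\<lambda>x. h x * poly p x)"
  shows "gauss_E (\<lambda>x. h x * poly (\<Sum>k<N. Polynomial.smult (d k) (hermite k)) x)
    = (\<Sum>k<N. d k * gauss_E (\<lambda>x. h x * poly (hermite k) x))"
proof -
  have "gauss_E (\<lambda>x. h x * poly (\<Sum>k<N. Polynomial.smult (d k) (hermite k)) x)
      = gauss_E (\<lambda>x. \<Sum>k<N. d k * (h x * poly (hermite k) x))"
    by (simp add: poly_sum sum_distrib_left mult_ac)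
  also have "\<dots> = (\<Sum>k<N. gauss_E (\<lambda>x. d k * (h x * poly (hermite k) x)))"
    by (intro Bochner_Integration.integral_sum integrable_mult_right assms)
  finally show ?thesis by simp
qed

lemma E_hermite: "gauss_E (\<lambda>x. \<phi> x * poly (hermite k) x) = c k * sqrt (fact k)"
  by (simp add: hermite_coeff_def)

lemma E_P_hermite: "gauss_E (\<lambda>x. poly (P N) x * poly (hermite k) x) = (if k < N then c k * sqrt (fact k) else 0)"
proof -
  have "gauss_E (\<lambda>x. poly (P N) x * poly (hermite k) x)
      = gauss_E (\<lambda>x. poly (hermite k) x * poly (P N) x)" by (simp add: mult.commute)
  also have "\<dots> = (\<Sum>j<N. c j / sqrt (fact j) * gauss_E (\<lambda>x. poly (hermite k) x * poly (hermite j) x))"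
    unfolding hermite_sum_def by (rule E_smult_sum[OF poly_integrable'])
  also have "\<dots> = (\<Sum>j<N. if j = k then c k * sqrt (fact k) else 0)"
  proof (intro sum.cong refl)
    have "sqrt (fact k) * sqrt (fact k) = (fact k :: real)" by simp
    then show "c j / sqrt (fact j) * gauss_E (\<lambda>x. poly (hermite k) x * poly (hermite j) x)
        = (if j = k then c k * sqrt (fact k) else 0)" for j
      unfolding hermite_orth by (auto simp: field_simps)
  qed
  also have "\<dots> = (if k < N then c k * sqrt (fact k) else 0)" by simp
  finally show ?thesis .
qed

lemma E_phi_P: "gauss_E (\<lambda>x. \<phi> x * poly (P N) x) = (\<Sum>k<N. (c k)\<^sup>2)"
  unfolding hermite_sum_def E_smult_sum[OF mult_poly] E_hermite
  by (simp add: power2_eq_square)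

lemma E_P_P: "M \<le> N \<Longrightarrow> gauss_E (\<lambda>x. poly (P N) x * poly (P M) x) = (\<Sum>k<M. (c k)\<^sup>2)"
proof -
  assume "M \<le> N"
  have "gauss_E (\<lambda>x. poly (P N) x * poly (P M) x)
    = (\<Sum>k<M. c k / sqrt (fact k) * gauss_E (\<lambda>x. poly (P N) x * poly (hermite k) x))"
    unfolding hermite_sum_def[of _ M] by (rule E_smult_sum[OF poly_integrable'])
  also have "\<dots> = (\<Sum>k<M. (c k)\<^sup>2)"
    using \<open>M \<le> N\<close> by (intro sum.cong) (auto simp: E_P_hermite power2_eq_square)
  finally show ?thesis .
qed

lemma E_P_diff: "M \<le> N \<Longrightarrow> gauss_E (\<lambda>x. (poly (P N) x - poly (P M) x)\<^sup>2) = (\<Sum>k<N. (c k)\<^sup>2) - (\<Sum>k<M. (c k)\<^sup>2)"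
proof -
  assume MN: "M \<le> N"
  have "gauss_E (\<lambda>x. (poly (P N) x - poly (P M) x)\<^sup>2)
      = gauss_E (\<lambda>x. poly (P N) x * poly (P N) x - 2 * (poly (P N) x * poly (P M) x) + poly (P M) x * poly (P M) x)"
    by (intro Bochner_Integration.integral_cong) (auto simp: power2_eq_square algebra_simps)
  also have "\<dots> = gauss_E (\<lambda>x. poly (P N) x * poly (P N) x) - 2 * gauss_E (\<lambda>x. poly (P N) x * poly (P M) x)
      + gauss_E (\<lambda>x. poly (P M) x * poly (P M) x)"
    using poly_integrable' by simp
  finally show ?thesis using MN by (simp add: E_P_P)
qed

lemma diff_sq_integrable: "integrable std_normal_distribution (\<lambda>x. (\<phi> x - poly p x)\<^sup>2)"
proof -
  have "integrable std_normal_distribution (\<lambda>x. (\<phi> x)\<^sup>2 - 2 * (\<phi> x * poly p x) + (poly p x)\<^sup>2)"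
    by (intro Bochner_Integration.integrable_add Bochner_Integration.integrable_diff sq integrable_mult_right mult_poly poly_sq_integrable)
  then show ?thesis by (simp add: power2_diff algebra_simps)
qed

lemma E_phi_P_diff: "gauss_E (\<lambda>x. (\<phi> x - poly (P N) x)\<^sup>2) = gauss_E (\<lambda>x. (\<phi> x)\<^sup>2) - (\<Sum>k<N. (c k)\<^sup>2)"
proof -
  have "gauss_E (\<lambda>x. (\<phi> x - poly (P N) x)\<^sup>2)
      = gauss_E (\<lambda>x. (\<phi> x)\<^sup>2 - 2 * (\<phi> x * poly (P N) x) + poly (P N) x * poly (P N) x)"
    by (intro Bochner_Integration.integral_cong) (auto simp: power2_eq_square algebra_simps)
  also have "\<dots> = gauss_E (\<lambda>x. (\<phi> x)\<^sup>2) - 2 * gauss_E (\<lambda>x. \<phi> x * poly (P N) x)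
      + gauss_E (\<lambda>x. poly (P N) x * poly (P N) x)"
    using poly_integrable' sq mult_poly by simp
  finally show ?thesis by (simp add: E_P_P E_phi_P)
qed

lemma Bessel: "(\<Sum>k<N. (c k)\<^sup>2) \<le> gauss_E (\<lambda>x. (\<phi> x)\<^sup>2)"
proof -
  have "0 \<le> gauss_E (\<lambda>x. (\<phi> x - poly (P N) x)\<^sup>2)" by simp
  then show ?thesis unfolding E_phi_P_diff by simp
qed

lemma coeff_summable: "summable (\<lambda>k. (c k)\<^sup>2)"
  using Bessel by (intro summableI_nonneg_bounded[where x="gauss_E (\<lambda>x. (\<phi> x)\<^sup>2)"]) auto

text \<open>Riesz--Fischer: a subsequence of the partial sums converges almost everywhere, and the limit
  differs from \<open>\<phi>\<close> by a function orthogonal to all polynomials.\<close>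

lemma Parseval: "(\<lambda>k. (c k)\<^sup>2) sums gauss_E (\<lambda>x. (\<phi> x)\<^sup>2)"
proof -
  interpret G: prob_space std_normal_distribution by (rule prob_space_std_normal)
  let ?S = "\<lambda>n x. poly (P n) x"
  define s where "s N = (\<Sum>k<N. (c k)\<^sup>2)" for N
  define T where "T = (\<Sum>k. (c k)\<^sup>2)"
  have sT: "s \<longlonglongrightarrow> T" and s_le: "s N \<le> T" for N
    using summable_LIMSEQ[OF coeff_summable] sum_le_suminf[OF coeff_summable, of "{..<N}"]
    by (auto simp: s_def[abs_def] T_def)
  have Pd: "gauss_E (\<lambda>x. (?S i x - ?S j x)\<^sup>2) = \<bar>s i - s j\<bar>" for i j
  proof (cases "i \<le> j")
    case True
    have "s i \<le> s j" unfolding s_def using True by (intro sum_mono2) auto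
    then show ?thesis using E_P_diff[OF True] by (simp add: s_def power2_commute[of "?S i _"])
  next
    case False
    have "s j \<le> s i" unfolding s_def using False by (intro sum_mono2) auto
    then show ?thesis using E_P_diff[of j i] False by (simp add: s_def)
  qed
  \<comment> \<open>The subsequence argument takes place in L1, and on a probability space the L1
    distance is at most the L2 distance.\<close>
  have L1: "gauss_E (\<lambda>x. norm (?S i x - ?S j x)) \<le> sqrt \<bar>s i - s j\<bar>" for i j
  proof -
    have "(gauss_E (\<lambda>x. norm (?S i x - ?S j x) * 1))\<^sup>2 \<le> gauss_E (\<lambda>x. (norm (?S i x - ?S j x))\<^sup>2) * gauss_E (\<lambda>x. 1\<^sup>2)"
      using poly_sq_integrable[of "P i - P j"] by (intro Cauchy_Schwarz_integral(2)) auto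
    then have "(gauss_E (\<lambda>x. norm (?S i x - ?S j x)))\<^sup>2 \<le> \<bar>s i - s j\<bar>"
      using G.prob_space by (simp add: Pd)
    then show ?thesis by (rule real_le_rsqrt)
  qed
  have "\<exists>N. \<forall>i\<ge>N. \<forall>j\<ge>N. gauss_E (\<lambda>x. norm (?S i x - ?S j x)) < e" if "e > 0" for e
  proof -
    have "0 < e\<^sup>2" using that by simp
    then obtain N where N: "\<And>i j. i \<ge> N \<Longrightarrow> j \<ge> N \<Longrightarrow> \<bar>s i - s j\<bar> < e\<^sup>2"
      using LIMSEQ_imp_Cauchy[OF sT] unfolding Cauchy_def dist_real_def by blast
    have "gauss_E (\<lambda>x. norm (?S i x - ?S j x)) < e" if "i \<ge> N" "j \<ge> N" for i j
    proof -
      have "sqrt \<bar>s i - s j\<bar> < sqrt (e\<^sup>2)" using N[OF that] by (rule real_sqrt_less_mono)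
      then show ?thesis using L1[of i j] \<open>e > 0\<close> by simp
    qed
    then show ?thesis by blast
  qed
  then obtain r where r: "strict_mono r" "AE x in std_normal_distribution. Cauchy (\<lambda>i. ?S (r i) x)"
    using cauchy_L1_AE_cauchy_subseq[of std_normal_distribution ?S] std_normal_moment_poly_integrable by blast
  define F where "F x = lim (\<lambda>i. ?S (r i) x)" for x
  have [measurable]: "F \<in> borel_measurable borel" unfolding F_def[abs_def] by measurable
  have lim: "AE x in std_normal_distribution. (\<lambda>i. ?S (r i) x) \<longlonglongrightarrow> F x"
    using r(2) by eventually_elim (simp add: F_def Cauchy_convergent convergent_LIMSEQ_iff[symmetric])
  \<comment> \<open>Fatou's lemma along the subsequence: the squared L2 distance from F to the
    partial sum of order M is at most the remaining coefficient mass, so F inherits every Hermite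
    coefficient of \<phi> (\<open>FH\<close>).\<close>
  have Fatou: "(\<integral>\<^sup>+x. ennreal ((F x - ?S M x)\<^sup>2) \<partial>std_normal_distribution) \<le> ennreal (T - s M)" for M
  proof -
    have "(\<integral>\<^sup>+x. ennreal ((F x - ?S M x)\<^sup>2) \<partial>std_normal_distribution)
       = (\<integral>\<^sup>+x. liminf (\<lambda>i. ennreal ((?S (r i) x - ?S M x)\<^sup>2)) \<partial>std_normal_distribution)"
    proof (rule nn_integral_cong_AE)
      show "AE x in std_normal_distribution. ennreal ((F x - ?S M x)\<^sup>2) = liminf (\<lambda>i. ennreal ((?S (r i) x - ?S M x)\<^sup>2))"
        using lim
      proof eventually_elim
        case (elim x)
        have "(\<lambda>i. ennreal ((?S (r i) x - ?S M x)\<^sup>2)) \<longlonglongrightarrow> ennreal ((F x - ?S M x)\<^sup>2)"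
          by (intro tendsto_intros elim)
        then show ?case by (rule lim_imp_Liminf[OF trivial_limit_sequentially, symmetric])
      qed
    qed
    also have "\<dots> \<le> liminf (\<lambda>i. \<integral>\<^sup>+x. ennreal ((?S (r i) x - ?S M x)\<^sup>2) \<partial>std_normal_distribution)"
      by (rule nn_integral_liminf) measurable
    also have "\<dots> = liminf (\<lambda>i. ennreal \<bar>s (r i) - s M\<bar>)"
    proof -
      have "(\<integral>\<^sup>+x. ennreal ((?S i x - ?S M x)\<^sup>2) \<partial>std_normal_distribution) = ennreal \<bar>s i - s M\<bar>" for i
        unfolding Pd[symmetric] using poly_sq_integrable[of "P i - P M"] by (intro nn_integral_eq_integral) auto
      then show ?thesis by simp
    qed
    also have "\<dots> = ennreal \<bar>T - s M\<bar>"
    proof (rule lim_imp_Liminf)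
      show "(\<lambda>i. ennreal \<bar>s (r i) - s M\<bar>) \<longlonglongrightarrow> ennreal \<bar>T - s M\<bar>"
        using LIMSEQ_subseq_LIMSEQ[OF sT r(1)] by (intro tendsto_intros) (simp add: o_def)
    qed simp
    finally show ?thesis using s_le[of M] by simp
  qed
  have Fsq: "integrable std_normal_distribution (\<lambda>x. (F x - ?S M x)\<^sup>2)" for M
    using Fatou[of M] by (intro integrableI_nonneg) (auto intro: le_less_trans)
  have FsqE: "gauss_E (\<lambda>x. (F x - ?S M x)\<^sup>2) \<le> T - s M" for M
    using Fatou[of M] nn_integral_eq_integral[OF Fsq[of M]] s_le[of M] by (simp add: ennreal_le_iff)
  have F2: "integrable std_normal_distribution (\<lambda>x. (F x)\<^sup>2)" using Fsq[of 0] by (simp add: hermite_sum_def)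
  have [measurable]: "(\<lambda>x. F x - \<phi> x) \<in> borel_measurable borel" by measurable
  have D2: "integrable std_normal_distribution (\<lambda>x. (\<phi> x - F x)\<^sup>2)"
  proof (rule Bochner_Integration.integrable_bound[OF Bochner_Integration.integrable_add[OF
        integrable_mult_right[OF sq, of 2] integrable_mult_right[OF F2, of 2]]])
    show "AE x in std_normal_distribution. norm ((\<phi> x - F x)\<^sup>2) \<le> norm (2 * (\<phi> x)\<^sup>2 + 2 * (F x)\<^sup>2)"
    proof (intro AE_I2)
      fix x
      have "0 \<le> (\<phi> x + F x)\<^sup>2" by simp
      then have "(\<phi> x - F x)\<^sup>2 \<le> 2 * (\<phi> x)\<^sup>2 + 2 * (F x)\<^sup>2"
        by (simp add: power2_eq_square algebra_simps)
      then show "norm ((\<phi> x - F x)\<^sup>2) \<le> norm (2 * (\<phi> x)\<^sup>2 + 2 * (F x)\<^sup>2)"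
        by simp
    qed
  qed simp
  have Fpoly: "integrable std_normal_distribution (\<lambda>x. F x * poly p x)" for p
    using Cauchy_Schwarz_integral(1)[OF _ _ F2 poly_sq_integrable[of p]] by simp
  have FH: "gauss_E (\<lambda>x. F x * poly (hermite k) x) = c k * sqrt (fact k)" for k
  proof -
    have le: "(gauss_E (\<lambda>x. F x * poly (hermite k) x) - c k * sqrt (fact k))\<^sup>2 \<le> (T - s M) * fact k" if "M > k" for M
    proof -
      have "gauss_E (\<lambda>x. F x * poly (hermite k) x) - c k * sqrt (fact k)
        = gauss_E (\<lambda>x. F x * poly (hermite k) x) - gauss_E (\<lambda>x. ?S M x * poly (hermite k) x)"
        using that by (simp add: E_P_hermite)
      also have "\<dots> = gauss_E (\<lambda>x. (F x - ?S M x) * poly (hermite k) x)"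
        using Fpoly poly_integrable' by (simp add: left_diff_distrib)
      finally have "(gauss_E (\<lambda>x. F x * poly (hermite k) x) - c k * sqrt (fact k))\<^sup>2
          \<le> gauss_E (\<lambda>x. (F x - ?S M x)\<^sup>2) * gauss_E (\<lambda>x. (poly (hermite k) x)\<^sup>2)"
        using Cauchy_Schwarz_integral(2)[OF _ _ Fsq[of M] poly_sq_integrable[of "hermite k"]] by simp
      also have "gauss_E (\<lambda>x. (poly (hermite k) x)\<^sup>2) = fact k"
        using hermite_orth[of k k] by (simp add: power2_eq_square)
      finally show ?thesis by (rule order_trans) (intro mult_right_mono FsqE, simp)
    qed
    have "(\<lambda>M. (T - s M) * fact k) \<longlonglongrightarrow> (T - T) * fact k" by (intro tendsto_intros sT)
    then have "(gauss_E (\<lambda>x. F x * poly (hermite k) x) - c k * sqrt (fact k))\<^sup>2 \<le> 0"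
      using le by (intro LIMSEQ_le_const[where X="\<lambda>M. (T - s M) * fact k"]) (auto intro!: exI[of _ "Suc k"])
    then show ?thesis by simp
  qed
  have D_poly: "integrable std_normal_distribution (\<lambda>x. (\<phi> x - F x) * poly p x)" for p
    using Cauchy_Schwarz_integral(1)[OF _ _ D2 poly_sq_integrable[of p]] by simp
  have D_herm: "gauss_E (\<lambda>x. (\<phi> x - F x) * poly (hermite k) x) = 0" for k
    using FH[of k] E_hermite[of k] Fpoly mult_poly by (simp add: left_diff_distrib)
  \<comment> \<open>Multiplication by x sends \<open>hermite k\<close> to a combination of its two
    neighbours, so induction on the exponent, for all k at once, reaches every monomial from the
    Hermite orthogonality.\<close>
  have D_mon: "gauss_E (\<lambda>x. (\<phi> x - F x) * (x ^ n * poly (hermite k) x)) = 0" for n k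
  proof (induction n arbitrary: k)
    case (Suc n)
    have ig: "integrable std_normal_distribution (\<lambda>x. (\<phi> x - F x) * (x ^ n * poly (hermite k) x))" for k
      using D_poly[of "monom 1 n * hermite k"] by (simp add: poly_monom)
    have "x ^ Suc n * poly (hermite k) x = x ^ n * poly (hermite (Suc k)) x + real k * (x ^ n * poly (hermite (k - 1)) x)" for x
      unfolding poly_hermite_Suc by (simp add: algebra_simps)
    then have "gauss_E (\<lambda>x. (\<phi> x - F x) * (x ^ Suc n * poly (hermite k) x)) =
      gauss_E (\<lambda>x. (\<phi> x - F x) * (x ^ n * poly (hermite (Suc k)) x) + real k * ((\<phi> x - F x) * (x ^ n * poly (hermite (k - 1)) x)))"
      by (simp only: distrib_left mult.left_commute[of _ "real k"])
    also have "\<dots> = gauss_E (\<lambda>x. (\<phi> x - F x) * (x ^ n * poly (hermite (Suc k)) x))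
       + real k * gauss_E (\<lambda>x. (\<phi> x - F x) * (x ^ n * poly (hermite (k - 1)) x))"
      using ig[of "Suc k"] ig[of "k - 1"] by (simp del: hermite.simps)
    finally show ?case using Suc by (simp del: hermite.simps)
  qed (simp add: D_herm)
  have "AE x in std_normal_distribution. \<phi> x - F x = 0"
    by (rule gauss_orthogonal_monomials[OF _ D2]) (use D_mon[of _ 0] in auto)
  then have "gauss_E (\<lambda>x. (\<phi> x - ?S M x)\<^sup>2) = gauss_E (\<lambda>x. (F x - ?S M x)\<^sup>2)" for M
    by (intro integral_cong_AE) (auto elim!: eventually_mono)
  then have "gauss_E (\<lambda>x. (\<phi> x)\<^sup>2) - s M \<le> T - s M" for M
    using FsqE[of M] E_phi_P_diff[of M] by (simp add: s_def)
  then have "gauss_E (\<lambda>x. (\<phi> x)\<^sup>2) \<le> T" by simp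
  moreover have "T \<le> gauss_E (\<lambda>x. (\<phi> x)\<^sup>2)"
    using Bessel sT by (intro LIMSEQ_le_const2[of s T]) (auto simp: s_def)
  ultimately show ?thesis using summable_sums[OF coeff_summable] by (simp add: T_def)
qed

end

section \<open>Correlated Gaussian pairs\<close>

lemma char_gauss: "(LINT x|std_normal_distribution. iexp (t * x)) = complex_of_real (exp (- t\<^sup>2 / 2))"
  using char_std_normal_distribution by (simp add: char_def fun_eq_iff)

abbreviation gauss2 :: "(real \<times> real) measure" where
  "gauss2 \<equiv> std_normal_distribution \<Otimes>\<^sub>M std_normal_distribution"

definition gauss_mix :: "real \<Rightarrow> real \<times> real \<Rightarrow> real" where
  "gauss_mix \<rho> z = \<rho> * fst z + sqrt (1 - \<rho>\<^sup>2) * snd z"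

lemma gauss_mix_measurable[measurable]: "gauss_mix \<rho> \<in> borel_measurable (borel \<Otimes>\<^sub>M borel)"
  unfolding gauss_mix_def[abs_def] by measurable

lemma sets_gauss2[measurable_cong]: "sets gauss2 = sets (borel \<Otimes>\<^sub>M borel)"
  by (intro sets_pair_measure_cong) auto

lemma gauss_pair_space: "pair_prob_space std_normal_distribution std_normal_distribution"
  by (simp add: pair_prob_space_def pair_sigma_finite_def prob_space_std_normal prob_space_imp_sigma_finite)

lemma distr_fst_gauss: "distr gauss2 borel fst = std_normal_distribution"
proof -
  have "distr gauss2 std_normal_distribution fst = std_normal_distribution"
    by (rule prob_space.distr_pair_fst[OF prob_space_std_normal])
  moreover have "distr gauss2 borel fst = distr gauss2 std_normal_distribution fst"
    by (rule distr_cong) auto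
  ultimately show ?thesis by simp
qed

text \<open>By independence the characteristic function is a product of two Gaussian ones, and the
  squared weights of signal and noise add up to 1. The degenerate case of weight 0 on the noise is
  included.\<close>

lemma distr_mix_gauss:
  assumes \<rho>: "\<bar>\<rho>\<bar> \<le> 1"
  shows "distr gauss2 borel (gauss_mix \<rho>) = std_normal_distribution"
proof (rule Levy_uniqueness)
  interpret P: pair_prob_space std_normal_distribution std_normal_distribution by (rule gauss_pair_space)
  show "real_distribution (distr gauss2 borel (gauss_mix \<rho>))"
    by (intro P.real_distribution_distr) measurable
  show "real_distribution std_normal_distribution" by (rule real_dist_normal_dist)
  define \<sigma> where "\<sigma> = sqrt (1 - \<rho>\<^sup>2)"
  have \<sigma>: "\<sigma>\<^sup>2 = 1 - \<rho>\<^sup>2" using \<rho> by (simp add: \<sigma>_def abs_square_le_1)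
  show "char (distr gauss2 borel (gauss_mix \<rho>)) = char std_normal_distribution"
  proof
    fix t
    have "char (distr gauss2 borel (gauss_mix \<rho>)) t = (LINT z|gauss2. iexp (t * gauss_mix \<rho> z))"
      unfolding char_def by (rule integral_distr) measurable
    also have "\<dots> = (LINT z|gauss2. iexp (t * \<rho> * fst z) * iexp (t * \<sigma> * snd z))"
      by (intro Bochner_Integration.integral_cong)
         (auto simp: gauss_mix_def \<sigma>_def exp_add[symmetric] algebra_simps)
    also have "\<dots> = (LINT u|std_normal_distribution. LINT w|std_normal_distribution. iexp (t * \<rho> * u) * iexp (t * \<sigma> * w))"
    proof (subst P.integral_fst'[symmetric])
      show "integrable gauss2 (\<lambda>z. iexp (t * \<rho> * fst z) * iexp (t * \<sigma> * snd z))"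
        by (rule P.integrable_const_bound[where B=1]) (auto simp: norm_mult)
    qed simp
    also have "\<dots> = complex_of_real (exp (- (t * \<rho>)\<^sup>2 / 2)) * complex_of_real (exp (- (t * \<sigma>)\<^sup>2 / 2))"
      by (simp add: char_gauss del: of_real_mult)
    also have "\<dots> = complex_of_real (exp (- t\<^sup>2 / 2))"
      unfolding of_real_mult[symmetric] exp_add[symmetric]
      by (simp add: power_mult_distrib \<sigma> add_divide_distrib[symmetric] algebra_simps)
    finally show "char (distr gauss2 borel (gauss_mix \<rho>)) t = char std_normal_distribution t"
      by (simp add: char_std_normal_distribution)
  qed
qed

lemma gauss2_fst:
  fixes f :: "real \<Rightarrow> real"
  assumes [measurable]: "f \<in> borel_measurable borel"
  shows "integrable gauss2 (\<lambda>z. f (fst z)) \<longleftrightarrow> integrable std_normal_distribution f"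
    "(\<integral>z. f (fst z) \<partial>gauss2) = gauss_E f"
proof -
  have m: "fst \<in> gauss2 \<rightarrow>\<^sub>M borel" by measurable
  show "integrable gauss2 (\<lambda>z. f (fst z)) \<longleftrightarrow> integrable std_normal_distribution f"
    using integrable_distr_eq[OF m assms] by (simp add: distr_fst_gauss)
  show "(\<integral>z. f (fst z) \<partial>gauss2) = gauss_E f"
    using integral_distr[OF m assms] by (simp add: distr_fst_gauss)
qed

lemma gauss2_mix:
  fixes f :: "real \<Rightarrow> real"
  assumes [measurable]: "f \<in> borel_measurable borel" and \<rho>: "\<bar>\<rho>\<bar> \<le> 1"
  shows "integrable gauss2 (\<lambda>z. f (gauss_mix \<rho> z)) \<longleftrightarrow> integrable std_normal_distribution f"
    "(\<integral>z. f (gauss_mix \<rho> z) \<partial>gauss2) = gauss_E f"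
proof -
  have m: "gauss_mix \<rho> \<in> gauss2 \<rightarrow>\<^sub>M borel" by measurable
  show "integrable gauss2 (\<lambda>z. f (gauss_mix \<rho> z)) \<longleftrightarrow> integrable std_normal_distribution f"
    using integrable_distr_eq[OF m assms(1)] by (simp add: distr_mix_gauss[OF \<rho>])
  show "(\<integral>z. f (gauss_mix \<rho> z) \<partial>gauss2) = gauss_E f"
    using integral_distr[OF m assms(1)] by (simp add: distr_mix_gauss[OF \<rho>])
qed

text \<open>Two separate arguments allow the factors of the dual activation to be approximated one
  after the other.\<close>

definition mix_form :: "real \<Rightarrow> (real \<Rightarrow> real) \<Rightarrow> (real \<Rightarrow> real) \<Rightarrow> real" where
  "mix_form \<rho> f h = (\<integral>z. f (fst z) * h (gauss_mix \<rho> z) \<partial>gauss2)"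

lemma mix_form:
  fixes f h :: "real \<Rightarrow> real"
  assumes [measurable]: "f \<in> borel_measurable borel" "h \<in> borel_measurable borel" and \<rho>: "\<bar>\<rho>\<bar> \<le> 1"
    and f: "integrable std_normal_distribution (\<lambda>x. (f x)\<^sup>2)"
    and h: "integrable std_normal_distribution (\<lambda>x. (h x)\<^sup>2)"
  shows "integrable gauss2 (\<lambda>z. f (fst z) * h (gauss_mix \<rho> z))"
    and "(mix_form \<rho> f h)\<^sup>2 \<le> gauss_E (\<lambda>x. (f x)\<^sup>2) * gauss_E (\<lambda>x. (h x)\<^sup>2)"
proof -
  have 1: "integrable gauss2 (\<lambda>z. (f (fst z))\<^sup>2)" using f by (subst gauss2_fst) auto
  have 2: "integrable gauss2 (\<lambda>z. (h (gauss_mix \<rho> z))\<^sup>2)"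
    using h \<rho> by (subst gauss2_mix) auto
  show "integrable gauss2 (\<lambda>z. f (fst z) * h (gauss_mix \<rho> z))"
    by (rule Cauchy_Schwarz_integral(1)[OF _ _ 1 2]) measurable
  show "(mix_form \<rho> f h)\<^sup>2 \<le> gauss_E (\<lambda>x. (f x)\<^sup>2) * gauss_E (\<lambda>x. (h x)\<^sup>2)"
    using Cauchy_Schwarz_integral(2)[OF _ _ 1 2] gauss2_fst(2)[of "\<lambda>x. (f x)\<^sup>2"] gauss2_mix(2)[of "\<lambda>x. (h x)\<^sup>2", OF _ \<rho>]
    unfolding mix_form_def by simp
qed

lemma dual_activation_mix_form:
  assumes [measurable]: "\<phi> \<in> borel_measurable borel"
  shows "dual_activation \<phi> \<rho> = mix_form \<rho> \<phi> \<phi>"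
proof -
  have "dual_activation \<phi> \<rho> = (\<integral>z. (case z of (u, v) \<Rightarrow> \<phi> u * \<phi> v) \<partial>distr gauss2 (borel \<Otimes>\<^sub>M borel) (\<lambda>(u, w). (u, \<rho> * u + sqrt (1 - \<rho>\<^sup>2) * w)))"
    by (simp add: dual_activation_def gaussian_pair_def)
  also have "\<dots> = (\<integral>z. (case (case z of (u, w) \<Rightarrow> (u, \<rho> * u + sqrt (1 - \<rho>\<^sup>2) * w)) of (u, v) \<Rightarrow> \<phi> u * \<phi> v) \<partial>gauss2)"
    by (rule integral_distr) measurable
  also have "\<dots> = mix_form \<rho> \<phi> \<phi>"
    unfolding mix_form_def gauss_mix_def by (intro Bochner_Integration.integral_cong) auto
  finally show ?thesis .
qed

context gauss_L2
begin

text \<open>By Fubini the noise is integrated out for fixed u, which multiplies the k-th Hermite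
  term by \<rho> ^ k; orthogonality leaves only the diagonal terms.\<close>

lemma mix_form_P:
  assumes \<rho>: "\<bar>\<rho>\<bar> \<le> 1"
  shows "mix_form \<rho> (poly (P N)) (poly (P N)) = (\<Sum>k<N. (c k)\<^sup>2 * \<rho> ^ k)"
proof -
  interpret G2: pair_prob_space std_normal_distribution std_normal_distribution by (rule gauss_pair_space)
  define R where "R = (\<Sum>k<N. Polynomial.smult (c k / sqrt (fact k) * \<rho> ^ k) (hermite k))"
  have inner: "gauss_E (\<lambda>w. poly (P N) (\<rho> * u + sqrt (1 - \<rho>\<^sup>2) * w)) = poly R u" for u
  proof -
    have ig: "integrable std_normal_distribution (\<lambda>w. poly p (\<rho> * u + sqrt (1 - \<rho>\<^sup>2) * w))" for p
    proof -
      have "(\<lambda>w. poly p (\<rho> * u + sqrt (1 - \<rho>\<^sup>2) * w)) = poly (pcompose p [:\<rho> * u, sqrt (1 - \<rho>\<^sup>2):])"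
        by (simp add: fun_eq_iff poly_pcompose mult.commute)
      then show ?thesis by (simp only: std_normal_moment_poly_integrable)
    qed
    have "gauss_E (\<lambda>w. poly (P N) (\<rho> * u + sqrt (1 - \<rho>\<^sup>2) * w))
      = gauss_E (\<lambda>w. \<Sum>k<N. c k / sqrt (fact k) * poly (hermite k) (\<rho> * u + sqrt (1 - \<rho>\<^sup>2) * w))"
      by (simp add: hermite_sum_def poly_sum)
    also have "\<dots> = (\<Sum>k<N. gauss_E (\<lambda>w. c k / sqrt (fact k) * poly (hermite k) (\<rho> * u + sqrt (1 - \<rho>\<^sup>2) * w)))"
      by (intro Bochner_Integration.integral_sum integrable_mult_right ig)
    also have "\<dots> = poly R u"
      unfolding integral_mult_right_zero gauss_noise_hermite[OF \<rho>] R_def by (simp add: poly_sum mult.assoc)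
    finally show ?thesis .
  qed
  have "mix_form \<rho> (poly (P N)) (poly (P N))
     = gauss_E (\<lambda>u. gauss_E (\<lambda>w. poly (P N) u * poly (P N) (\<rho> * u + sqrt (1 - \<rho>\<^sup>2) * w)))"
    unfolding mix_form_def
    by (subst G2.integral_fst'[symmetric])
       (auto simp: gauss_mix_def intro!: mix_form(1)[OF _ _ \<rho>, unfolded gauss_mix_def] poly_sq_integrable)
  also have "\<dots> = gauss_E (\<lambda>u. poly (P N) u * poly R u)"
    by (simp add: inner)
  also have "\<dots> = (\<Sum>k<N. c k / sqrt (fact k) * \<rho> ^ k * gauss_E (\<lambda>x. poly (P N) x * poly (hermite k) x))"
    unfolding R_def by (rule E_smult_sum[OF poly_integrable'])
  also have "\<dots> = (\<Sum>k<N. (c k)\<^sup>2 * \<rho> ^ k)"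
    by (intro sum.cong) (auto simp: E_P_hermite power2_eq_square)
  finally show ?thesis .
qed

lemma P_tendsto: "(\<lambda>N. gauss_E (\<lambda>x. (\<phi> x - poly (P N) x)\<^sup>2)) \<longlonglongrightarrow> 0"
proof -
  have "(\<lambda>N. gauss_E (\<lambda>x. (\<phi> x)\<^sup>2) - (\<Sum>k<N. (c k)\<^sup>2)) \<longlonglongrightarrow> gauss_E (\<lambda>x. (\<phi> x)\<^sup>2) - gauss_E (\<lambda>x. (\<phi> x)\<^sup>2)"
    using Parseval by (intro tendsto_intros) (simp add: sums_def)
  then show ?thesis by (simp add: E_phi_P_diff)
qed

text \<open>The form at (\<phi>, \<phi>) differs from the form at the partial sums by two terms,
  each with \<phi> minus a partial sum in one slot. Cauchy-Schwarz bounds them by the L2 error,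
  uniformly in \<rho>, so the expansion also holds at the end points 1 and -1.\<close>

lemma dual_sums:
  assumes \<rho>: "\<bar>\<rho>\<bar> \<le> 1"
  shows "(\<lambda>k. (c k)\<^sup>2 * \<rho> ^ k) sums dual_activation \<phi> \<rho>"
proof -
  let ?E2 = "gauss_E (\<lambda>x. (\<phi> x)\<^sup>2)"
  let ?d = "\<lambda>N. gauss_E (\<lambda>x. (\<phi> x - poly (P N) x)\<^sup>2)"
  have EP: "gauss_E (\<lambda>x. (poly (P N) x)\<^sup>2) \<le> ?E2" for N
    using E_P_P[of N N] Bessel[of N] by (simp add: power2_eq_square)
  have E20: "0 \<le> ?E2" by simp
  have lim0: "X \<longlonglongrightarrow> 0" if "\<And>N. (X N)\<^sup>2 \<le> ?E2 * ?d N" for X :: "nat \<Rightarrow> real"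
  proof -
    have "(\<lambda>N. (X N)\<^sup>2) \<longlonglongrightarrow> 0"
    proof (rule tendsto_sandwich[OF always_eventually always_eventually tendsto_const])
      show "(\<lambda>N. ?E2 * ?d N) \<longlonglongrightarrow> 0" using tendsto_mult_left[OF P_tendsto, of ?E2] by simp
    qed (use that in auto)
    from tendsto_real_sqrt[OF this] show ?thesis by (simp add: tendsto_rabs_zero_iff)
  qed
  have 1: "(\<lambda>N. mix_form \<rho> (\<lambda>x. \<phi> x - poly (P N) x) \<phi>) \<longlonglongrightarrow> 0"
    by (rule lim0) (use mix_form(2)[OF _ _ \<rho> diff_sq_integrable sq] in \<open>simp add: mult.commute\<close>)
  have 2: "(\<lambda>N. mix_form \<rho> (poly (P N)) (\<lambda>x. \<phi> x - poly (P N) x)) \<longlonglongrightarrow> 0"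
  proof (rule lim0)
    fix N
    have "(mix_form \<rho> (poly (P N)) (\<lambda>x. \<phi> x - poly (P N) x))\<^sup>2 \<le> gauss_E (\<lambda>x. (poly (P N) x)\<^sup>2) * ?d N"
      by (rule mix_form(2)[OF _ _ \<rho> poly_sq_integrable diff_sq_integrable]) measurable
    also have "\<dots> \<le> ?E2 * ?d N" by (intro mult_right_mono EP) auto
    finally show "(mix_form \<rho> (poly (P N)) (\<lambda>x. \<phi> x - poly (P N) x))\<^sup>2 \<le> ?E2 * ?d N" .
  qed
  have split: "mix_form \<rho> \<phi> \<phi> - mix_form \<rho> (\<lambda>x. \<phi> x - poly (P N) x) \<phi>
      - mix_form \<rho> (poly (P N)) (\<lambda>x. \<phi> x - poly (P N) x) = mix_form \<rho> (poly (P N)) (poly (P N))" for N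
  proof -
    have i: "integrable gauss2 (\<lambda>z. \<phi> (fst z) * \<phi> (gauss_mix \<rho> z))"
      "integrable gauss2 (\<lambda>z. (\<phi> (fst z) - poly (P N) (fst z)) * \<phi> (gauss_mix \<rho> z))"
      "integrable gauss2 (\<lambda>z. poly (P N) (fst z) * (\<phi> (gauss_mix \<rho> z) - poly (P N) (gauss_mix \<rho> z)))"
      by (intro mix_form(1)[OF _ _ \<rho>] sq diff_sq_integrable poly_sq_integrable; measurable)+
    show ?thesis unfolding mix_form_def
      by (simp only: Bochner_Integration.integral_diff[OF i(1,2), symmetric]
            Bochner_Integration.integral_diff[OF Bochner_Integration.integrable_diff[OF i(1,2)] i(3), symmetric])
         (intro Bochner_Integration.integral_cong, auto simp: algebra_simps)
  qed
  have "(\<lambda>N. mix_form \<rho> \<phi> \<phi> - mix_form \<rho> (\<lambda>x. \<phi> x - poly (P N) x) \<phi>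
      - mix_form \<rho> (poly (P N)) (\<lambda>x. \<phi> x - poly (P N) x)) \<longlonglongrightarrow> mix_form \<rho> \<phi> \<phi> - 0 - 0"
    by (intro tendsto_intros 1 2)
  then show ?thesis unfolding split mix_form_P[OF \<rho>] sums_def
    by (simp add: dual_activation_mix_form)
qed

end

text \<open>Stein's identity with p = \<open>hermite k\<close>, since x p - p' is then
  \<open>hermite (Suc k)\<close>; the square root is the ratio of the normalisations.\<close>

lemma hermite_coeff_weak_derivative:
  assumes w: "weak_derivative f f'"
    and f2: "integrable std_normal_distribution (\<lambda>x. (f x)\<^sup>2)"
    and f'2: "integrable std_normal_distribution (\<lambda>x. (f' x)\<^sup>2)"
  shows "hermite_coeff f' k = sqrt (real (Suc k)) * hermite_coeff f (Suc k)"
proof -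
  have "gauss_E (\<lambda>x. f' x * poly (hermite k) x) = gauss_E (\<lambda>x. f x * poly (hermite (Suc k)) x)"
    unfolding weak_derivative_Stein[OF w f2 f'2, symmetric] by simp
  then show ?thesis
    by (simp add: hermite_coeff_def real_sqrt_mult del: hermite.simps of_nat_Suc)
qed

text \<open>The witness is the sequence of squared Hermite coefficients of \<phi>. Those of \<phi>'
  are the same ones shifted and weighted by the index, so Parseval for \<phi>' evaluates the
  weighted sum, which is the derivative of the series at 1.\<close>

theorem dual_activation_series:
  assumes "normalized_activation \<phi> \<phi>'"
  obtains e :: "nat \<Rightarrow> real" where
    "\<And>k. 0 \<le> e k" "e sums 1" "\<And>\<rho>. \<bar>\<rho>\<bar> \<le> 1 \<Longrightarrow> (\<lambda>k. e k * \<rho> ^ k) sums dual_activation \<phi> \<rho>"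
    "e 0 = (gauss_E \<phi>)\<^sup>2" "e 1 = (gauss_E \<phi>')\<^sup>2" "(\<lambda>k. real k * e k) sums gauss_E (\<lambda>x. (\<phi>' x)\<^sup>2)"
proof -
  have w: "weak_derivative \<phi> \<phi>'" and sq: "integrable std_normal_distribution (\<lambda>x. (\<phi> x)\<^sup>2)"
    and one: "gauss_E (\<lambda>x. (\<phi> x)\<^sup>2) = 1" and sq': "integrable std_normal_distribution (\<lambda>x. (\<phi>' x)\<^sup>2)"
    using assms by (auto simp: normalized_activation_def)
  note meas = weak_derivative_measurable[OF w]
  interpret P: gauss_L2 \<phi> by standard (use meas sq in auto)
  interpret P': gauss_L2 \<phi>' by standard (use meas sq' in auto)
  have c': "(hermite_coeff \<phi>' k)\<^sup>2 = real (Suc k) * (hermite_coeff \<phi> (Suc k))\<^sup>2" for k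
    unfolding hermite_coeff_weak_derivative[OF w sq sq'] by (simp add: power_mult_distrib)
  show ?thesis
  proof (rule that[of "\<lambda>k. (hermite_coeff \<phi> k)\<^sup>2"])
    show "(\<lambda>k. (hermite_coeff \<phi> k)\<^sup>2) sums 1" using P.Parseval one by simp
    show "(hermite_coeff \<phi> 0)\<^sup>2 = (gauss_E \<phi>)\<^sup>2" by (simp add: hermite_coeff_def)
    show "(hermite_coeff \<phi> 1)\<^sup>2 = (gauss_E \<phi>')\<^sup>2" using c'[of 0] by (simp add: hermite_coeff_def)
    have "(\<lambda>k. real (Suc k) * (hermite_coeff \<phi> (Suc k))\<^sup>2) sums gauss_E (\<lambda>x. (\<phi>' x)\<^sup>2)"
      using P'.Parseval unfolding c' .
    then show "(\<lambda>k. real k * (hermite_coeff \<phi> k)\<^sup>2) sums gauss_E (\<lambda>x. (\<phi>' x)\<^sup>2)"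
      by (subst (asm) sums_Suc_iff) simp
  qed (use P.dual_sums in auto)
qed

section \<open>Iterating the dual activation\<close>

text \<open>A form of the Cesaro-Stolz theorem; it converts the limit of the layerwise increments of
  the rescaled kernel into a linear growth rate.\<close>

lemma increments_imp_mean_limit:
  fixes x :: "nat \<Rightarrow> real"
  assumes "(\<lambda>n. x (Suc n) - x n) \<longlonglongrightarrow> l"
  shows "(\<lambda>n. x n / real (Suc n)) \<longlonglongrightarrow> l"
proof -
  define y where "y n = x n - real (Suc n) * l" for n
  have inc: "(\<lambda>n. y (Suc n) - y n) \<longlonglongrightarrow> 0"
    using tendsto_diff[OF assms tendsto_const[of l]] by (simp add: y_def algebra_simps)
  have "(\<lambda>n. y n / real (Suc n)) \<longlonglongrightarrow> 0"
  proof (rule LIMSEQ_I)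
    fix e :: real assume e: "e > 0"
    obtain N where N: "\<And>n. n \<ge> N \<Longrightarrow> \<bar>y (Suc n) - y n\<bar> < e / 2"
      using LIMSEQ_D[OF inc, of "e / 2"] e by auto
    have b: "\<bar>y (N + k)\<bar> \<le> \<bar>y N\<bar> + real k * (e / 2)" for k
    proof (induction k)
      case (Suc k)
      have "\<bar>y (N + Suc k)\<bar> \<le> \<bar>y (N + k)\<bar> + \<bar>y (Suc (N + k)) - y (N + k)\<bar>" by simp
      also have "\<dots> \<le> \<bar>y N\<bar> + real k * (e / 2) + e / 2" using Suc N[of "N + k"] by simp
      finally show ?case by (simp add: algebra_simps add_divide_distrib)
    qed simp
    \<comment> \<open>From index M on, the fixed initial term uses less than half of the allowed
      error.\<close>
    obtain M where M: "real M > 2 * \<bar>y N\<bar> / e" using reals_Archimedean2 by blast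
    show "\<exists>no. \<forall>n\<ge>no. norm (y n / real (Suc n) - 0) < e"
    proof (intro exI allI impI)
      fix n assume n: "n \<ge> max N M"
      have "\<bar>y n\<bar> \<le> \<bar>y N\<bar> + real (n - N) * (e / 2)" using b[of "n - N"] n by simp
      also have "\<dots> < e / 2 * real (Suc n) + real (Suc n) * (e / 2)"
      proof (rule add_less_le_mono)
        have "2 * \<bar>y N\<bar> / e < real (Suc n)" using M n by simp
        then show "\<bar>y N\<bar> < e / 2 * real (Suc n)" using e by (simp add: field_simps)
        show "real (n - N) * (e / 2) \<le> real (Suc n) * (e / 2)" using e by (intro mult_right_mono) auto
      qed
      finally show "norm (y n / real (Suc n) - 0) < e" by (simp add: field_simps)
    qed
  qed
  from tendsto_add[OF this tendsto_const[of l]]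
  show ?thesis by (simp add: y_def diff_divide_distrib del: of_nat_Suc)
qed

text \<open>Collects what the dynamics use: a quadratic upper bound that forces geometric decay to
  0, and estimates at the repelling point 1. Expansion by at most b holds on the whole interval
  (\<open>dual_lip\<close>), expansion by almost b only near 1
  (\<open>dual_deriv_1\<close>).\<close>

locale dual_iteration =
  fixes \<phi> :: "real \<Rightarrow> real" and a b :: real
  assumes a: "0 < a" "a < 1" and b: "1 < b"
    and dual_cont: "continuous_on {0..1} (dual_activation \<phi>)"
    and deriv_cont: "continuous_on {0..1} (dual_activation_deriv \<phi>)"
    and dual_incr: "\<And>w z. 0 \<le> w \<Longrightarrow> w \<le> z \<Longrightarrow> z \<le> 1 \<Longrightarrow>
          a * (z - w) \<le> dual_activation \<phi> z - dual_activation \<phi> w"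
    and dual_upper: "\<And>z. 0 \<le> z \<Longrightarrow> z \<le> 1 \<Longrightarrow> dual_activation \<phi> z \<le> z * (a + (1 - a) * z)"
    and dual_0: "dual_activation \<phi> 0 = 0" and dual_1: "dual_activation \<phi> 1 = 1"
    and deriv_bounds: "\<And>z. 0 \<le> z \<Longrightarrow> z \<le> 1 \<Longrightarrow> a \<le> dual_activation_deriv \<phi> z"
        "\<And>z. 0 \<le> z \<Longrightarrow> z \<le> 1 \<Longrightarrow> dual_activation_deriv \<phi> z \<le> a + (b - a) * z"
    and dual_lip: "\<And>z. 0 \<le> z \<Longrightarrow> z \<le> 1 \<Longrightarrow> 1 - dual_activation \<phi> z \<le> b * (1 - z)"
    and dual_deriv_1: "\<And>\<delta>. 0 < \<delta> \<Longrightarrow>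
          \<forall>\<^sub>F t in at_right 0. (1 - \<delta>) * b * t \<le> 1 - dual_activation \<phi> (1 - t)"
begin

abbreviation "f \<equiv> dual_activation \<phi>"
abbreviation "g \<equiv> dual_activation_deriv \<phi>"

lemma dual_range:
  assumes "0 \<le> z" "z \<le> 1"
  shows "a * z \<le> f z" "0 \<le> f z" "f z \<le> z"
proof -
  show 1: "a * z \<le> f z" using dual_incr[of 0 z] assms dual_0 by simp
  show "0 \<le> f z" using 1 a assms by (meson mult_nonneg_nonneg order.trans less_imp_le)
  have "a + (1 - a) * z \<le> a + (1 - a) * 1" using assms a by (intro add_left_mono mult_left_mono) auto
  then have "z * (a + (1 - a) * z) \<le> z * 1" using assms by (intro mult_left_mono) auto
  then show "f z \<le> z" using dual_upper[of z] assms by simp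
qed

lemma iter_range:
  assumes "0 \<le> z" "z \<le> 1"
  shows "0 \<le> (f ^^ k) z" "(f ^^ k) z \<le> z" "(f ^^ k) z \<le> 1"
proof -
  have "0 \<le> (f ^^ k) z \<and> (f ^^ k) z \<le> z"
  proof (induction k)
    case (Suc k)
    then show ?case using dual_range[of "(f ^^ k) z"] assms by auto
  qed (use assms in auto)
  then show "0 \<le> (f ^^ k) z" "(f ^^ k) z \<le> z" "(f ^^ k) z \<le> 1" using assms by auto
qed

text \<open>The contraction factor at the start of the orbit. It increases with z and orbits
  decrease, so it bounds the factors of all later steps.\<close>

abbreviation rate :: "real \<Rightarrow> real" where
  "rate z \<equiv> a + (1 - a) * z"

lemma rate_bounds:
  assumes "0 \<le> z" "z < 1"
  shows "0 < rate z" "rate z < 1"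
proof -
  show "0 < rate z" using a assms by (intro add_pos_nonneg mult_nonneg_nonneg) auto
  have "(1 - a) * z < (1 - a) * 1" using a assms by (intro mult_strict_left_mono) auto
  then show "rate z < 1" by simp
qed

lemma iter_geometric:
  assumes z: "0 \<le> z" "z < 1"
  shows "(f ^^ k) z \<le> rate z ^ k"
proof (induction k)
  case (Suc k)
  let ?w = "(f ^^ k) z"
  have w: "0 \<le> ?w" "?w \<le> z" "?w \<le> 1" using iter_range[of z k] z by auto
  have "f ?w \<le> ?w * rate ?w" using dual_upper w by auto
  also have "\<dots> \<le> rate z ^ k * rate z"
    using Suc w a z rate_bounds[OF z] by (intro mult_mono add_left_mono mult_left_mono) auto
  finally show ?case by (simp add: mult.commute)
qed (use z in simp)

lemma geometric_sum_le:
  assumes "0 \<le> r" "r < (1::real)"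
  shows "(\<Sum>i<k. r ^ i) \<le> 1 / (1 - r)"
proof -
  have "(\<Sum>i<k. r ^ i) = (1 - r ^ k) / (1 - r)" using sum_gp_strict[of r k] assms by simp
  also have "\<dots> \<le> 1 / (1 - r)" using assms by (intro divide_right_mono) auto
  finally show ?thesis .
qed

section \<open>Scaled iterates and the Koenigs function\<close>

definition scaled_iter :: "nat \<Rightarrow> real \<Rightarrow> real" where
  "scaled_iter k z = (f ^^ k) z / a ^ k"

lemma scaled_iter_nonneg: "0 \<le> z \<Longrightarrow> z \<le> 1 \<Longrightarrow> 0 \<le> scaled_iter k z"
  using a iter_range by (simp add: scaled_iter_def)

lemma scaled_iter_incseq:
  assumes "0 \<le> z" "z \<le> 1"
  shows "incseq (\<lambda>k. scaled_iter k z)"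
proof (rule incseq_SucI)
  fix k
  have "a * (f ^^ k) z \<le> f ((f ^^ k) z)" using iter_range[OF assms] dual_range by simp
  then show "scaled_iter k z \<le> scaled_iter (Suc k) z" using a by (simp add: scaled_iter_def field_simps)
qed

text \<open>A step multiplies the scaled iterate by at most 1 plus a constant times the current
  iterate. The iterates decay geometrically, so the product of these factors is bounded by the
  exponential of a geometric series.\<close>

lemma scaled_iter_bounded:
  assumes z: "0 \<le> z" "z < 1"
  shows "scaled_iter k z \<le> exp ((1 - a) / a / (1 - rate z))"
proof -
  let ?c = "(1 - a) / a"
  have c: "0 \<le> ?c" using a by simp
  have "scaled_iter k z \<le> exp (?c * (\<Sum>i<k. rate z ^ i))"
  proof (induction k)
    case 0 then show ?case using z by (simp add: scaled_iter_def)
  next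
    case (Suc k)
    let ?w = "(f ^^ k) z"
    have w: "0 \<le> ?w" "?w \<le> 1" using iter_range[of z k] z by auto
    have "scaled_iter (Suc k) z \<le> ?w * rate ?w / a ^ Suc k"
      using dual_upper[OF w] a by (simp add: scaled_iter_def divide_right_mono)
    also have "\<dots> = scaled_iter k z * (1 + ?c * ?w)"
      using a by (simp add: scaled_iter_def field_simps)
    also have "\<dots> \<le> exp (?c * (\<Sum>i<k. rate z ^ i)) * exp (?c * rate z ^ k)"
    proof (intro mult_mono Suc)
      have "1 + ?c * ?w \<le> 1 + ?c * rate z ^ k" using c iter_geometric[OF z] by (intro add_left_mono mult_left_mono)
      also have "\<dots> \<le> exp (?c * rate z ^ k)" by (rule exp_ge_add_one_self)
      finally show "1 + ?c * ?w \<le> exp (?c * rate z ^ k)" .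
      show "0 \<le> 1 + ?c * ?w" using c w by (intro add_nonneg_nonneg mult_nonneg_nonneg) auto
    qed auto
    also have "\<dots> = exp (?c * (\<Sum>i<Suc k. rate z ^ i))" by (simp add: exp_add[symmetric] distrib_left)
    finally show ?case .
  qed
  also have "\<dots> \<le> exp (?c * (1 / (1 - rate z)))"
    using geometric_sum_le[of "rate z" k] rate_bounds[OF z] c by (simp add: mult_left_mono del: times_divide_eq_right times_divide_eq_left)
  finally show ?thesis by simp
qed

text \<open>The linearisation of the dual at its attracting fixed point. At 1 the scaled iterates
  are (1 / a) ^ k and diverge; the default 0 at that point concerns only overlap 1, a null
  event.\<close>

definition koenigs :: "real \<Rightarrow> real" where
  "koenigs z = (if 0 \<le> z \<and> z < 1 then lim (\<lambda>k. scaled_iter k z) else 0)"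

lemma koenigs_lim:
  assumes "0 \<le> z" "z < 1"
  shows "(\<lambda>k. scaled_iter k z) \<longlonglongrightarrow> koenigs z"
proof -
  have "convergent (\<lambda>k. scaled_iter k z)"
    using scaled_iter_incseq[of z] scaled_iter_bounded[OF assms] assms
      incseq_convergent[of "\<lambda>k. scaled_iter k z"] by (metis convergentI less_imp_le)
  then show ?thesis using assms by (simp add: koenigs_def convergent_LIMSEQ_iff)
qed

lemma scaled_iter_le_koenigs:
  "0 \<le> z \<Longrightarrow> z < 1 \<Longrightarrow> scaled_iter k z \<le> koenigs z"
  using incseq_le[OF scaled_iter_incseq koenigs_lim] by simp

lemma koenigs_dual:
  assumes z: "0 \<le> z" "z < 1"
  shows "koenigs (f z) = a * koenigs z"
proof (rule LIMSEQ_unique)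
  have "0 \<le> f z" "f z < 1" using dual_range[of z] z by auto
  then show "(\<lambda>k. scaled_iter k (f z)) \<longlonglongrightarrow> koenigs (f z)" by (rule koenigs_lim)
  have "scaled_iter k (f z) = a * scaled_iter (Suc k) z" for k
    using a by (simp add: scaled_iter_def funpow_swap1)
  then show "(\<lambda>k. scaled_iter k (f z)) \<longlonglongrightarrow> a * koenigs z"
    using tendsto_mult_left[OF LIMSEQ_Suc[OF koenigs_lim[OF z]]] by simp
qed

lemma koenigs_0: "koenigs 0 = 0"
proof (rule LIMSEQ_unique[OF koenigs_lim])
  have "(f ^^ k) 0 = 0" for k by (induction k) (auto simp: dual_0)
  then show "(\<lambda>k. scaled_iter k 0) \<longlonglongrightarrow> 0" by (simp add: scaled_iter_def)
qed auto

text \<open>An iteration preserves at least the fraction a of a gap, and the scaling cancels this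
  fraction. Slope at least 1 gives strict monotonicity, hence the injectivity that later excludes
  atoms of the vote.\<close>

lemma koenigs_incr:
  assumes "0 \<le> w" "w \<le> z" "z < 1"
  shows "z - w \<le> koenigs z - koenigs w"
proof (rule LIMSEQ_le_const)
  show "(\<lambda>k. scaled_iter k z - scaled_iter k w) \<longlonglongrightarrow> koenigs z - koenigs w"
    using assms by (intro tendsto_diff koenigs_lim) auto
  have "a ^ k * (z - w) \<le> (f ^^ k) z - (f ^^ k) w" for k
  proof (induction k)
    case (Suc k)
    have le: "(f ^^ k) w \<le> (f ^^ k) z" using Suc assms a by (smt (verit) mult_nonneg_nonneg zero_le_power)
    have "a ^ Suc k * (z - w) \<le> a * ((f ^^ k) z - (f ^^ k) w)"
      using Suc a by (simp add: mult.assoc mult_left_mono)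
    also have "\<dots> \<le> f ((f ^^ k) z) - f ((f ^^ k) w)"
      using iter_range[of z k] iter_range[of w k] assms le by (intro dual_incr) auto
    finally show ?case by simp
  qed simp
  then have "z - w \<le> scaled_iter k z - scaled_iter k w" for k
    using a by (simp add: scaled_iter_def field_simps)
  then show "\<exists>N. \<forall>k\<ge>N. z - w \<le> scaled_iter k z - scaled_iter k w" by blast
qed

lemma koenigs_nonneg: "0 \<le> koenigs z"
proof (cases "0 \<le> z \<and> z < 1")
  case True
  then show ?thesis using koenigs_incr[of 0 z] koenigs_0 by simp
qed (auto simp: koenigs_def)

lemma koenigs_mono: "0 \<le> w \<Longrightarrow> w \<le> z \<Longrightarrow> z < 1 \<Longrightarrow> koenigs w \<le> koenigs z"
  using koenigs_incr[of w z] by simp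

lemma koenigs_inj:
  assumes "0 \<le> w" "w < 1" "0 \<le> z" "z < 1" "koenigs w = koenigs z"
  shows "w = z"
  using koenigs_incr[of w z] koenigs_incr[of z w] assms by linarith

lemma iter_cont: "continuous_on {0..1} (f ^^ k)"
proof (induction k)
  case 0
  show ?case by (simp add: id_def)
next
  case (Suc k)
  have "continuous_on {0..1} (f \<circ> (f ^^ k))"
    by (rule continuous_on_compose[OF Suc continuous_on_subset[OF dual_cont]])
       (use iter_range in \<open>auto simp: image_subset_iff\<close>)
  then show ?case by simp
qed

lemma koenigs_measurable[measurable]: "koenigs \<in> borel_measurable borel"
proof (rule borel_measurable_LIMSEQ_real)
  show "(\<lambda>z. indicator {0..<1} z * (indicator {0..1} z *\<^sub>R (f ^^ k) z / a ^ k)) \<in> borel_measurable borel" for k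
    using borel_measurable_continuous_on_indicator[OF _ iter_cont[of k]] by measurable
  fix z :: real
  have "(\<lambda>k. indicator {0..<1} z * scaled_iter k z) \<longlonglongrightarrow> koenigs z"
    using koenigs_lim[of z] by (cases "0 \<le> z \<and> z < 1") (auto simp: koenigs_def)
  then show "(\<lambda>k. indicator {0..<1} z * (indicator {0..1} z *\<^sub>R (f ^^ k) z / a ^ k)) \<longlonglongrightarrow> koenigs z"
    by (cases "0 \<le> z \<and> z < 1") (auto simp: scaled_iter_def)
qed

text \<open>A step of the dual expands the distance to 1 by at most b, so after k steps the orbit of
  z is still at w or above, whereas \<open>koenigs\<close> has been multiplied by exactly a ^
  k.\<close>

lemma koenigs_growth:
  assumes "0 \<le> w" "w < 1" "0 \<le> z" "z < 1" "b ^ k * (1 - z) \<le> 1 - w"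
  shows "koenigs w / a ^ k \<le> koenigs z"
  using assms(3-)
proof (induction k arbitrary: z)
  case 0
  then show ?case using koenigs_mono[of w z] assms by simp
next
  case (Suc k)
  have r: "0 \<le> f z" "f z < 1" using dual_range[of z] Suc.prems by auto
  have "b ^ k * (1 - f z) \<le> b ^ k * (b * (1 - z))"
    using dual_lip[of z] Suc.prems b by (intro mult_left_mono) auto
  also have "\<dots> \<le> 1 - w" using Suc.prems by (simp add: mult_ac)
  finally have "koenigs w / a ^ k \<le> koenigs (f z)" using Suc.IH r by blast
  then show ?case using koenigs_dual[of z] Suc.prems a by (simp add: field_simps)
qed

section \<open>The kernel at large depth\<close>

lemma ntk_cont: "continuous_on {0..1} (ntk \<phi> L)"
proof (induction L)
  case 0
  show ?case by (simp add: continuous_on_id)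
next
  case (Suc L)
  have "continuous_on {0..1} (g \<circ> (f ^^ L))"
    by (rule continuous_on_compose[OF iter_cont continuous_on_subset[OF deriv_cont]])
       (use iter_range in \<open>auto simp: image_subset_iff\<close>)
  then have "continuous_on {0..1} (\<lambda>z. (f ^^ Suc L) z + ntk \<phi> L z * (g \<circ> (f ^^ L)) z)"
    by (intro continuous_on_add continuous_on_mult iter_cont Suc)
  then show ?case by simp
qed

lemma ntk_at_1: "1 \<le> ntk \<phi> L 1"
proof -
  have i: "(f ^^ k) 1 = 1" for k by (induction k) (auto simp: dual_1)
  show ?thesis
  proof (induction L)
    case (Suc L)
    have "0 \<le> ntk \<phi> L 1 * g 1" using Suc deriv_bounds(1)[of 1] a by (intro mult_nonneg_nonneg) auto
    then show ?case using i[of L] i[of "Suc L"] by simp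
  qed simp
qed

text \<open>In units of \<open>a ^ L\<close> the kernel grows by the scaled iterate at each layer, up to a relative
  error that is summable because the iterates decay geometrically.\<close>

theorem ntk_limit:
  assumes z: "0 \<le> z" "z < 1"
  shows "(\<lambda>L. ntk \<phi> L z / (real (Suc L) * a ^ L)) \<longlonglongrightarrow> koenigs z"
proof -
  define k where "k L = ntk \<phi> L z / a ^ L" for L
  define e where "e L = g ((f ^^ L) z) / a - 1" for L
  define C where "C = (b - a) / a"
  define M where "M = koenigs z * exp (C / (1 - rate z))"
  have C: "0 \<le> C" using a b by (simp add: C_def)
  have e0: "0 \<le> e L" and e1: "e L \<le> C * rate z ^ L" for L
  proof -
    have w: "0 \<le> (f ^^ L) z" "(f ^^ L) z \<le> 1" using iter_range[of z] z by auto
    show "0 \<le> e L" using deriv_bounds(1)[OF w] a by (simp add: e_def)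
    have "g ((f ^^ L) z) \<le> a + (b - a) * rate z ^ L"
      using deriv_bounds(2)[OF w] iter_geometric[OF z, of L] a b
      by (smt (verit) mult_left_mono)
    then have "(g ((f ^^ L) z) - a) / a \<le> (b - a) * rate z ^ L / a" using a by (intro divide_right_mono) auto
    moreover have "(g ((f ^^ L) z) - a) / a = e L" using a by (simp add: e_def diff_divide_distrib)
    moreover have "(b - a) * rate z ^ L / a = C * rate z ^ L" by (simp add: C_def)
    ultimately show "e L \<le> C * rate z ^ L" by simp
  qed
  have k_Suc: "k (Suc L) = scaled_iter (Suc L) z + (1 + e L) * k L" for L
    using a by (simp add: k_def e_def scaled_iter_def field_simps)
  have k_nonneg: "0 \<le> k L" for L
  proof (induction L)
    case (Suc L)
    then show ?case unfolding k_Suc using e0[of L] scaled_iter_nonneg[of z "Suc L"] z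
      by (intro add_nonneg_nonneg mult_nonneg_nonneg) auto
  qed (use z in \<open>auto simp: k_def\<close>)
  have k_bound': "k L \<le> real (Suc L) * (koenigs z * exp (C * (\<Sum>i<L. rate z ^ i)))" for L
  proof (induction L)
    case 0
    show ?case using scaled_iter_le_koenigs[OF z, of 0] by (simp add: k_def scaled_iter_def)
  next
    case (Suc L)
    let ?E = "\<lambda>L. exp (C * (\<Sum>i<L. rate z ^ i))"
    have "0 \<le> C * (\<Sum>i<Suc L. rate z ^ i)"
      using C rate_bounds[OF z] by (intro mult_nonneg_nonneg sum_nonneg) auto
    then have "1 \<le> ?E (Suc L)" by (simp del: sum.lessThan_Suc)
    then have 1: "scaled_iter (Suc L) z \<le> koenigs z * ?E (Suc L)"
      using scaled_iter_le_koenigs[OF z, of "Suc L"] mult_left_mono[of 1 "?E (Suc L)", OF _ koenigs_nonneg[of z]] by simp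
    have "1 + e L \<le> exp (C * rate z ^ L)"
      using e1[of L] exp_ge_add_one_self[of "C * rate z ^ L"] by linarith
    then have "(1 + e L) * k L \<le> exp (C * rate z ^ L) * (real (Suc L) * (koenigs z * ?E L))"
      using Suc e0 k_nonneg by (intro mult_mono) auto
    also have "\<dots> = real (Suc L) * (koenigs z * ?E (Suc L))"
      by (simp add: exp_add distrib_left mult_ac)
    finally have 2: "(1 + e L) * k L \<le> real (Suc L) * (koenigs z * ?E (Suc L))" .
    show ?case unfolding k_Suc using 1 2 by (simp add: distrib_right)
  qed
  have k_bound: "k L \<le> real (Suc L) * M" for L
  proof -
    have "C * (\<Sum>i<L. rate z ^ i) \<le> C * (1 / (1 - rate z))"
      using geometric_sum_le[of "rate z" L] rate_bounds[OF z] C by (intro mult_left_mono) auto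
    then have "koenigs z * exp (C * (\<Sum>i<L. rate z ^ i)) \<le> M"
      unfolding M_def using koenigs_nonneg by (intro mult_left_mono) auto
    then have "real (Suc L) * (koenigs z * exp (C * (\<Sum>i<L. rate z ^ i))) \<le> real (Suc L) * M"
      by (intro mult_left_mono) auto
    then show ?thesis using k_bound'[of L] by linarith
  qed
  \<comment> \<open>A linearly growing bound meets a geometrically decaying one, so the increment of
    k at each layer tends to the limit of the scaled iterates.\<close>
  have ek: "(\<lambda>L. e L * k L) \<longlonglongrightarrow> 0"
  proof (rule tendsto_sandwich[OF always_eventually always_eventually tendsto_const])
    show "\<forall>L. 0 \<le> e L * k L" using e0 k_nonneg by simp
    show "\<forall>L. e L * k L \<le> C * M * (real L * rate z ^ L) + C * M * rate z ^ L"
    proof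
      fix L
      have "e L * k L \<le> (C * rate z ^ L) * (real (Suc L) * M)"
        using e0 e1 k_nonneg k_bound C rate_bounds[OF z] by (intro mult_mono) auto
      then show "e L * k L \<le> C * M * (real L * rate z ^ L) + C * M * rate z ^ L"
        by (simp add: algebra_simps)
    qed
    have "(\<lambda>L. C * M * (real L * rate z ^ L) + C * M * rate z ^ L) \<longlonglongrightarrow> C * M * 0 + C * M * 0"
      using rate_bounds[OF z] by (intro tendsto_intros powser_times_n_limit_0 LIMSEQ_power_zero) auto
    then show "(\<lambda>L. C * M * (real L * rate z ^ L) + C * M * rate z ^ L) \<longlonglongrightarrow> 0" by simp
  qed
  have "(\<lambda>L. k (Suc L) - k L) \<longlonglongrightarrow> koenigs z"
  proof -
    have "(\<lambda>L. scaled_iter (Suc L) z + e L * k L) \<longlonglongrightarrow> koenigs z + 0"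
      by (intro tendsto_add ek LIMSEQ_Suc[OF koenigs_lim[OF z]])
    then show ?thesis by (simp add: k_Suc algebra_simps)
  qed
  from increments_imp_mean_limit[OF this] show ?thesis
    by (simp add: k_def mult.commute del: of_nat_Suc)
qed

lemma ntk_tendsto_0:
  assumes z: "0 \<le> z" "z < 1"
  shows "(\<lambda>L. ntk \<phi> L z) \<longlonglongrightarrow> 0"
proof -
  have "(\<lambda>L. real L * a ^ L + a ^ L) \<longlonglongrightarrow> 0 + 0"
    using a by (intro tendsto_add powser_times_n_limit_0 LIMSEQ_power_zero) auto
  from tendsto_mult[OF ntk_limit[OF z] this]
  have "(\<lambda>L. ntk \<phi> L z / (real (Suc L) * a ^ L) * (real L * a ^ L + a ^ L)) \<longlonglongrightarrow> 0" by simp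
  moreover have "ntk \<phi> L z / (real (Suc L) * a ^ L) * (real L * a ^ L + a ^ L) = ntk \<phi> L z" for L
  proof -
    have "real (Suc L) * a ^ L \<noteq> 0" using a by simp
    moreover have "real L * a ^ L + a ^ L = real (Suc L) * a ^ L" by (simp add: algebra_simps)
    ultimately show ?thesis by simp
  qed
  ultimately show ?thesis by simp
qed

end

section \<open>Bounds on the dual activation from its power series\<close>

lemma power_series_derivative_closed:
  fixes e :: "nat \<Rightarrow> real" and F :: "real \<Rightarrow> real"
  assumes e0: "\<And>k. 0 \<le> e k" and ke: "summable (\<lambda>k. real k * e k)"
    and F: "\<And>y. \<bar>y\<bar> \<le> 1 \<Longrightarrow> (\<lambda>k. e k * y ^ k) sums F y"
    and z: "\<bar>z\<bar> \<le> 1"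
  shows "(F has_real_derivative (\<Sum>k. real k * e k * z ^ (k - 1))) (at z within {-1..1})"
proof -
  \<comment> \<open>The radius of convergence may be exactly 1 and the end points matter. The q k
    are the difference quotients of the powers, at most k in modulus, so summability of
    \<open>real k * e k\<close> gives uniform convergence of the quotients on the closed
    interval.\<close>
  define q where "q k y = (\<Sum>i<k. y ^ i * z ^ (k - Suc i))" for k y
  define Q where "Q y = (\<Sum>k. e k * q k y)" for y
  have qb: "\<bar>e k * q k y\<bar> \<le> real k * e k" if "y \<in> {-1..1}" for k y
  proof -
    have "\<bar>q k y\<bar> \<le> (\<Sum>i<k. 1)"
      unfolding q_def
    proof (intro order_trans[OF sum_abs] sum_mono)
      fix i
      have "\<bar>y\<bar> ^ i * \<bar>z\<bar> ^ (k - Suc i) \<le> 1 * 1"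
        using that z by (intro mult_mono power_le_one) auto
      then show "\<bar>y ^ i * z ^ (k - Suc i)\<bar> \<le> 1" by (simp add: abs_mult power_abs)
    qed
    then have "e k * \<bar>q k y\<bar> \<le> e k * real k" using e0 by (intro mult_left_mono) auto
    then show ?thesis using e0[of k] by (simp add: abs_mult mult.commute)
  qed
  have ul: "uniform_limit {-1..1} (\<lambda>N y. \<Sum>k<N. e k * q k y) Q sequentially"
    unfolding Q_def by (rule Weierstrass_m_test[OF _ ke]) (use qb in auto)
  have cont: "continuous_on {-1..1} Q"
    by (rule uniform_limit_theorem[OF _ ul]) (auto simp: q_def intro!: always_eventually continuous_intros)
  have quot: "(F y - F z) / (y - z) = Q y" if y: "y \<in> {-1..1}" "y \<noteq> z" for y
  proof -
    have qd: "(y - z) * q k y = y ^ k - z ^ k" for k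
    proof (cases k)
      case (Suc n)
      show ?thesis unfolding Suc q_def diff_power_eq_sum by simp
    qed (simp add: q_def)
    have s: "summable (\<lambda>k. e k * q k y)"
      by (rule summable_comparison_test'[OF ke, of 0]) (use qb y in auto)
    have "(\<lambda>k. e k * y ^ k - e k * z ^ k) sums (F y - F z)"
      using F[of y] F[OF z] y by (intro sums_diff) auto
    moreover have "(\<lambda>k. (y - z) * (e k * q k y)) sums ((y - z) * Q y)"
      unfolding Q_def by (intro sums_mult summable_sums s)
    moreover have "(y - z) * (e k * q k y) = e k * y ^ k - e k * z ^ k" for k
      using qd[of k] by (metis mult.left_commute right_diff_distrib)
    ultimately have "F y - F z = (y - z) * Q y" using sums_unique2 by simp
    then show ?thesis using y by simp
  qed
  have "Q z = (\<Sum>k. real k * e k * z ^ (k - 1))"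
  proof -
    have "q k z = real k * z ^ (k - 1)" for k
    proof -
      have "q k z = (\<Sum>i<k. z ^ (k - 1))" unfolding q_def
        by (intro sum.cong refl) (simp add: power_add[symmetric])
      then show ?thesis by simp
    qed
    then show ?thesis by (simp add: Q_def mult_ac)
  qed
  moreover have "((\<lambda>y. (F y - F z) / (y - z)) \<longlongrightarrow> Q z) (at z within {-1..1})"
  proof (rule Lim_transform_eventually)
    show "(Q \<longlongrightarrow> Q z) (at z within {-1..1})" using cont z by (auto simp: continuous_on_def abs_le_iff)
    show "\<forall>\<^sub>F y in at z within {-1..1}. Q y = (F y - F z) / (y - z)"
      using quot by (auto simp: eventually_at_filter)
  qed
  ultimately show ?thesis by (simp add: has_field_derivative_iff)
qed

lemma sums_single: "(\<lambda>k. if k = m then (x::real) else 0) sums x"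
  using sums_If_finite_set[of "{m}" "\<lambda>_. x"] by simp

text \<open>The inequalities on {0..1} are compared term by term, since all coefficients are
  nonnegative; the asymptotic lower bound at 1 comes from the one-sided derivative there.\<close>

lemma dual_iteration_of_series:
  fixes e :: "nat \<Rightarrow> real"
  assumes e0: "\<And>k. 0 \<le> e k" and e1: "e sums 1" and eb: "(\<lambda>k. real k * e k) sums b"
    and F: "\<And>\<rho>. \<bar>\<rho>\<bar> \<le> 1 \<Longrightarrow> (\<lambda>k. e k * \<rho> ^ k) sums dual_activation \<phi> \<rho>"
    and z0: "e 0 = 0" and a: "0 < e 1" "e 1 < 1" and b: "1 < b"
  shows "dual_iteration \<phi> (e 1) b"
proof -
  have ke: "summable (\<lambda>k. real k * e k)" using eb by (rule sums_summable)
  define D where "D z = (\<Sum>k. real k * e k * z ^ (k - 1))" for z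
  have der: "(dual_activation \<phi> has_real_derivative D z) (at z within {-1..1})" if "\<bar>z\<bar> \<le> 1" for z
    unfolding D_def by (rule power_series_derivative_closed[OF e0 ke F that])
  have Deq: "dual_activation_deriv \<phi> z = D z" if "\<bar>z\<bar> \<le> 1" for z
    unfolding dual_activation_deriv_def
    by (rule vector_derivative_within_closed_interval)
       (use der[OF that] that in \<open>auto simp: has_real_derivative_iff_has_vector_derivative abs_le_iff\<close>)
  have Db: "\<bar>real k * e k * z ^ (k - 1)\<bar> \<le> real k * e k" if "\<bar>z\<bar> \<le> 1" for k z
  proof -
    have "real k * e k * \<bar>z\<bar> ^ (k - 1) \<le> real k * e k * 1"
      using that e0 by (intro mult_left_mono power_le_one mult_nonneg_nonneg) auto
    then show ?thesis using e0[of k] by (simp add: abs_mult power_abs)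
  qed
  have Dsums: "(\<lambda>k. real k * e k * z ^ (k - 1)) sums D z" if "\<bar>z\<bar> \<le> 1" for z
    unfolding D_def using Db[OF that]
    by (intro summable_sums summable_comparison_test'[OF ke, of 0]) auto
  have d1: "dual_activation \<phi> 1 = 1" using F[of 1] e1 sums_unique2 by simp
  have D1: "D 1 = b" using Dsums[of 1] eb sums_unique2 by simp
  show ?thesis
  proof
    show "0 < e 1" "e 1 < 1" "1 < b" by fact+
    show "dual_activation \<phi> 0 = 0"
      using F[of 0] sums_unique2[OF _ sums_zero] z0
      by (metis (no_types, lifting) abs_zero mult_zero_right power_0_left mult_zero_left sums_cong zero_le_one)
    show "dual_activation \<phi> 1 = 1" by (rule d1)
    have "continuous_on {-1..1} (dual_activation \<phi>)"
      using der by (intro DERIV_continuous_on) (auto simp: abs_le_iff)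
    then show "continuous_on {0..1} (dual_activation \<phi>)" by (rule continuous_on_subset) auto
    have "continuous_on {-1..1} D"
    proof (rule uniform_limit_theorem)
      show "uniform_limit {-1..1} (\<lambda>N z. \<Sum>k<N. real k * e k * z ^ (k - 1)) D sequentially"
        unfolding D_def by (rule Weierstrass_m_test[OF _ ke]) (use Db in \<open>auto simp: abs_le_iff\<close>)
    qed (auto intro!: always_eventually continuous_intros)
    then have "continuous_on {0..1} D" by (rule continuous_on_subset) auto
    then show "continuous_on {0..1} (dual_activation_deriv \<phi>)"
      by (subst continuous_on_cong[OF refl Deq]) auto
    show "e 1 * (z - w) \<le> dual_activation \<phi> z - dual_activation \<phi> w" if w: "0 \<le> w" "w \<le> z" "z \<le> 1" for w z
    proof (rule sums_le[OF _ sums_single[of 1]])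
      show "(\<lambda>k. e k * z ^ k - e k * w ^ k) sums (dual_activation \<phi> z - dual_activation \<phi> w)"
        using w by (intro sums_diff F) auto
      show "(if k = 1 then e 1 * (z - w) else 0) \<le> e k * z ^ k - e k * w ^ k" for k
        using w e0[of k] by (auto simp: right_diff_distrib power_mono mult_left_mono)
    qed
    show "dual_activation \<phi> z \<le> z * (e 1 + (1 - e 1) * z)" if z: "0 \<le> z" "z \<le> 1" for z
    proof -
      \<comment> \<open>In the comparison series all powers from the second on are replaced by the
        square of z, and the total weight 1 determines the sum.\<close>
      have s: "(\<lambda>k. e k * z\<^sup>2 + (if k = 1 then e 1 * (z - z\<^sup>2) else 0)) sums (1 * z\<^sup>2 + e 1 * (z - z\<^sup>2))"
        by (intro sums_add sums_mult2 e1 sums_single)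
      have le: "e k * z ^ k \<le> e k * z\<^sup>2 + (if k = 1 then e 1 * (z - z\<^sup>2) else 0)" for k
      proof -
        consider "k = 0" | "k = 1" | "2 \<le> k" by linarith
        then show ?thesis
        proof cases
          case 3
          then have "z ^ k \<le> z ^ 2" using z by (intro power_decreasing) auto
          then show ?thesis using 3 e0[of k] by (simp add: mult_left_mono)
        qed (auto simp: z0 right_diff_distrib)
      qed
      have "(\<lambda>k. e k * z ^ k) sums dual_activation \<phi> z" using F z by simp
      from sums_le[OF le this s] have "dual_activation \<phi> z \<le> 1 * z\<^sup>2 + e 1 * (z - z\<^sup>2)" .
      then show ?thesis by (simp add: power2_eq_square algebra_simps)
    qed
    show "e 1 \<le> dual_activation_deriv \<phi> z" if z: "0 \<le> z" "z \<le> 1" for z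
    proof -
      have "e 1 \<le> D z"
        by (rule sums_le[OF _ sums_single[of 1] Dsums]) (use z e0 in auto)
      then show ?thesis using Deq z by simp
    qed
    show "dual_activation_deriv \<phi> z \<le> e 1 + (b - e 1) * z" if z: "0 \<le> z" "z \<le> 1" for z
    proof -
      \<comment> \<open>Likewise with z in place of its higher powers; the total weight of the
        derivative series is b.\<close>
      have s: "(\<lambda>k. real k * e k * z + (if k = 1 then e 1 * (1 - z) else 0)) sums (b * z + e 1 * (1 - z))"
        by (intro sums_add sums_mult2 eb sums_single)
      have le: "real k * e k * z ^ (k - 1) \<le> real k * e k * z + (if k = 1 then e 1 * (1 - z) else 0)" for k
      proof -
        consider "k = 0" | "k = 1" | "2 \<le> k" by linarith
        then show ?thesis
        proof cases
          case 3
          then have "z ^ (k - 1) \<le> z ^ 1" using z by (intro power_decreasing) auto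
          then show ?thesis using 3 e0[of k] by (simp add: mult_left_mono)
        qed (auto simp: algebra_simps)
      qed
      have "(\<lambda>k. real k * e k * z ^ (k - 1)) sums D z" using Dsums z by simp
      from sums_le[OF le this s] have "D z \<le> b * z + e 1 * (1 - z)" .
      then show ?thesis using Deq z by (simp add: algebra_simps)
    qed
    show "1 - dual_activation \<phi> z \<le> b * (1 - z)" if z: "0 \<le> z" "z \<le> 1" for z
    proof (rule sums_le)
      show "(\<lambda>k. e k - e k * z ^ k) sums (1 - dual_activation \<phi> z)"
        using z by (intro sums_diff e1 F) auto
      show "(\<lambda>k. real k * e k * (1 - z)) sums (b * (1 - z))" by (intro sums_mult2 eb)
      show "e k - e k * z ^ k \<le> real k * e k * (1 - z)" for k
      proof -
        have "1 - z ^ k \<le> real k * (1 - z)"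
          using Bernoulli_inequality[of "z - 1" k] z by (simp add: algebra_simps)
        then have "e k * (1 - z ^ k) \<le> e k * (real k * (1 - z))" by (intro mult_left_mono e0)
        then show ?thesis by (simp add: algebra_simps)
      qed
    qed
    show "\<forall>\<^sub>F t in at_right 0. (1 - \<delta>) * b * t \<le> 1 - dual_activation \<phi> (1 - t)" if "0 < \<delta>" for \<delta>
    proof -
      have "((\<lambda>y. (dual_activation \<phi> y - dual_activation \<phi> 1) / (y - 1)) \<longlongrightarrow> b) (at 1 within {-1..1})"
        using der[of 1] D1 by (simp add: has_field_derivative_iff)
      moreover have "filterlim (\<lambda>t. 1 - t) (at (1::real) within {-1..1}) (at_right 0)"
        unfolding filterlim_at
      proof
        show "\<forall>\<^sub>F t in at_right 0. 1 - t \<in> {-1..1} \<and> 1 - t \<noteq> (1::real)"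
          by (rule eventually_at_rightI[of 0 1]) auto
        show "((\<lambda>t. 1 - t) \<longlongrightarrow> (1::real)) (at_right 0)" by (auto intro!: tendsto_eq_intros)
      qed
      ultimately have "((\<lambda>t. (dual_activation \<phi> (1 - t) - dual_activation \<phi> 1) / (1 - t - 1)) \<longlongrightarrow> b) (at_right 0)"
        by (rule filterlim_compose)
      then have "\<forall>\<^sub>F t in at_right 0. (1 - \<delta>) * b < (dual_activation \<phi> (1 - t) - dual_activation \<phi> 1) / (1 - t - 1)"
        by (rule order_tendstoD) (use that b in \<open>simp add: algebra_simps\<close>)
      moreover have "\<forall>\<^sub>F t in at_right (0::real). 0 < t" by (simp add: eventually_at_right_less)
      ultimately show ?thesis by eventually_elim (simp add: d1 field_simps)
    qed
  qed
qed

theorem normalized_activation_dual_iteration: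
  assumes \<phi>: "normalized_activation \<phi> \<phi>'"
    and "gauss_E \<phi> = 0" "gauss_E \<phi>' \<noteq> 0"
    and d: "0 < d" and eq: "- (ln ((gauss_E \<phi>')\<^sup>2) / ln (gauss_E (\<lambda>x. (\<phi>' x)\<^sup>2))) = d"
  shows "dual_iteration \<phi> ((gauss_E \<phi>')\<^sup>2) (gauss_E (\<lambda>x. (\<phi>' x)\<^sup>2))"
    and "(gauss_E \<phi>')\<^sup>2 = gauss_E (\<lambda>x. (\<phi>' x)\<^sup>2) powr (- d)"
proof -
  obtain e :: "nat \<Rightarrow> real" where e0: "\<And>k. 0 \<le> e k" and e1: "e sums 1"
    and F: "\<And>\<rho>. \<bar>\<rho>\<bar> \<le> 1 \<Longrightarrow> (\<lambda>k. e k * \<rho> ^ k) sums dual_activation \<phi> \<rho>"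
    and z0: "e 0 = (gauss_E \<phi>)\<^sup>2" and a: "e 1 = (gauss_E \<phi>')\<^sup>2"
    and eb: "(\<lambda>k. real k * e k) sums gauss_E (\<lambda>x. (\<phi>' x)\<^sup>2)"
    using dual_activation_series[OF \<phi>] by blast
  define A where "A = (gauss_E \<phi>')\<^sup>2"
  define B where "B = gauss_E (\<lambda>x. (\<phi>' x)\<^sup>2)"
  have eA: "e 1 = A" using a by (simp add: A_def)
  have z0: "e 0 = 0" using z0 assms by simp
  have A0: "0 < A" using assms by (simp add: A_def)
  have A1: "A \<le> 1"
    by (rule sums_le[OF _ sums_single[of 1] e1]) (use e0 eA in auto)
  have B1: "1 \<le> B"
  proof (rule sums_le[OF _ e1 eb[folded B_def]])
    show "e k \<le> real k * e k" for k
      using z0 mult_right_mono[of 1 "real k" "e k"] e0[of k] by (cases k) auto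
  qed
  have eq': "- (ln A / ln B) = d" using eq by (simp add: A_def B_def)
  \<comment> \<open>ln 1 = 0 and division by 0 yields 0, so either equality would make the quotient
    0, against d > 0.\<close>
  have "A \<noteq> 1" "B \<noteq> 1" using eq' d by auto
  then have lt: "A < 1" "1 < B" using A1 B1 by auto
  show "dual_iteration \<phi> ((gauss_E \<phi>')\<^sup>2) (gauss_E (\<lambda>x. (\<phi>' x)\<^sup>2))"
    using dual_iteration_of_series[OF e0 e1 eb F z0] eA A0 lt by (simp add: A_def B_def)
  have "ln A = - d * ln B" using eq' lt by (simp add: field_simps)
  then have "A = exp (- d * ln B)" using A0 by (metis exp_ln)
  then show "(gauss_E \<phi>')\<^sup>2 = gauss_E (\<lambda>x. (\<phi>' x)\<^sup>2) powr (- d)"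
    using lt by (simp add: powr_def A_def[symmetric] B_def[symmetric])
qed

section \<open>Limit and measurability of the predictor\<close>

lemma det_mat_permutations:
  "Determinant.det (mat n n a) = (\<Sum>p | p permutes {0..<n}. signof p * (\<Prod>i=0..<n. a (i, p i)))"
proof -
  have "p i < n" if "p permutes {0..<n}" "i < n" for p i
    using permutes_in_image[OF that(1), of i] that(2) by simp
  then show ?thesis by (subst Determinant.det_def'[of _ n]) (auto intro!: sum.cong prod.cong)
qed

lemma tendsto_det:
  fixes a :: "'b \<Rightarrow> nat \<times> nat \<Rightarrow> real"
  assumes "\<And>i j. i < n \<Longrightarrow> j < n \<Longrightarrow> ((\<lambda>L. a L (i, j)) \<longlongrightarrow> l (i, j)) F"
  shows "((\<lambda>L. Determinant.det (mat n n (a L))) \<longlongrightarrow> Determinant.det (mat n n l)) F"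
proof -
  have "p i < n" if "p permutes {0..<n}" "i < n" for p i
    using permutes_in_image[OF that(1), of i] that(2) by simp
  then show ?thesis
    unfolding det_mat_permutations by (intro tendsto_intros assms) auto
qed

lemma borel_measurable_det:
  fixes a :: "'b \<Rightarrow> nat \<times> nat \<Rightarrow> real"
  assumes "\<And>i j. i < n \<Longrightarrow> j < n \<Longrightarrow> (\<lambda>S. a S (i, j)) \<in> borel_measurable M"
  shows "(\<lambda>S. Determinant.det (mat n n (a S))) \<in> borel_measurable M"
proof -
  have "p i < n" if "p permutes {0..<n}" "i < n" for p i
    using permutes_in_image[OF that(1), of i] that(2) by simp
  then show ?thesis
    unfolding det_mat_permutations
    by (intro borel_measurable_sum borel_measurable_times borel_measurable_prod assms) auto
qed

text \<open>Minors are again of the form \<open>mat\<close> over a reindexed entry function, so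
  continuity and measurability of determinants carry over to cofactors.\<close>

lemma cofactor_mat:
  assumes "i < n" "j < n"
  shows "cofactor (mat n n a) i j =
    (-1) ^ (i + j) * Determinant.det (mat (n - 1) (n - 1)
      (\<lambda>(k, l). a (if k < i then k else Suc k, if l < j then l else Suc l)))"
proof -
  have "mat_delete (mat n n a) i j = mat (n - 1) (n - 1)
      (\<lambda>(k, l). a (if k < i then k else Suc k, if l < j then l else Suc l))"
    unfolding mat_delete_def by (rule eq_matI) auto
  then show ?thesis by (simp add: cofactor_def)
qed

lemma tendsto_cofactor:
  fixes a :: "'b \<Rightarrow> nat \<times> nat \<Rightarrow> real"
  assumes "\<And>i j. i < n \<Longrightarrow> j < n \<Longrightarrow> ((\<lambda>L. a L (i, j)) \<longlongrightarrow> l (i, j)) F" and "i < n" "j < n"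
  shows "((\<lambda>L. cofactor (mat n n (a L)) i j) \<longlongrightarrow> cofactor (mat n n l) i j) F"
  unfolding cofactor_mat[OF assms(2,3)]
  by (intro tendsto_intros tendsto_det) (auto intro!: assms(1))

lemma borel_measurable_cofactor:
  fixes a :: "'b \<Rightarrow> nat \<times> nat \<Rightarrow> real"
  assumes "\<And>i j. i < n \<Longrightarrow> j < n \<Longrightarrow> (\<lambda>S. a S (i, j)) \<in> borel_measurable M" and "i < n" "j < n"
  shows "(\<lambda>S. cofactor (mat n n (a S)) i j) \<in> borel_measurable M"
  unfolding cofactor_mat[OF assms(2,3)]
  by (intro borel_measurable_times borel_measurable_const borel_measurable_det) (auto intro!: assms(1))

lemma cofactor_one_mat:
  assumes "i < n" "j < n"
  shows "cofactor (1\<^sub>m n :: real mat) i j = (if i = j then 1 else 0)"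
proof -
  have "adj_mat (1\<^sub>m n :: real mat) * 1\<^sub>m n = Determinant.det (1\<^sub>m n :: real mat) \<cdot>\<^sub>m 1\<^sub>m n"
    by (rule adj_mat(3)) simp
  moreover have "1 \<cdot>\<^sub>m (1\<^sub>m n :: real mat) = 1\<^sub>m n" by (rule eq_matI) auto
  ultimately have "adj_mat (1\<^sub>m n :: real mat) = 1\<^sub>m n"
    using adj_mat(1)[of "1\<^sub>m n :: real mat" n] by simp
  then have "adj_mat (1\<^sub>m n :: real mat) $$ (j, i) = (1\<^sub>m n :: real mat) $$ (j, i)" by simp
  then show ?thesis using assms by (simp add: adj_mat_def)
qed

lemma invertible_mat_iff_det:
  assumes A: "(A :: real mat) \<in> carrier_mat n n"
  shows "invertible_mat A \<longleftrightarrow> Determinant.det A \<noteq> 0"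
proof
  assume "invertible_mat A"
  then obtain B where B: "A * B = 1\<^sub>m n" "B * A = 1\<^sub>m (dim_row B)"
    using A by (auto simp: invertible_mat_def inverts_mat_def)
  have "dim_col B = n" using arg_cong[OF B(1), of dim_col] by simp
  moreover have "dim_row B = n" using arg_cong[OF B(2), of dim_col] A by simp
  ultimately have "B \<in> carrier_mat n n" by auto
  then have "Determinant.det A * Determinant.det B = 1" using Determinant.det_mult[OF A] B(1) by (metis Determinant.det_one)
  then show "Determinant.det A \<noteq> 0" by auto
next
  assume d: "Determinant.det A \<noteq> 0"
  define B where "B = (1 / Determinant.det A) \<cdot>\<^sub>m adj_mat A"
  have c: "adj_mat A \<in> carrier_mat n n" by (rule adj_mat(1)[OF A])
  have "(1 / Determinant.det A) \<cdot>\<^sub>m (Determinant.det A \<cdot>\<^sub>m 1\<^sub>m n) = 1\<^sub>m n"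
    using d by (intro eq_matI) auto
  then have "A * B = 1\<^sub>m n" "B * A = 1\<^sub>m n"
    unfolding B_def mult_smult_distrib[OF A c] mult_smult_assoc_mat[OF c A] adj_mat(2,3)[OF A] by simp_all
  then show "invertible_mat A"
    using A c unfolding invertible_mat_def inverts_mat_def B_def by (auto intro!: exI[of _ B] simp: B_def)
qed

text \<open>An expression for y A^-1 k that is arithmetic in the entries, hence transparently
  measurable and, where the determinant is nonzero, continuous, in contrast to the algorithmic
  \<open>mat_inverse\<close>.\<close>

definition cramer_form :: "nat \<Rightarrow> (nat \<times> nat \<Rightarrow> real) \<Rightarrow> (nat \<Rightarrow> real) \<Rightarrow> (nat \<Rightarrow> real) \<Rightarrow> real" where
  "cramer_form n a k y =
     (\<Sum>i<n. y i * (\<Sum>j<n. cofactor (mat n n a) j i * k j)) / Determinant.det (mat n n a)"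

lemma mat_inverse_cramer:
  assumes d: "Determinant.det (mat n n a) \<noteq> 0"
  shows "scalar_prod (Matrix.vec n y) (the (mat_inverse (mat n n a)) *\<^sub>v Matrix.vec n k) = cramer_form n a k y"
proof -
  define A where "A = mat n n a"
  have A: "A \<in> carrier_mat n n" by (simp add: A_def)
  have c: "adj_mat A \<in> carrier_mat n n" by (rule adj_mat(1)[OF A])
  obtain B where B: "mat_inverse A = Some B"
  proof (cases "mat_inverse A")
    case None
    have "invertible_mat A" using d invertible_mat_iff_det[OF A] by (simp add: A_def)
    then obtain B where B: "A * B = 1\<^sub>m n" "B * A = 1\<^sub>m (dim_row B)"
      using A by (auto simp: invertible_mat_def inverts_mat_def)
    have "dim_col B = n" using arg_cong[OF B(1), of dim_col] by simp
    moreover have "dim_row B = n" using arg_cong[OF B(2), of dim_col] A by simp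
    ultimately have "A \<in> Units (ring_mat TYPE(real) n n)"
      using A B by (auto simp: Units_def ring_mat_def intro!: bexI[of _ B])
    then show ?thesis using mat_inverse(1)[OF A None, of n] by blast
  qed
  have inv: "A * B = 1\<^sub>m n" "B * A = 1\<^sub>m n" "B \<in> carrier_mat n n" using mat_inverse(2)[OF A B] by auto
  have "adj_mat A = adj_mat A * (A * B)" using inv c by simp
  also have "\<dots> = (adj_mat A * A) * B" using A c inv(3) by (simp add: assoc_mult_mat)
  also have "\<dots> = Determinant.det A \<cdot>\<^sub>m B"
    unfolding adj_mat(3)[OF A] mult_smult_assoc_mat[OF one_carrier_mat inv(3)] using inv(3) by simp
  finally have adj: "adj_mat A = Determinant.det A \<cdot>\<^sub>m B" .
  have Bij: "B $$ (i, j) = cofactor A j i / Determinant.det A" if "i < n" "j < n" for i j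
  proof -
    have "adj_mat A $$ (i, j) = Determinant.det A * B $$ (i, j)" unfolding adj using that inv(3) by auto
    moreover have "adj_mat A $$ (i, j) = cofactor A j i" using that A by (simp add: adj_mat_def)
    ultimately show ?thesis using d by (simp add: A_def field_simps)
  qed
  have "scalar_prod (Matrix.vec n y) (B *\<^sub>v Matrix.vec n k) = (\<Sum>i<n. y i * (\<Sum>j<n. B $$ (i, j) * k j))"
    using inv(3) by (auto simp: scalar_prod_def lessThan_atLeast0 intro!: sum.cong)
  also have "\<dots> = (\<Sum>i<n. y i * (\<Sum>j<n. cofactor A j i / Determinant.det A * k j))"
    by (intro sum.cong refl arg_cong2[where f="(*)"]) (auto simp: Bij)
  also have "\<dots> = cramer_form n a k y"
    by (simp add: cramer_form_def A_def sum_divide_distrib sum_distrib_left)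
  finally show ?thesis using B by (simp add: A_def)
qed

text \<open>Cofactors are homogeneous of degree n - 1 and the determinant of degree n, so the
  inverse scales with degree -1. Matrix and vector can thus be rescaled independently by positive
  factors without changing the sign of the form.\<close>

lemma cramer_form_scale:
  assumes \<kappa>: "\<kappa> \<noteq> 0"
  shows "cramer_form n (\<lambda>p. a p / \<kappa>) (\<lambda>j. k j / \<mu>) y = \<kappa> / \<mu> * cramer_form n a k y"
proof (cases "n = 0")
  case False
  have m: "mat m m (\<lambda>p. h p / \<kappa>) = (1 / \<kappa>) \<cdot>\<^sub>m mat m m h" for m h by (rule eq_matI) auto
  have det: "Determinant.det (mat m m (\<lambda>p. h p / \<kappa>)) = (1 / \<kappa>) ^ m * Determinant.det (mat m m h)" for m h
    unfolding m by (subst Determinant.det_smult) simp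
  have cof: "cofactor (mat n n (\<lambda>p. a p / \<kappa>)) j i = (1 / \<kappa>) ^ (n - 1) * cofactor (mat n n a) j i"
    if "i < n" "j < n" for i j
    unfolding cofactor_mat[OF that(2,1)]
    using det[of "n - 1" "\<lambda>(k, l). a (if k < j then k else Suc k, if l < i then l else Suc l)"]
    by (simp add: case_prod_unfold)
  have "(\<Sum>i<n. y i * (\<Sum>j<n. cofactor (mat n n (\<lambda>p. a p / \<kappa>)) j i * (k j / \<mu>)))
     = (\<Sum>i<n. y i * (\<Sum>j<n. (1 / \<kappa>) ^ (n - 1) / \<mu> * (cofactor (mat n n a) j i * k j)))"
    by (rule sum.cong, simp, rule arg_cong2[where f="(*)"], simp, rule sum.cong) (simp_all add: cof)
  also have "\<dots> = (1 / \<kappa>) ^ (n - 1) / \<mu> * (\<Sum>i<n. y i * (\<Sum>j<n. cofactor (mat n n a) j i * k j))"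
    by (simp add: sum_distrib_left mult_ac)
  finally have *: "(\<Sum>i<n. y i * (\<Sum>j<n. cofactor (mat n n (\<lambda>p. a p / \<kappa>)) j i * (k j / \<mu>))) = \<dots>" .
  obtain m where "n = Suc m" using False by (cases n) auto
  then have "(1 / \<kappa>) ^ (n - 1) / \<mu> * X / ((1 / \<kappa>) ^ n * Y) = \<kappa> / \<mu> * (X / Y)" for X Y
    using \<kappa> by (simp add: field_simps)
  then show ?thesis unfolding cramer_form_def * det .
qed (simp add: cramer_form_def)

text \<open>The limiting matrix is the identity, whose cofactors are the entries of the identity and
  whose determinant is 1.\<close>

lemma tendsto_cramer_form:
  fixes a :: "'b \<Rightarrow> nat \<times> nat \<Rightarrow> real"
  assumes a: "\<And>i j. i < n \<Longrightarrow> j < n \<Longrightarrow> ((\<lambda>L. a L (i, j)) \<longlongrightarrow> (if i = j then 1 else 0)) F"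
    and k: "\<And>j. j < n \<Longrightarrow> ((\<lambda>L. k L j) \<longlongrightarrow> l j) F"
  shows "((\<lambda>L. Determinant.det (mat n n (a L))) \<longlongrightarrow> 1) F"
    and "((\<lambda>L. cramer_form n (a L) (k L) y) \<longlongrightarrow> (\<Sum>i<n. y i * l i)) F"
proof -
  define I where "I = (\<lambda>(i::nat, j). if i = j then 1 else 0 :: real)"
  have I: "mat n n I = 1\<^sub>m n" by (rule eq_matI) (auto simp: I_def)
  have aI: "((\<lambda>L. a L (i, j)) \<longlongrightarrow> I (i, j)) F" if "i < n" "j < n" for i j
    using a[OF that] by (simp add: I_def)
  show det: "((\<lambda>L. Determinant.det (mat n n (a L))) \<longlongrightarrow> 1) F"
    using tendsto_det[of n a I F] aI by (simp add: I)
  have "((\<lambda>L. \<Sum>i<n. y i * (\<Sum>j<n. cofactor (mat n n (a L)) j i * k L j)) \<longlongrightarrow>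
      (\<Sum>i<n. y i * (\<Sum>j<n. cofactor (mat n n I) j i * l j))) F"
    by (intro tendsto_intros tendsto_cofactor aI k) auto
  also have "(\<Sum>i<n. y i * (\<Sum>j<n. cofactor (mat n n I) j i * l j)) = (\<Sum>i<n. y i * l i)"
  proof (intro sum.cong refl arg_cong2[where f="(*)"])
    fix i assume i: "i \<in> {..<n}"
    have "(\<Sum>j<n. cofactor (mat n n I) j i * l j) = (\<Sum>j<n. if j = i then l i else 0)"
      by (intro sum.cong) (use i in \<open>auto simp: I cofactor_one_mat\<close>)
    then show "(\<Sum>j<n. cofactor (mat n n I) j i * l j) = l i" using i by simp
  qed
  finally show "((\<lambda>L. cramer_form n (a L) (k L) y) \<longlongrightarrow> (\<Sum>i<n. y i * l i)) F"
    unfolding cramer_form_def using tendsto_divide[OF _ det] by fastforce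
qed

lemma borel_measurable_cramer_form:
  assumes "\<And>i j. i < n \<Longrightarrow> j < n \<Longrightarrow> (\<lambda>S. a S (i, j)) \<in> borel_measurable M"
    and "\<And>j. j < n \<Longrightarrow> (\<lambda>S. k S j) \<in> borel_measurable M"
    and "\<And>j. j < n \<Longrightarrow> (\<lambda>S. y S j) \<in> borel_measurable M"
  shows "(\<lambda>S. cramer_form n (a S) (k S) (y S)) \<in> borel_measurable M"
  unfolding cramer_form_def
  by (intro borel_measurable_divide borel_measurable_sum borel_measurable_times
      borel_measurable_cofactor borel_measurable_det assms) auto

section \<open>The classifier as the sign of a vote\<close>

context dual_iteration
begin

abbreviation overlap :: "(nat \<Rightarrow> (real^'k) \<times> real) \<Rightarrow> nat \<Rightarrow> real^'k \<Rightarrow> real" where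
  "overlap S i x \<equiv> inner (fst (S i)) x"

definition vote :: "nat \<Rightarrow> (nat \<Rightarrow> (real^'k) \<times> real) \<Rightarrow> real^'k \<Rightarrow> real" where
  "vote n S x = (\<Sum>i<n. snd (S i) * koenigs (overlap S i x))"

definition gram :: "nat \<Rightarrow> (nat \<Rightarrow> (real^'k) \<times> real) \<Rightarrow> nat \<times> nat \<Rightarrow> real" where
  "gram L S = (\<lambda>(i, j). ntk \<phi> L (inner (fst (S i)) (fst (S j))))"

lemma ntk_predictor_cramer:
  assumes "invertible_mat (ntk_matrix \<phi> L n S)"
  shows "ntk_predictor \<phi> L n S x = cramer_form n (gram L S) (\<lambda>i. ntk \<phi> L (overlap S i x)) (\<lambda>i. snd (S i))"
proof -
  have "Determinant.det (mat n n (gram L S)) \<noteq> 0"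
    using assms invertible_mat_iff_det[of "ntk_matrix \<phi> L n S" n] by (simp add: ntk_matrix_def gram_def)
  from mat_inverse_cramer[OF this] show ?thesis
    unfolding ntk_predictor_def ntk_matrix_def gram_def by simp
qed

text \<open>The diagonal of the kernel matrix stays above \<open>1\<close> while the off-diagonal entries and the
  kernel vector tend to \<open>0\<close>, so that the predictor is asymptotically a weighted vote.\<close>

theorem deep_classifier_vote:
  assumes range: "\<And>i. i < n \<Longrightarrow> 0 \<le> overlap S i x \<and> overlap S i x < 1"
    and diag: "\<And>i. i < n \<Longrightarrow> inner (fst (S i)) (fst (S i)) = 1"
    and off: "\<And>i j. i < n \<Longrightarrow> j < n \<Longrightarrow> i \<noteq> j \<Longrightarrow> 0 \<le> inner (fst (S i)) (fst (S j)) \<and> inner (fst (S i)) (fst (S j)) < 1"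
    and v: "vote n S x \<noteq> 0"
  shows "deep_classifier_defined \<phi> n S x" and "deep_classifier \<phi> n S x = sgn (vote n S x)"
proof -
  \<comment> \<open>The matrix is rescaled by its diagonal and the vector by the rate in
    \<open>ntk_limit\<close>; the two scales differ, but both are positive and only the sign of the
    predictor counts.\<close>
  define \<kappa> where "\<kappa> L = ntk \<phi> L 1" for L
  define \<mu> where "\<mu> L = real (Suc L) * a ^ L" for L
  have \<kappa>: "1 \<le> \<kappa> L" for L using ntk_at_1 by (simp add: \<kappa>_def)
  have \<mu>: "0 < \<mu> L" for L using a by (simp add: \<mu>_def)
  have entries: "(\<lambda>L. gram L S (i, j) / \<kappa> L) \<longlonglongrightarrow> (if i = j then 1 else 0)" if "i < n" "j < n" for i j
  proof (cases "i = j")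
    case True
    have "gram L S (i, j) / \<kappa> L = 1" for L
      using True diag[OF that(1)] \<kappa>[of L] by (simp add: gram_def \<kappa>_def)
    then have "(\<lambda>L. gram L S (i, j) / \<kappa> L) = (\<lambda>L. 1)" by (rule ext)
    then show ?thesis unfolding if_P[OF True] by (simp only: tendsto_const)
  next
    case False
    let ?z = "inner (fst (S i)) (fst (S j))"
    have z: "0 \<le> ?z" "?z < 1" using off[OF that False] by auto
    have "(\<lambda>L. gram L S (i, j) / \<kappa> L) \<longlonglongrightarrow> 0"
    proof (rule tendsto_rabs_zero_cancel, rule tendsto_sandwich[OF always_eventually always_eventually tendsto_const])
      show "(\<lambda>L. \<bar>ntk \<phi> L ?z\<bar>) \<longlonglongrightarrow> 0" using tendsto_rabs_zero[OF ntk_tendsto_0[OF z]] .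
      show "\<forall>L. \<bar>gram L S (i, j) / \<kappa> L\<bar> \<le> \<bar>ntk \<phi> L ?z\<bar>"
      proof
        fix L
        have "\<bar>ntk \<phi> L ?z\<bar> / \<kappa> L \<le> \<bar>ntk \<phi> L ?z\<bar> / 1" using \<kappa>[of L] by (intro divide_left_mono) auto
        then show "\<bar>gram L S (i, j) / \<kappa> L\<bar> \<le> \<bar>ntk \<phi> L ?z\<bar>" using \<kappa>[of L] by (simp add: gram_def abs_divide)
      qed
    qed auto
    then show ?thesis using False by simp
  qed
  have kv: "(\<lambda>L. ntk \<phi> L (overlap S j x) / \<mu> L) \<longlonglongrightarrow> koenigs (overlap S j x)" if "j < n" for j
    unfolding \<mu>_def using ntk_limit range[OF that] by blast
  note lim = tendsto_cramer_form[OF entries kv]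
  have "\<forall>\<^sub>F L in sequentially. 0 < Determinant.det (mat n n (\<lambda>p. gram L S p / \<kappa> L))"
    by (rule order_tendstoD(1)[OF lim(1)]) auto
  then have inv: "\<forall>\<^sub>F L in sequentially. invertible_mat (ntk_matrix \<phi> L n S)"
  proof eventually_elim
    case (elim L)
    have "mat n n (\<lambda>p. gram L S p / \<kappa> L) = (1 / \<kappa> L) \<cdot>\<^sub>m ntk_matrix \<phi> L n S"
      by (rule eq_matI) (auto simp: ntk_matrix_def gram_def)
    then have "Determinant.det (ntk_matrix \<phi> L n S) \<noteq> 0" using elim by auto
    then show ?case using invertible_mat_iff_det[of "ntk_matrix \<phi> L n S" n] by (simp add: ntk_matrix_def)
  qed
  have "(\<lambda>L. sgn (cramer_form n (\<lambda>p. gram L S p / \<kappa> L) (\<lambda>j. ntk \<phi> L (overlap S j x) / \<mu> L) (\<lambda>i. snd (S i))))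
      \<longlonglongrightarrow> sgn (vote n S x)"
    using v lim(2) unfolding vote_def by (intro tendsto_sgn) auto
  then have sgn: "(\<lambda>L. sgn (ntk_predictor \<phi> L n S x)) \<longlonglongrightarrow> sgn (vote n S x)"
  proof (rule Lim_transform_eventually)
    show "\<forall>\<^sub>F L in sequentially. sgn (cramer_form n (\<lambda>p. gram L S p / \<kappa> L) (\<lambda>j. ntk \<phi> L (overlap S j x) / \<mu> L) (\<lambda>i. snd (S i)))
        = sgn (ntk_predictor \<phi> L n S x)"
      using inv
    proof eventually_elim
      case (elim L)
      have pos: "\<kappa> L / \<mu> L > 0" "\<kappa> L \<noteq> 0" using \<kappa>[of L] \<mu>[of L] by auto
      show ?case
        unfolding ntk_predictor_cramer[OF elim] cramer_form_scale[OF pos(2)] sgn_mult sgn_pos[OF pos(1)] by simp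
    qed
  qed
  then show "deep_classifier_defined \<phi> n S x"
    using inv by (auto simp: deep_classifier_defined_def convergent_def)
  show "deep_classifier \<phi> n S x = sgn (vote n S x)"
    unfolding deep_classifier_def using limI[OF sgn] .
qed

end

section \<open>A weak law for heavy-tailed votes\<close>

text \<open>A discrete layer cake with levels in geometric progression; through it the tail at the
  scales r a ^ j enters a lower bound for the truncated mean.\<close>

lemma staircase_bound:
  fixes g r a :: real
  assumes "0 \<le> g" "0 < a" "a < 1" "0 \<le> r"
  shows "(\<Sum>j<J. (r * a ^ j - r * a ^ Suc j) * indicator {x. r * a ^ j < x} g) \<le> min g r"
proof -
  \<comment> \<open>The induction needs this sharper bound: it counts only the part of
    \<open>min g r\<close> above the lowest level r a ^ J.\<close>
  have "(\<Sum>j<J. (r * a ^ j - r * a ^ Suc j) * indicator {x. r * a ^ j < x} g) \<le> max 0 (min g r - r * a ^ J)"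
  proof (induction J)
    case (Suc J)
    have le: "r * a ^ Suc J \<le> r * a ^ J"
      using assms by (intro mult_left_mono power_decreasing) auto
    have lr: "r * a ^ J \<le> r" using assms mult_left_mono[OF power_le_one[of a J], of r] by auto
    show ?case
    proof (cases "r * a ^ J < g")
      case True
      then have "max 0 (min g r - r * a ^ J) = min g r - r * a ^ J" using lr by auto
      then show ?thesis using True Suc by simp
    next
      case False
      then show ?thesis using Suc le by simp
    qed
  qed (use assms in auto)
  also have "\<dots> \<le> min g r"
  proof -
    define q where "q = r * a ^ J"
    have "0 \<le> q" using assms by (auto simp: q_def)
    then show ?thesis using assms unfolding q_def[symmetric] by (auto simp: max_def min_def)
  qed
  finally show ?thesis .
qed

lemma layer_sum_bounds:
  fixes g r h :: real
  assumes h: "0 < h"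
  defines "T \<equiv> \<lambda>n. \<Sum>i<n. h * indicator {x. r + real i * h < x} g"
    and "D \<equiv> \<lambda>n::nat. min g (r + real n * h) - min g r"
  shows "0 \<le> T n - D n" "T n - D n \<le> h"
proof -
  \<comment> \<open>The extra conjunct says that the staircase is exact until it passes g; only the
    step in which it passes g can overshoot, by at most h.\<close>
  have "0 \<le> T n - D n \<and> T n - D n \<le> h \<and> (r + real n * h \<le> g \<longrightarrow> T n = D n)"
  proof (induction n)
    case 0
    then show ?case using h by (simp add: T_def D_def)
  next
    case (Suc n)
    have T: "T (Suc n) = T n + (if r + real n * h < g then h else 0)"
      by (simp only: T_def sum.lessThan_Suc) (simp add: indicator_def)
    have e: "r + real (Suc n) * h = r + real n * h + h" by (simp add: algebra_simps)
    have nh: "0 \<le> real n * h" using h by simp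
    show ?case
    proof (cases "r + real n * h < g")
      case True
      have "r < g" using nh True by linarith
      then have rg: "min g r = r" by simp
      have mg: "min g (r + real n * h) = r + real n * h"
        using True by simp
      have "T n = D n" using Suc True by auto
      then have Tn: "T n = real n * h" unfolding D_def rg mg by simp
      have Ds: "D (Suc n) = min g (r + real n * h + h) - r" unfolding D_def e rg ..
      show ?thesis unfolding T Ds Tn e using True h by (auto simp: min_def)
    next
      case False
      then have "D (Suc n) = D n" using h nh unfolding D_def e by (auto simp: min_def)
      then show ?thesis using Suc False h unfolding T e by auto
    qed
  qed
  then show "0 \<le> T n - D n" "T n - D n \<le> h" by auto
qed

context prob_space
begin

text \<open>The layer-cake formula, with step functions in place of an integral over the heights.\<close>

lemma layer_cake_nonneg:
  fixes g y :: "'a \<Rightarrow> real"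
  assumes [measurable]: "g \<in> borel_measurable M" "y \<in> borel_measurable M"
    and yb: "\<And>s. s \<in> space M \<Longrightarrow> \<bar>y s\<bar> \<le> B"
    and lev: "\<And>u. r \<le> u \<Longrightarrow> 0 \<le> expectation (\<lambda>s. y s * indicator {x. u < x} (g s))"
    and r: "r \<le> r'"
  shows "0 \<le> expectation (\<lambda>s. y s * (min (g s) r' - min (g s) r))"
proof (cases "r = r'")
  case False
  then have rr: "r < r'" using r by simp
  have B0: "0 \<le> B" using yb not_empty by (meson abs_ge_zero all_not_in_conv order_trans)
  define h where "h n = (r' - r) / real (Suc n)" for n
  have h: "0 < h n" "r + real (Suc n) * h n = r'" for n using rr by (auto simp: h_def)
  \<comment> \<open>The layer sum has nonnegative weighted expectation and exceeds the difference of
    truncations by at most one mesh width, so the error is at most \<open>B * h n\<close> and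
    vanishes with the mesh.\<close>
  have lower: "- (B * h n) \<le> expectation (\<lambda>s. y s * (min (g s) r' - min (g s) r))" for n
  proof -
    let ?T = "\<lambda>s. \<Sum>i<Suc n. h n * indicator {x. r + real i * h n < x} (g s)"
    let ?D = "\<lambda>s. min (g s) r' - min (g s) r"
    have bnd: "0 \<le> ?T s - ?D s" "?T s - ?D s \<le> h n" for s
      using layer_sum_bounds[OF h(1)[of n], where n="Suc n" and r=r and g="g s"] h(2)[of n] by auto
    have ind: "integrable M (\<lambda>s. y s * indicator {x. u < x} (g s))" for u
      by (rule integrable_const_bound[where B=B]) (use yb B0 in \<open>auto simp: indicator_def\<close>)
    have iT: "integrable M (\<lambda>s. y s * ?T s)"
      unfolding sum_distrib_left by (intro Bochner_Integration.integrable_sum) (use ind in \<open>simp add: mult.left_commute[of _ "h n"]\<close>)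
    have iD: "integrable M (\<lambda>s. y s * ?D s)"
    proof (rule integrable_const_bound[where B="B * (r' - r)"])
      show "AE s in M. norm (y s * ?D s) \<le> B * (r' - r)"
      proof (intro AE_I2)
        fix s assume "s \<in> space M"
        moreover have "\<bar>?D s\<bar> \<le> r' - r" using rr by auto
        ultimately show "norm (y s * ?D s) \<le> B * (r' - r)"
          using yb B0 unfolding real_norm_def abs_mult by (intro mult_mono) auto
      qed
    qed measurable
    have "0 \<le> (\<Sum>i<Suc n. h n * expectation (\<lambda>s. y s * indicator {x. r + real i * h n < x} (g s)))"
      using h(1)[of n] by (intro sum_nonneg mult_nonneg_nonneg lev) auto
    also have "\<dots> = expectation (\<lambda>s. \<Sum>i<Suc n. h n * (y s * indicator {x. r + real i * h n < x} (g s)))"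
      using ind by (subst Bochner_Integration.integral_sum) auto
    also have "\<dots> = expectation (\<lambda>s. y s * ?T s)"
      by (simp only: sum_distrib_left mult.left_commute[of _ "h n"])
    also have "\<dots> = expectation (\<lambda>s. y s * ?D s) + expectation (\<lambda>s. y s * (?T s - ?D s))"
      using Bochner_Integration.integral_diff[OF iT iD] by (simp only: right_diff_distrib)
    also have "expectation (\<lambda>s. y s * (?T s - ?D s)) \<le> B * h n"
    proof (rule integral_le_const)
      show "integrable M (\<lambda>s. y s * (?T s - ?D s))"
        using Bochner_Integration.integrable_diff[OF iT iD] by (simp only: right_diff_distrib)
      show "AE s in M. y s * (?T s - ?D s) \<le> B * h n"
      proof (intro AE_I2)
        fix s assume "s \<in> space M"
        then have "\<bar>y s\<bar> * \<bar>?T s - ?D s\<bar> \<le> B * h n" using yb bnd[of s] B0 by (intro mult_mono) auto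
        then show "y s * (?T s - ?D s) \<le> B * h n" unfolding abs_mult[symmetric] by linarith
      qed
    qed
    finally show ?thesis by simp
  qed
  have "(\<lambda>n. - (B * h n)) \<longlonglongrightarrow> - (B * 0)"
    unfolding h_def by (intro tendsto_intros real_tendsto_divide_at_top[OF tendsto_const]
        filterlim_compose[OF filterlim_real_sequentially filterlim_Suc])
  then show ?thesis using lower by (intro LIMSEQ_le_const2[of "\<lambda>n. - (B * h n)" 0]) auto
qed simp

end

text \<open>Chebyshev's inequality: on this event the centred sum deviates by at least n times the
  mean. The variance is bounded by the second moment, which is what the truncation argument
  controls.\<close>

lemma iid_sum_nonpos_prob:
  fixes W :: "'a \<Rightarrow> real"
  assumes D: "prob_space D" and mW[measurable]: "W \<in> borel_measurable D"
    and bd: "\<And>s. s \<in> space D \<Longrightarrow> \<bar>W s\<bar> \<le> B" and n: "0 < n"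
    and pos: "0 < (\<integral>s. W s \<partial>D)"
  shows "measure (Pi\<^sub>M {..<n} (\<lambda>_. D)) {S \<in> space (Pi\<^sub>M {..<n} (\<lambda>_. D)). (\<Sum>i<n. W (S i)) \<le> 0}
    \<le> (\<integral>s. (W s)\<^sup>2 \<partial>D) / (real n * (\<integral>s. W s \<partial>D)\<^sup>2)"
proof -
  interpret D: prob_space D by (rule D)
  let ?P = "Pi\<^sub>M {..<n} (\<lambda>_. D)"
  interpret P: product_sigma_finite "\<lambda>_::nat. D" by standard
  interpret PP: prob_space ?P by (intro prob_space_PiM D)
  define \<mu> where "\<mu> = (\<integral>s. W s \<partial>D)"
  define V where "V s = W s - \<mu>" for s
  have mV[measurable]: "V \<in> borel_measurable D" unfolding V_def[abs_def] by measurable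
  have Wi: "integrable D W" using bd by (intro D.integrable_const_bound[where B=B]) auto
  have W2: "integrable D (\<lambda>s. (W s)\<^sup>2)"
  proof (intro D.integrable_const_bound[where B="B\<^sup>2"] AE_I2)
    fix s assume "s \<in> space D"
    then show "norm ((W s)\<^sup>2) \<le> B\<^sup>2" using bd[of s] by (simp add: abs_le_square_iff[symmetric])
  qed measurable
  have Vi: "integrable D V" and V0: "(\<integral>s. V s \<partial>D) = 0"
    using Wi D.prob_space by (auto simp: V_def[abs_def] \<mu>_def)
  have Vb: "\<bar>V s\<bar> \<le> B + \<bar>\<mu>\<bar>" if "s \<in> space D" for s using bd[OF that] by (auto simp: V_def)
  have V2i: "integrable D (\<lambda>s. (V s)\<^sup>2)"
  proof (intro D.integrable_const_bound[where B="(B + \<bar>\<mu>\<bar>)\<^sup>2"] AE_I2)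
    fix s assume "s \<in> space D"
    then show "norm ((V s)\<^sup>2) \<le> (B + \<bar>\<mu>\<bar>)\<^sup>2" using Vb[of s] by (simp add: abs_le_square_iff[symmetric])
  qed measurable
  have V2: "(\<integral>s. (V s)\<^sup>2 \<partial>D) \<le> (\<integral>s. (W s)\<^sup>2 \<partial>D)"
  proof -
    have "(\<integral>s. (V s)\<^sup>2 \<partial>D) = (\<integral>s. (W s)\<^sup>2 - 2 * \<mu> * W s + \<mu>\<^sup>2 \<partial>D)"
      by (intro Bochner_Integration.integral_cong) (auto simp: V_def power2_eq_square algebra_simps)
    also have "\<dots> = (\<integral>s. (W s)\<^sup>2 \<partial>D) - 2 * \<mu> * \<mu> + \<mu>\<^sup>2"
      using W2 Wi D.prob_space by (simp add: \<mu>_def)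
    finally show ?thesis by (simp add: power2_eq_square)
  qed
  have comp: "(\<lambda>S. S i) \<in> ?P \<rightarrow>\<^sub>M D" if "i < n" for i using that by (intro measurable_component_singleton) auto
  have VS[measurable]: "(\<lambda>S. V (S i)) \<in> borel_measurable ?P" if "i < n" for i
    by (rule measurable_compose[OF comp[OF that] mV])
  have WS[measurable]: "(\<lambda>S. W (S i)) \<in> borel_measurable ?P" if "i < n" for i
    by (rule measurable_compose[OF comp[OF that] mW])
  have ViS: "integrable ?P (\<lambda>S. V (S i) * V (S j))" if "i < n" "j < n" for i j
  proof (rule PP.integrable_const_bound[where B="(B + \<bar>\<mu>\<bar>) * (B + \<bar>\<mu>\<bar>)"])
    show "AE S in ?P. norm (V (S i) * V (S j)) \<le> (B + \<bar>\<mu>\<bar>) * (B + \<bar>\<mu>\<bar>)"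
    proof (intro AE_I2)
      fix S assume "S \<in> space ?P"
      then have "S i \<in> space D" "S j \<in> space D" using that by (auto simp: space_PiM PiE_iff)
      then have "\<bar>V (S i)\<bar> * \<bar>V (S j)\<bar> \<le> (B + \<bar>\<mu>\<bar>) * (B + \<bar>\<mu>\<bar>)"
        using Vb[of "S i"] Vb[of "S j"] by (intro mult_mono) auto
      then show "norm (V (S i) * V (S j)) \<le> (B + \<bar>\<mu>\<bar>) * (B + \<bar>\<mu>\<bar>)" by (simp add: abs_mult)
    qed
  qed (use that in measurable)
  have cross: "(\<integral>S. V (S i) * V (S j) \<partial>?P) = (if i = j then \<integral>s. (V s)\<^sup>2 \<partial>D else 0)" if ij: "i < n" "j < n" for i j
  proof (cases "i = j")
    case True
    have "(\<integral>S. (V (S i))\<^sup>2 \<partial>?P) = (\<integral>s. (V s)\<^sup>2 \<partial>distr ?P D (\<lambda>S. S i))"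
      using comp[OF ij(1)] by (subst integral_distr) auto
    also have "distr ?P D (\<lambda>S. S i) = D" using ij by (intro distr_PiM_component D) auto
    finally show ?thesis using True by (simp add: power2_eq_square)
  next
    case False
    \<comment> \<open>The mixed moment is written as a product over all coordinates, with factor 1
      outside i and j, so that independence applies; the factor at i integrates to 0.\<close>
    let ?f = "\<lambda>k. if k = i \<or> k = j then V else (\<lambda>_. 1)"
    have "(\<integral>S. (\<Prod>k<n. ?f k (S k)) \<partial>?P) = (\<Prod>k<n. integral\<^sup>L D (?f k))"
      by (rule P.product_integral_prod) (auto simp: Vi)
    also have "\<dots> = 0" using ij V0 by (intro prod_zero) (auto intro!: bexI[of _ i])
    also have "(\<lambda>S. \<Prod>k<n. ?f k (S k)) = (\<lambda>S. V (S i) * V (S j))"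
    proof
      fix S
      have "(\<Prod>k<n. ?f k (S k)) = (\<Prod>k\<in>{i, j}. V (S k))"
        using ij by (intro prod.mono_neutral_cong_right) auto
      then show "(\<Prod>k<n. ?f k (S k)) = V (S i) * V (S j)" using False by simp
    qed
    finally show ?thesis using False by simp
  qed
  have sq: "(\<lambda>S. (\<Sum>i<n. V (S i))\<^sup>2) = (\<lambda>S. \<Sum>i<n. \<Sum>j<n. V (S i) * V (S j))"
    by (auto simp: power2_eq_square sum_product)
  have isq: "integrable ?P (\<lambda>S. (\<Sum>i<n. V (S i))\<^sup>2)"
    unfolding sq by (intro Bochner_Integration.integrable_sum ViS) auto
  have "(\<integral>S. (\<Sum>i<n. V (S i))\<^sup>2 \<partial>?P) = (\<Sum>i<n. \<Sum>j<n. \<integral>S. V (S i) * V (S j) \<partial>?P)"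
    unfolding sq
    by (subst Bochner_Integration.integral_sum; (intro Bochner_Integration.integrable_sum ViS sum.cong refl Bochner_Integration.integral_sum)?) auto
  also have "\<dots> = (\<Sum>i<n. \<Sum>j<n. if i = j then \<integral>s. (V s)\<^sup>2 \<partial>D else 0)"
    by (intro sum.cong refl cross) auto
  also have "\<dots> = real n * (\<integral>s. (V s)\<^sup>2 \<partial>D)" by (simp add: sum.delta)
  finally have E: "(\<integral>S. (\<Sum>i<n. V (S i))\<^sup>2 \<partial>?P) \<le> real n * (\<integral>s. (W s)\<^sup>2 \<partial>D)"
    using V2 n by simp
  let ?A = "{S \<in> space ?P. (\<Sum>i<n. W (S i)) \<le> 0}"
  have A[measurable]: "?A \<in> sets ?P"
    by (intro borel_measurable_le borel_measurable_sum WS) auto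
  have \<mu>n: "0 < (real n * \<mu>)\<^sup>2" using n pos by (simp add: \<mu>_def)
  have "(real n * \<mu>)\<^sup>2 * measure ?P ?A = (\<integral>S. (real n * \<mu>)\<^sup>2 * indicator ?A S \<partial>?P)" by simp
  also have "\<dots> \<le> (\<integral>S. (\<Sum>i<n. V (S i))\<^sup>2 \<partial>?P)"
  proof (rule integral_mono[OF _ isq])
    show "integrable ?P (\<lambda>S. (real n * \<mu>)\<^sup>2 * indicator ?A S)"
      by (intro integrable_mult_right integrable_real_indicator A) (simp add: PP.emeasure_eq_measure)
    show "(real n * \<mu>)\<^sup>2 * indicator ?A S \<le> (\<Sum>i<n. V (S i))\<^sup>2" for S
    proof (cases "S \<in> ?A")
      case True
      have "(\<Sum>i<n. V (S i)) = (\<Sum>i<n. W (S i)) - real n * \<mu>" by (simp add: V_def sum_subtractf)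
      then have "real n * \<mu> \<le> \<bar>\<Sum>i<n. V (S i)\<bar>" using True by auto
      moreover have "0 \<le> real n * \<mu>" using pos by (simp add: \<mu>_def)
      ultimately have "(real n * \<mu>)\<^sup>2 \<le> \<bar>\<Sum>i<n. V (S i)\<bar>\<^sup>2" by (intro power_mono)
      then show ?thesis using True by simp
    qed simp
  qed
  finally have "measure ?P ?A \<le> real n * (\<integral>s. (W s)\<^sup>2 \<partial>D) / (real n * \<mu>)\<^sup>2"
    using E \<mu>n by (simp add: pos_le_divide_eq mult.commute)
  then show ?thesis using n by (simp add: \<mu>_def power2_eq_square mult_ac)
qed

text \<open>\<open>Z\<close> is the overlap of a random input with a fixed query point and \<open>Y\<close> is its label. The
  hypotheses on \<open>Z\<close> and \<open>Y\<close> express that the query point is a Lebesgue point of the data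
  distribution, at which \<open>m\<close> is the conditional mean of the label.\<close>

locale vote_distribution = dual_iteration \<phi> a b + prob_space D
  for \<phi> a b and D :: "'s measure" +
  fixes Z Y :: "'s \<Rightarrow> real" and n :: nat and c m :: real
  assumes Z_meas[measurable]: "Z \<in> borel_measurable D" and Y_meas[measurable]: "Y \<in> borel_measurable D"
    and Z_range: "\<And>s. s \<in> space D \<Longrightarrow> 0 \<le> Z s \<and> Z s \<le> 1"
    and Y_range: "\<And>s. s \<in> space D \<Longrightarrow> \<bar>Y s\<bar> = 1"
    and no_atom: "\<And>z. 0 \<le> z \<Longrightarrow> AE s in D. Z s \<noteq> z"
    and ab: "a * sqrt b ^ n = 1"
    and c: "0 < c" and m: "0 < m"
    and tail: "((\<lambda>t. prob {s \<in> space D. 1 - t < Z s} / sqrt t ^ n) \<longlongrightarrow> c) (at_right 0)"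
    and label_tail: "((\<lambda>t. expectation (\<lambda>s. Y s * indicator {z. 1 - t < z} (Z s)) / sqrt t ^ n) \<longlongrightarrow> m * c) (at_right 0)"
begin

section \<open>Tail and truncated mean of a single weight\<close>

definition G :: "'s \<Rightarrow> real" where "G s = koenigs (Z s)"

definition Q :: "real \<Rightarrow> real" where "Q t = prob {s \<in> space D. 1 - t < Z s}"

definition q :: "real \<Rightarrow> real" where "q r = prob {s \<in> space D. r < G s}"

definition U :: "real \<Rightarrow> real" where "U r = expectation (\<lambda>s. min (G s) r)"

lemma G_meas[measurable]: "G \<in> borel_measurable D"
  unfolding G_def[abs_def] by measurable

lemma G_nonneg: "0 \<le> G s"
  by (simp add: G_def koenigs_nonneg)

lemma Z_lt_1: "AE s in D. Z s < 1"
  using no_atom[OF zero_le_one] AE_space by eventually_elim (use Z_range in fastforce)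

lemma q_nonneg: "0 \<le> q r"
  by (simp add: q_def)

lemma min_G_integrable: "0 \<le> r \<Longrightarrow> integrable D (\<lambda>s. min (G s) r)"
  using G_nonneg by (intro integrable_const_bound[where B=r]) auto

lemma indicator_G_expectation: "expectation (\<lambda>s. indicator {x. r < x} (G s)) = q r"
proof -
  have "expectation (\<lambda>s. indicator {x. r < x} (G s)) = expectation (indicator {s \<in> space D. r < G s})"
    by (intro Bochner_Integration.integral_cong) (auto simp: indicator_def)
  also have "\<dots> = q r" using Int_absorb2[of "{s \<in> space D. r < G s}" "space D"] by (simp add: q_def)
  finally show ?thesis .
qed

text \<open>A generalised inverse, expressed as a distance to 1: by monotonicity a superlevel set of
  \<open>koenigs\<close> is a half-line in {0..<1}, and its end point, which may or may not belong
  to it, is null by \<open>no_atom\<close>.\<close>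

definition threshold :: "real \<Rightarrow> real" where
  "threshold r = 1 - Inf {z. 0 \<le> z \<and> z < 1 \<and> r < koenigs z}"

lemma koenigs_half_pos: "0 < koenigs (1 / 2)"
  using koenigs_incr[of 0 "1 / 2"] koenigs_0 by simp

lemma koenigs_unbounded: "\<exists>z. 0 \<le> z \<and> z < 1 \<and> r < koenigs z"
proof -
  have "1 < 1 / a" using a by simp
  then obtain k where k: "r / koenigs (1 / 2) < (1 / a) ^ k" using real_arch_pow by blast
  \<comment> \<open>The point whose distance to 1, expanded k times by b, equals 1 / 2, so that
    \<open>koenigs_growth\<close> applies with w = 1 / 2.\<close>
  define z where "z = 1 - 1 / (2 * b ^ k)"
  have bk: "1 \<le> b ^ k" using b by simp
  have z: "0 \<le> z" "z < 1" using bk by (auto simp: z_def field_simps)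
  have "koenigs (1 / 2) / a ^ k \<le> koenigs z"
    using z bk by (intro koenigs_growth) (auto simp: z_def)
  moreover have "r < koenigs (1 / 2) / a ^ k"
    using k koenigs_half_pos by (simp add: field_simps)
  ultimately show ?thesis using z by (meson less_le_trans)
qed

lemma threshold:
  assumes "0 \<le> r"
  shows "0 < threshold r" "threshold r \<le> 1"
    and "\<And>z. 0 \<le> z \<Longrightarrow> z < 1 \<Longrightarrow> 1 - threshold r < z \<Longrightarrow> r < koenigs z"
    and "\<And>z. 0 \<le> z \<Longrightarrow> z < 1 \<Longrightarrow> r < koenigs z \<Longrightarrow> 1 - threshold r \<le> z"
proof -
  let ?S = "{z. 0 \<le> z \<and> z < 1 \<and> r < koenigs z}"
  have ne: "?S \<noteq> {}" using koenigs_unbounded by auto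
  have bdd: "bdd_below ?S" by (rule bdd_belowI[of _ 0]) auto
  show 4: "1 - threshold r \<le> z" if "0 \<le> z" "z < 1" "r < koenigs z" for z
    using that by (auto simp: threshold_def intro!: cInf_lower bdd)
  obtain z where z: "z \<in> ?S" using ne by blast
  then show "0 < threshold r" using 4[of z] by auto
  have "0 \<le> Inf ?S" using ne by (intro cInf_greatest) auto
  then show "threshold r \<le> 1" by (simp add: threshold_def)
  show "r < koenigs z" if z: "0 \<le> z" "z < 1" "1 - threshold r < z" for z
  proof -
    have "Inf ?S < z" using z by (simp add: threshold_def)
    then obtain w where "w \<in> ?S" "w < z" using cInf_lessD[OF ne] by blast
    then show ?thesis using koenigs_mono[of w z] z by auto
  qed
qed

lemma threshold_tendsto: "filterlim threshold (at_right 0) at_top"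
  unfolding filterlim_at
proof
  show "\<forall>\<^sub>F r in at_top. threshold r \<in> {0<..} \<and> threshold r \<noteq> 0"
    using eventually_ge_at_top[of 0] by eventually_elim (use threshold(1) in force)
  show "(threshold \<longlongrightarrow> 0) at_top"
  proof (rule order_tendstoI)
    show "\<forall>\<^sub>F r in at_top. x < threshold r" if "x < 0" for x
      using eventually_ge_at_top[of 0] by eventually_elim (use threshold(1) that in force)
    fix x :: real assume x: "0 < x"
    define w where "w = max 0 (1 - x / 2)"
    have w: "0 \<le> w" "w < 1" using x by (auto simp: w_def)
    show "\<forall>\<^sub>F r in at_top. threshold r < x"
      using eventually_ge_at_top[of "max 0 (koenigs w)"]
    proof eventually_elim
      case (elim r)
      have "\<not> 1 - threshold r < w"
        using threshold(3)[of r w] w elim by auto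
      then show ?case using x by (auto simp: w_def)
    qed
  qed
qed

lemma superlevel:
  assumes "0 \<le> r"
  shows "AE s in D. r < G s \<longleftrightarrow> 1 - threshold r < Z s"
proof -
  have "0 \<le> 1 - threshold r" using threshold(2)[OF assms] by simp
  from no_atom[OF this] show ?thesis
    using Z_lt_1 AE_space
  proof eventually_elim
    case (elim s)
    then have z: "0 \<le> Z s" "Z s < 1" using Z_range[of s] by auto
    show ?case using elim(1) threshold(3)[OF assms z] threshold(4)[OF assms z] by (auto simp: G_def)
  qed
qed

lemma q_eq_Q: "0 \<le> r \<Longrightarrow> q r = Q (threshold r)"
  unfolding q_def Q_def by (rule finite_measure_eq_AE) (use superlevel[of r] in \<open>auto elim: eventually_mono\<close>)

lemma Q_tail: "((\<lambda>t. Q t / sqrt t ^ n) \<longlongrightarrow> c) (at_right 0)"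
  using tail by (simp add: Q_def)

lemma Q_mono: "t \<le> t' \<Longrightarrow> Q t \<le> Q t'"
  unfolding Q_def by (intro finite_measure_mono) auto

lemma Q_pos: "\<forall>\<^sub>F t in at_right 0. 0 < Q t"
proof -
  have "\<forall>\<^sub>F t in at_right 0. 0 < Q t / sqrt t ^ n" by (rule order_tendstoD(1)[OF Q_tail c])
  moreover have "\<forall>\<^sub>F t in at_right (0::real). 0 < t" by (simp add: eventually_at_right_less)
  ultimately show ?thesis by eventually_elim (simp add: zero_less_divide_iff)
qed

text \<open>At 0 the function Q is asymptotic to c times \<open>sqrt t ^ n\<close>, so the constant
  cancels in the quotient and the scaling of the power remains.\<close>

lemma Q_scale:
  assumes k: "0 < k"
  shows "((\<lambda>t. Q (k * t) / Q t) \<longlongrightarrow> sqrt k ^ n) (at_right 0)"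
proof -
  have pos: "\<forall>\<^sub>F t in at_right (0::real). 0 < t" by (simp add: eventually_at_right_less)
  have "filterlim (\<lambda>t. k * t) (at_right 0) (at_right 0)"
    unfolding filterlim_at
  proof
    show "\<forall>\<^sub>F t in at_right 0. k * t \<in> {0<..} \<and> k * t \<noteq> 0"
      using pos by eventually_elim (use k in simp)
    have "((\<lambda>t. k * t) \<longlongrightarrow> k * 0) (at_right 0)" by (intro tendsto_intros)
    then show "((\<lambda>t. k * t) \<longlongrightarrow> 0) (at_right 0)" by simp
  qed
  from filterlim_compose[OF Q_tail this]
  have "((\<lambda>t. Q (k * t) / sqrt (k * t) ^ n) \<longlongrightarrow> c) (at_right 0)" .
  then have "((\<lambda>t. sqrt k ^ n * ((Q (k * t) / sqrt (k * t) ^ n) / (Q t / sqrt t ^ n))) \<longlongrightarrow> sqrt k ^ n * (c / c)) (at_right 0)"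
    using c by (intro tendsto_intros Q_tail) auto
  then have "((\<lambda>t. sqrt k ^ n * ((Q (k * t) / sqrt (k * t) ^ n) / (Q t / sqrt t ^ n))) \<longlongrightarrow> sqrt k ^ n) (at_right 0)"
    using c by simp
  then show ?thesis
  proof (rule Lim_transform_eventually)
    show "\<forall>\<^sub>F t in at_right 0. sqrt k ^ n * ((Q (k * t) / sqrt (k * t) ^ n) / (Q t / sqrt t ^ n)) = Q (k * t) / Q t"
      using pos by eventually_elim (use k in \<open>simp add: real_sqrt_mult power_mult_distrib\<close>)
  qed
qed

text \<open>One application of the dual activation multiplies the Koenigs function by \<open>a\<close> and, near \<open>1\<close>,
  the distance to \<open>1\<close> by almost \<open>b\<close>; since \<open>a = b powr (- n / 2)\<close> the tail \<open>q\<close> is almost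
  regularly varying with index \<open>-1\<close> along powers of \<open>a\<close>.\<close>

lemma q_step:
  assumes \<theta>: "0 < \<theta>" "\<theta> < 1"
  shows "\<forall>\<^sub>F r in at_top. \<theta> * q r \<le> a * q (a * r)"
proof -
  \<comment> \<open>The permitted loss \<theta> is converted into a loss 1 - \<delta> in the
    expansion factor b at the point 1.\<close>
  have "((\<lambda>\<delta>. sqrt (1 - \<delta>) ^ n) \<longlongrightarrow> sqrt (1 - 0) ^ n) (at_right 0)" by (intro tendsto_intros)
  then have "\<forall>\<^sub>F \<delta> in at_right 0. \<theta> < sqrt (1 - \<delta>) ^ n"
    using \<theta> by (intro order_tendstoD(1)[of _ "1"]) auto
  moreover have "\<forall>\<^sub>F \<delta> in at_right (0::real). 0 < \<delta> \<and> \<delta> < 1"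
    by (rule eventually_at_rightI[of 0 1]) auto
  ultimately have "\<forall>\<^sub>F \<delta> in at_right 0. \<theta> < sqrt (1 - \<delta>) ^ n \<and> 0 < \<delta> \<and> \<delta> < 1"
    by eventually_elim auto
  then obtain \<delta> where \<delta>: "\<theta> < sqrt (1 - \<delta>) ^ n" "0 < \<delta>" "\<delta> < 1"
    using eventually_happens[of _ "at_right (0::real)"] by auto
  define k where "k = (1 - \<delta>) * b"
  have k: "0 < k" using \<delta> b by (simp add: k_def)
  have "((\<lambda>t. a * (Q (k * t) / Q t)) \<longlongrightarrow> a * sqrt k ^ n) (at_right 0)"
    by (intro tendsto_intros Q_scale k)
  moreover have "a * sqrt k ^ n = sqrt (1 - \<delta>) ^ n"
    using ab by (simp add: k_def real_sqrt_mult power_mult_distrib mult.left_commute[of a])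
  ultimately have "\<forall>\<^sub>F t in at_right 0. \<theta> < a * (Q (k * t) / Q t)"
    using \<delta> by (intro order_tendstoD(1)) auto
  then have "\<forall>\<^sub>F t in at_right 0. \<theta> * Q t \<le> a * Q (k * t) \<and> (1 - \<delta>) * b * t \<le> 1 - f (1 - t)"
    using Q_pos dual_deriv_1[OF \<delta>(2)] by eventually_elim (simp add: field_simps)
  then have "\<forall>\<^sub>F r in at_top. \<theta> * Q (threshold r) \<le> a * Q (k * threshold r) \<and>
      (1 - \<delta>) * b * threshold r \<le> 1 - f (1 - threshold r)"
    by (rule eventually_compose_filterlim[OF _ threshold_tendsto])
  then show ?thesis using eventually_ge_at_top[of 0]
  proof eventually_elim
    case (elim r)
    let ?t = "threshold r"
    have t: "0 < ?t" "?t \<le> 1" using threshold(1,2) elim by auto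
    have ar: "0 \<le> a * r" using a elim by simp
    have "Q (k * ?t) \<le> Q (1 - f (1 - ?t))" using elim by (intro Q_mono) (simp add: k_def)
    also have "\<dots> \<le> q (a * r)"
      unfolding Q_def q_def
    proof (rule finite_measure_mono_AE)
      show "AE s in D. s \<in> {s \<in> space D. 1 - (1 - f (1 - ?t)) < Z s} \<longrightarrow> s \<in> {s \<in> space D. a * r < G s}"
        using Z_lt_1 AE_space
      proof (eventually_elim, intro impI)
        fix s assume s: "Z s < 1" "s \<in> space D" "s \<in> {s \<in> space D. 1 - (1 - f (1 - ?t)) < Z s}"
        \<comment> \<open>Every overlap above \<open>f (1 - ?t)\<close> is the image of some w above
          \<open>1 - ?t\<close>; \<open>koenigs w\<close> exceeds r, and by the functional equation
          the weight \<open>G s\<close> exceeds a r.\<close>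
        have "\<exists>w\<ge>1 - ?t. w \<le> 1 \<and> f w = Z s"
        proof (rule IVT')
          show "continuous_on {1 - ?t..1} f" using t by (intro continuous_on_subset[OF dual_cont]) auto
        qed (use s t dual_1 in auto)
        then obtain w where w: "1 - ?t \<le> w" "w \<le> 1" "f w = Z s" by auto
        have "w \<noteq> 1 - ?t" "w \<noteq> 1" using s w dual_1 by auto
        then have "r < koenigs w" using w t elim by (intro threshold(3)) auto
        then have "a * r < a * koenigs w" using a by simp
        also have "\<dots> = G s" using koenigs_dual[of w] w t \<open>w \<noteq> 1\<close> by (simp add: G_def)
        finally show "s \<in> {s \<in> space D. a * r < G s}" using s by simp
      qed
    qed measurable
    finally have "a * Q (k * ?t) \<le> a * q (a * r)" using a by simp
    then show ?case using elim q_eq_Q[of r] by simp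
  qed
qed

lemma q_steps:
  assumes "0 < \<theta>" "\<theta> < 1"
  shows "\<forall>\<^sub>F r in at_top. \<theta> * q r \<le> a ^ j * q (a ^ j * r)"
  using assms
proof (induction j arbitrary: \<theta>)
  case 0
  then show ?case using mult_right_mono[of \<theta> 1 "q _", OF _ q_nonneg] by simp
next
  case (Suc j)
  \<comment> \<open>The loss is split evenly between the induction hypothesis and one more
    step.\<close>
  define \<kappa> where "\<kappa> = sqrt \<theta>"
  have \<kappa>: "0 < \<kappa>" "\<kappa> < 1" "\<kappa> * \<kappa> = \<theta>" using Suc.prems by (auto simp: \<kappa>_def)
  have "filterlim (\<lambda>r. a ^ j * r) at_top at_top"
    using a by (intro filterlim_tendsto_pos_mult_at_top[OF tendsto_const] filterlim_ident) auto
  then have "\<forall>\<^sub>F r in at_top. \<kappa> * q (a ^ j * r) \<le> a * q (a * (a ^ j * r))"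
    by (rule eventually_compose_filterlim[OF q_step[OF \<kappa>(1,2)]])
  then show ?case using Suc.IH[OF \<kappa>(1,2)]
  proof eventually_elim
    case (elim r)
    have "\<theta> * q r = \<kappa> * (\<kappa> * q r)" using \<kappa> by simp
    also have "\<dots> \<le> \<kappa> * (a ^ j * q (a ^ j * r))" using elim \<kappa> by (intro mult_left_mono) auto
    also have "\<dots> = a ^ j * (\<kappa> * q (a ^ j * r))" by simp
    also have "\<dots> \<le> a ^ j * (a * q (a * (a ^ j * r)))" using elim a by (intro mult_left_mono) auto
    finally show ?case by (simp add: mult_ac)
  qed
qed

text \<open>All scales \<open>r a^j\<close> contribute comparably to the truncated mean, hence the top one is negligible.\<close>

lemma tail_negligible_steps:
  "\<forall>\<^sub>F r in at_top. (1 - a) * real J / 2 * (r * q r) \<le> U r"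
proof -
  have "\<forall>\<^sub>F r in at_top. \<forall>j\<in>{..<J}. 1 / 2 * q r \<le> a ^ j * q (a ^ j * r)"
    by (intro eventually_ball_finite ballI q_steps) auto
  then show ?thesis using eventually_ge_at_top[of 0]
  proof eventually_elim
    case (elim r)
    have ind: "integrable D (\<lambda>s. indicator {x. u < x} (G s) :: real)" for u
      by (rule integrable_const_bound[where B=1]) (auto simp: indicator_def)
    have "(1 - a) * real J / 2 * (r * q r) = (\<Sum>j<J. (1 - a) * r * (1 / 2 * q r))" by simp
    also have "\<dots> \<le> (\<Sum>j<J. (1 - a) * r * (a ^ j * q (a ^ j * r)))"
      using elim a by (intro sum_mono mult_left_mono) auto
    also have "\<dots> = (\<Sum>j<J. (r * a ^ j - r * a ^ Suc j) * expectation (\<lambda>s. indicator {x. r * a ^ j < x} (G s)))"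
      unfolding indicator_G_expectation by (intro sum.cong) (auto simp: algebra_simps)
    also have "\<dots> = expectation (\<lambda>s. \<Sum>j<J. (r * a ^ j - r * a ^ Suc j) * indicator {x. r * a ^ j < x} (G s))"
      using ind by (subst Bochner_Integration.integral_sum) auto
    also have "\<dots> \<le> U r"
      unfolding U_def
    proof (rule integral_mono)
      show "integrable D (\<lambda>s. \<Sum>j<J. (r * a ^ j - r * a ^ Suc j) * indicator {x. r * a ^ j < x} (G s))"
        using ind by (intro Bochner_Integration.integrable_sum integrable_mult_right)
      show "integrable D (\<lambda>s. min (G s) r)" using elim by (intro min_G_integrable) auto
    qed (use staircase_bound[OF G_nonneg] a elim in auto)
    finally show ?case .
  qed
qed

lemma tail_negligible:
  assumes "0 < \<epsilon>"
  shows "\<forall>\<^sub>F r in at_top. r * q r \<le> \<epsilon> * U r"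
proof -
  \<comment> \<open>The number of compared scales depends on \<epsilon> only and stays fixed while r
    grows.\<close>
  obtain J :: nat where J: "2 / ((1 - a) * \<epsilon>) < real J" using reals_Archimedean2 by blast
  have J1: "1 \<le> \<epsilon> * ((1 - a) * real J / 2)" using J a assms by (simp add: field_simps)
  show ?thesis using tail_negligible_steps[of J] eventually_ge_at_top[of 0]
  proof eventually_elim
    case (elim r)
    have "1 * (r * q r) \<le> \<epsilon> * ((1 - a) * real J / 2) * (r * q r)"
      using J1 elim q_nonneg by (intro mult_right_mono) auto
    also have "\<dots> = \<epsilon> * ((1 - a) * real J / 2 * (r * q r))" by simp
    also have "\<dots> \<le> \<epsilon> * U r" using elim assms by (intro mult_left_mono) auto
    finally show ?case by simp
  qed
qed

lemma U_mono: "0 \<le> r \<Longrightarrow> r \<le> r' \<Longrightarrow> U r \<le> U r'"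
  unfolding U_def by (intro integral_mono min_G_integrable) auto

text \<open>Along a geometric sequence of levels \<open>r * q r\<close> stays above a positive
  constant, because \<open>koenigs_growth\<close> and the tail of the overlap match by
  \<open>ab\<close>. As \<open>r * q r\<close> is also eventually at most \<epsilon> times
  \<open>U r\<close>, for each \<epsilon>, U is unbounded.\<close>

lemma U_at_top: "filterlim U at_top at_top"
proof -
  define g0 where "g0 = koenigs (1 / 2)"
  have g0: "0 < g0" using koenigs_half_pos by (simp add: g0_def)
  \<comment> \<open>Half of the value that \<open>koenigs_growth\<close> guarantees within distance
    \<open>tk k\<close> of 1; the factor 1 / 2 makes the inequality strict.\<close>
  define rk where "rk k = g0 / 2 / a ^ k" for k :: nat
  define tk where "tk k = 1 / 2 / b ^ k" for k :: nat
  have rk_top: "filterlim rk at_top sequentially"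
  proof -
    have "filterlim (\<lambda>k. (1 / a) ^ k) at_infinity sequentially"
      using a by (intro filterlim_realpow_sequentially_gt1) simp
    then have "filterlim (\<lambda>k. (1 / a) ^ k) at_top sequentially"
      using a by (intro filterlim_at_infinity_imp_filterlim_at_top) auto
    then have "filterlim (\<lambda>k. g0 / 2 * (1 / a) ^ k) at_top sequentially"
      using g0 by (intro filterlim_tendsto_pos_mult_at_top[OF tendsto_const]) auto
    moreover have "(\<lambda>k. g0 / 2 * (1 / a) ^ k) = rk" by (simp add: rk_def fun_eq_iff power_one_over)
    ultimately show ?thesis by simp
  qed
  have tk: "filterlim tk (at_right 0) sequentially"
    unfolding filterlim_at
  proof
    show "\<forall>\<^sub>F k in sequentially. tk k \<in> {0<..} \<and> tk k \<noteq> 0" using b by (simp add: tk_def)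
    have "(\<lambda>k. 1 / 2 * (1 / b) ^ k) \<longlonglongrightarrow> 1 / 2 * 0"
      using b by (intro tendsto_intros LIMSEQ_power_zero) simp
    then show "tk \<longlonglongrightarrow> 0" by (simp add: tk_def[abs_def] power_one_over)
  qed
  have Qq: "Q (tk k) \<le> q (rk k)" for k
    unfolding Q_def q_def
  proof (rule finite_measure_mono_AE)
    show "AE s in D. s \<in> {s \<in> space D. 1 - tk k < Z s} \<longrightarrow> s \<in> {s \<in> space D. rk k < G s}"
      using Z_lt_1 AE_space
    proof (eventually_elim, intro impI)
      fix s assume s: "Z s < 1" "s \<in> space D" "s \<in> {s \<in> space D. 1 - tk k < Z s}"
      have "b ^ k * (1 - Z s) \<le> b ^ k * tk k" using s b by (intro mult_left_mono) auto
      then have "b ^ k * (1 - Z s) \<le> 1 - 1 / 2" using b by (simp add: tk_def)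
      then have "g0 / a ^ k \<le> koenigs (Z s)"
        unfolding g0_def using s Z_range[OF s(2)] by (intro koenigs_growth) auto
      moreover have "rk k < g0 / a ^ k" using g0 a by (simp add: rk_def field_simps)
      ultimately show "s \<in> {s \<in> space D. rk k < G s}" using s by (simp add: G_def)
    qed
  qed measurable
  define \<kappa> where "\<kappa> = g0 / 2 * (c / 2 * sqrt (1 / 2) ^ n)"
  have \<kappa>: "0 < \<kappa>" using g0 c by (simp add: \<kappa>_def)
  have "\<forall>\<^sub>F t in at_right 0. c / 2 < Q t / sqrt t ^ n" using c by (intro order_tendstoD(1)[OF Q_tail]) auto
  then have "\<forall>\<^sub>F k in sequentially. c / 2 < Q (tk k) / sqrt (tk k) ^ n"
    by (rule eventually_compose_filterlim[OF _ tk])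
  then have low: "\<forall>\<^sub>F k in sequentially. \<kappa> \<le> rk k * q (rk k)"
  proof eventually_elim
    case (elim k)
    have tpos: "0 < sqrt (tk k) ^ n" using b by (simp add: tk_def)
    have "a ^ k * sqrt b ^ (k * n) = 1"
      using arg_cong[OF ab, of "\<lambda>x. x ^ k"] by (simp add: power_mult_distrib power_mult[symmetric] mult.commute)
    then have "a ^ k * sqrt (b ^ k) ^ n = 1" by (simp add: real_sqrt_power power_mult)
    then have ak: "1 / sqrt (b ^ k) ^ n = a ^ k" using b by (simp add: field_simps)
    have "sqrt (tk k) ^ n = sqrt (1 / 2) ^ n * (1 / sqrt (b ^ k) ^ n)"
      by (simp add: tk_def real_sqrt_divide real_sqrt_mult power_mult_distrib power_divide)
    then have st: "sqrt (tk k) ^ n = sqrt (1 / 2) ^ n * a ^ k" unfolding ak .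
    have "c / 2 * sqrt (tk k) ^ n \<le> q (rk k)" using elim Qq[of k] tpos by (simp add: field_simps)
    then have "rk k * (c / 2 * (sqrt (1 / 2) ^ n * a ^ k)) \<le> rk k * q (rk k)"
      unfolding st using g0 a by (intro mult_left_mono) (auto simp: rk_def)
    moreover have "rk k * (c / 2 * (sqrt (1 / 2) ^ n * a ^ k)) = \<kappa>"
      using a by (simp add: rk_def \<kappa>_def)
    ultimately show ?case by simp
  qed
  show ?thesis
    unfolding filterlim_at_top
  proof
    fix B :: real
    obtain \<epsilon> where \<epsilon>: "0 < \<epsilon>" "\<epsilon> * (\<bar>B\<bar> + 1) \<le> \<kappa>"
      using \<kappa> by (intro that[of "\<kappa> / (\<bar>B\<bar> + 1)"]) auto
    have "\<forall>\<^sub>F k in sequentially. rk k * q (rk k) \<le> \<epsilon> * U (rk k)"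
      by (rule eventually_compose_filterlim[OF tail_negligible[OF \<epsilon>(1)] rk_top])
    moreover have "\<forall>\<^sub>F k in sequentially. 0 \<le> rk k" using g0 a by (simp add: rk_def)
    ultimately have "\<forall>\<^sub>F k in sequentially. B \<le> U (rk k) \<and> 0 \<le> rk k"
      using low
    proof eventually_elim
      case (elim k)
      have "\<epsilon> * (\<bar>B\<bar> + 1) \<le> \<epsilon> * U (rk k)" using elim \<epsilon> by linarith
      then have "\<bar>B\<bar> + 1 \<le> U (rk k)" using \<epsilon>(1) by simp
      then show ?case using elim by linarith
    qed
    then obtain k where k: "B \<le> U (rk k)" "0 \<le> rk k"
      using eventually_happens[of _ sequentially] by auto
    show "\<forall>\<^sub>F r in at_top. B \<le> U r"
      using eventually_ge_at_top[of "rk k"]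
      by eventually_elim (use k U_mono in \<open>meson order_trans\<close>)
  qed
qed

section \<open>Truncated moments of the labelled votes\<close>

definition V :: "real \<Rightarrow> real" where "V r = expectation (\<lambda>s. Y s * min (G s) r)"

lemma Y_min_integrable:
  assumes "0 \<le> r"
  shows "integrable D (\<lambda>s. Y s * min (G s) r)"
proof (rule integrable_const_bound[where B=r])
  show "AE s in D. norm (Y s * min (G s) r) \<le> r"
    by (intro AE_I2) (use Y_range G_nonneg assms in \<open>simp add: abs_mult\<close>)
qed measurable

text \<open>Beyond some level r1 the label mean on superlevel sets is at least m / 2, and the layer
  cake carries this over to the truncated means above r1. The part below r1 is a constant, absorbed
  by the divergence of U at the price of m / 4.\<close>

lemma V_lower: "\<forall>\<^sub>F r in at_top. m / 4 * U r \<le> V r"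
proof -
  have "((\<lambda>t. (expectation (\<lambda>s. Y s * indicator {z. 1 - t < z} (Z s)) / sqrt t ^ n) / (Q t / sqrt t ^ n)) \<longlongrightarrow> m * c / c) (at_right 0)"
    using c by (intro tendsto_divide label_tail Q_tail) auto
  then have "\<forall>\<^sub>F t in at_right 0. m / 2 < (expectation (\<lambda>s. Y s * indicator {z. 1 - t < z} (Z s)) / sqrt t ^ n) / (Q t / sqrt t ^ n)"
    using m c by (intro order_tendstoD(1)) auto
  moreover have "\<forall>\<^sub>F t in at_right (0::real). 0 < t" by (simp add: eventually_at_right_less)
  ultimately have "\<forall>\<^sub>F t in at_right 0. m / 2 * Q t \<le> expectation (\<lambda>s. Y s * indicator {z. 1 - t < z} (Z s))"
    using Q_pos by eventually_elim (simp add: field_simps)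
  then have "\<forall>\<^sub>F r in at_top. m / 2 * Q (threshold r) \<le> expectation (\<lambda>s. Y s * indicator {z. 1 - threshold r < z} (Z s))"
    by (rule eventually_compose_filterlim[OF _ threshold_tendsto])
  then have "\<forall>\<^sub>F r in at_top. 0 \<le> expectation (\<lambda>s. (Y s - m / 2) * indicator {x. r < x} (G s))"
    using eventually_ge_at_top[of 0]
  proof eventually_elim
    case (elim r)
    have i1: "integrable D (\<lambda>s. Y s * indicator {x. r < x} (G s))"
      by (rule integrable_const_bound[where B=1]) (use Y_range in \<open>auto simp: indicator_def\<close>)
    have i2: "integrable D (\<lambda>s. m / 2 * indicator {x. r < x} (G s))"
      by (rule integrable_const_bound[where B="m / 2"]) (use m in \<open>auto simp: indicator_def\<close>)
    have "expectation (\<lambda>s. Y s * indicator {x. r < x} (G s)) = expectation (\<lambda>s. Y s * indicator {z. 1 - threshold r < z} (Z s))"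
      by (intro integral_cong_AE) (use superlevel[OF elim(2)] in \<open>auto elim!: eventually_mono simp: indicator_def\<close>)
    moreover have "expectation (\<lambda>s. m / 2 * indicator {x. r < x} (G s)) = m / 2 * Q (threshold r)"
      using indicator_G_expectation[of r] q_eq_Q[OF elim(2)] by simp
    moreover have "expectation (\<lambda>s. (Y s - m / 2) * indicator {x. r < x} (G s))
        = expectation (\<lambda>s. Y s * indicator {x. r < x} (G s)) - expectation (\<lambda>s. m / 2 * indicator {x. r < x} (G s))"
      unfolding left_diff_distrib by (rule Bochner_Integration.integral_diff[OF i1 i2])
    ultimately show ?case using elim by linarith
  qed
  then obtain r0 where r0: "\<And>r. r0 \<le> r \<Longrightarrow> 0 \<le> expectation (\<lambda>s. (Y s - m / 2) * indicator {x. r < x} (G s))"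
    unfolding eventually_at_top_linorder by blast
  define r1 where "r1 = max r0 0"
  have "\<forall>\<^sub>F r in at_top. 4 / m * (m / 2 * U r1 - V r1) \<le> U r"
    using U_at_top by (simp add: filterlim_at_top)
  then show ?thesis using eventually_ge_at_top[of r1]
  proof eventually_elim
    case (elim r)
    have r1: "0 \<le> r1" "0 \<le> r" using elim by (auto simp: r1_def)
    have "0 \<le> expectation (\<lambda>s. (Y s - m / 2) * (min (G s) r - min (G s) r1))"
    proof (rule layer_cake_nonneg[where B="1 + m / 2"])
      show "\<bar>Y s - m / 2\<bar> \<le> 1 + m / 2" if "s \<in> space D" for s using Y_range[OF that] m by linarith
    qed (use elim r0 in \<open>auto simp: r1_def\<close>)
    also have "expectation (\<lambda>s. (Y s - m / 2) * (min (G s) r - min (G s) r1))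
      = expectation (\<lambda>s. (Y s * min (G s) r - Y s * min (G s) r1) - (m / 2 * min (G s) r - m / 2 * min (G s) r1))"
      by (intro Bochner_Integration.integral_cong) (auto simp: algebra_simps)
    also have "\<dots> = (V r - V r1) - (m / 2 * U r - m / 2 * U r1)"
      unfolding V_def U_def using Y_min_integrable[OF r1(1)] Y_min_integrable[OF r1(2)]
        min_G_integrable[OF r1(1)] min_G_integrable[OF r1(2)] by simp
    finally have "m / 2 * U r - (m / 2 * U r1 - V r1) \<le> V r" by simp
    moreover have "m / 2 * U r1 - V r1 \<le> m / 4 * U r" using elim(1) m by (simp add: field_simps)
    ultimately show ?case by simp
  qed
qed

text \<open>Split at the level \<delta> r: below it one factor is at most \<delta> r, above it both
  are at most r. The first term is made small through \<delta>, the second because the tail is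
  negligible.\<close>

lemma second_moment:
  assumes "0 \<le> r" "0 < \<delta>"
  shows "expectation (\<lambda>s. (min (G s) r)\<^sup>2) \<le> \<delta> * r * U r + r\<^sup>2 * q (\<delta> * r)"
proof -
  have ind: "integrable D (\<lambda>s. indicator {x. u < x} (G s) :: real)" for u
    by (rule integrable_const_bound[where B=1]) (auto simp: indicator_def)
  have "expectation (\<lambda>s. (min (G s) r)\<^sup>2) \<le> expectation (\<lambda>s. \<delta> * r * min (G s) r + r\<^sup>2 * indicator {x. \<delta> * r < x} (G s))"
  proof (rule integral_mono)
    show "integrable D (\<lambda>s. (min (G s) r)\<^sup>2)"
    proof (rule integrable_const_bound[where B="r\<^sup>2"])
      show "AE s in D. norm ((min (G s) r)\<^sup>2) \<le> r\<^sup>2"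
        using G_nonneg assms by (intro AE_I2) (auto intro!: power_mono)
    qed measurable
    show "integrable D (\<lambda>s. \<delta> * r * min (G s) r + r\<^sup>2 * indicator {x. \<delta> * r < x} (G s))"
      using ind min_G_integrable[OF assms(1)] by (intro Bochner_Integration.integrable_add integrable_mult_right)
    fix s
    let ?w = "min (G s) r"
    have w: "0 \<le> ?w" using G_nonneg assms by simp
    show "?w\<^sup>2 \<le> \<delta> * r * ?w + r\<^sup>2 * indicator {x. \<delta> * r < x} (G s)"
    proof (cases "\<delta> * r < G s")
      case True
      have "?w\<^sup>2 \<le> r\<^sup>2" using w by (intro power_mono) auto
      moreover have "0 \<le> \<delta> * r * ?w" using w assms by (intro mult_nonneg_nonneg) auto
      ultimately show ?thesis using True by simp
    next
      case False
      then have "?w * ?w \<le> \<delta> * r * ?w" using w by (intro mult_right_mono) auto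
      then show ?thesis using False by (simp add: power2_eq_square)
    qed
  qed
  also have "\<dots> = \<delta> * r * U r + r\<^sup>2 * q (\<delta> * r)"
    using ind min_G_integrable[OF assms(1)] by (simp add: U_def indicator_G_expectation)
  finally show ?thesis .
qed

lemma q_tendsto_0: "(q \<longlongrightarrow> 0) at_top"
proof -
  have Q0: "((\<lambda>r. Q (threshold r)) \<longlongrightarrow> 0) at_top" if "0 < n"
  proof -
    have "((\<lambda>t. Q t / sqrt t ^ n * sqrt t ^ n) \<longlongrightarrow> c * sqrt 0 ^ n) (at_right 0)"
      by (intro tendsto_intros Q_tail)
    moreover have "c * sqrt 0 ^ n = 0" using that by simp
    ultimately have "((\<lambda>t. Q t / sqrt t ^ n * sqrt t ^ n) \<longlongrightarrow> 0) (at_right 0)" by (simp only:)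
    then have "(Q \<longlongrightarrow> 0) (at_right 0)"
    proof (rule Lim_transform_eventually)
      have "\<forall>\<^sub>F t in at_right (0::real). 0 < t" by (simp add: eventually_at_right_less)
      then show "\<forall>\<^sub>F t in at_right 0. Q t / sqrt t ^ n * sqrt t ^ n = Q t"
        by eventually_elim simp
    qed
    then show ?thesis by (rule filterlim_compose[OF _ threshold_tendsto])
  qed
  \<comment> \<open>For n = 0 the relation \<open>ab\<close> would read a = 1.\<close>
  have "0 < n" using ab a by (cases n) auto
  from Q0[OF this] show ?thesis
    by (rule Lim_transform_eventually) (use eventually_ge_at_top[of 0] in \<open>eventually_elim, simp add: q_eq_Q\<close>)
qed

text \<open>Values up to a fixed K contribute at most K, larger ones at most r times a small
  probability. Together with the divergence of U this makes N U(s) = s solvable for large N.\<close>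

lemma U_sublinear:
  assumes "0 < \<epsilon>"
  shows "\<forall>\<^sub>F r in at_top. U r < \<epsilon> * r"
proof -
  have "\<forall>\<^sub>F K in at_top. q K < \<epsilon> / 2" using q_tendsto_0 assms by (intro order_tendstoD) auto
  then have "\<forall>\<^sub>F K in at_top. q K < \<epsilon> / 2 \<and> 0 \<le> K" using eventually_ge_at_top[of 0] by eventually_elim auto
  then obtain K where K: "q K < \<epsilon> / 2" "0 \<le> K"
    using eventually_happens[of _ "at_top :: real filter"] by auto
  show ?thesis using eventually_gt_at_top[of "2 * K / \<epsilon>"] eventually_gt_at_top[of 0]
  proof eventually_elim
    case (elim r)
    have ind: "integrable D (\<lambda>s. indicator {x. K < x} (G s) :: real)"
      by (rule integrable_const_bound[where B=1]) (auto simp: indicator_def)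
    have "U r \<le> expectation (\<lambda>s. K + r * indicator {x. K < x} (G s))"
      unfolding U_def
    proof (rule integral_mono)
      show "integrable D (\<lambda>s. min (G s) r)" using elim by (intro min_G_integrable) auto
      show "integrable D (\<lambda>s. K + r * indicator {x. K < x} (G s))" using ind by simp
      show "min (G s) r \<le> K + r * indicator {x. K < x} (G s)" for s
        using K by (auto simp: indicator_def)
    qed
    also have "\<dots> = K + r * q K" using ind prob_space by (simp add: indicator_G_expectation)
    also have "\<dots> < \<epsilon> / 2 * r + r * (\<epsilon> / 2)"
    proof (rule add_less_le_mono)
      show "K < \<epsilon> / 2 * r" using elim(1) assms by (simp add: field_simps)
      show "r * q K \<le> r * (\<epsilon> / 2)" using K elim by (intro mult_left_mono) auto
    qed
    finally show ?case by (simp add: algebra_simps)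
  qed
qed

lemma U_continuous: "continuous_on {0..} U"
proof (rule continuous_onI)
  fix x e :: real assume x: "x \<in> {0..}" and e: "0 < e"
  have lip: "\<bar>U r' - U r\<bar> \<le> \<bar>r' - r\<bar>" if "0 \<le> r" "0 \<le> r'" for r r'
  proof -
    have "U r' - U r = expectation (\<lambda>s. min (G s) r' - min (G s) r)"
      unfolding U_def using min_G_integrable that by simp
    also have "\<bar>\<dots>\<bar> \<le> expectation (\<lambda>s. \<bar>min (G s) r' - min (G s) r\<bar>)" by (rule integral_abs_bound)
    also have "\<dots> \<le> expectation (\<lambda>s. \<bar>r' - r\<bar>)"
      using min_G_integrable[OF that(1)] min_G_integrable[OF that(2)] by (intro integral_mono) auto
    finally show ?thesis using prob_space by simp
  qed
  show "\<exists>d>0. \<forall>x'\<in>{0..}. dist x' x < d \<longrightarrow> dist (U x') (U x) \<le> e"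
  proof (intro exI[of _ e] conjI ballI impI e)
    fix x' :: real assume "x' \<in> {0..}" "dist x' x < e"
    then show "dist (U x') (U x) \<le> e" using lip[of x x'] x by (simp add: dist_real_def)
  qed
qed

text \<open>The truncation level for sample size \<open>N\<close> balances the union bound and the variance.\<close>

lemma truncation_level:
  "\<exists>s0\<ge>1. \<forall>N::nat. s0 \<le> real N \<longrightarrow> (\<exists>s\<ge>real N. real N * U s = s)"
proof -
  have "\<forall>\<^sub>F r in at_top. 1 \<le> U r" using U_at_top by (simp add: filterlim_at_top)
  then have "\<forall>\<^sub>F r in at_top. 1 \<le> U r \<and> 1 \<le> r" using eventually_ge_at_top[of 1] by eventually_elim auto
  then obtain s0 where s0: "1 \<le> U s0" "1 \<le> s0"
    using eventually_happens[of _ "at_top :: real filter"] by auto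
  show ?thesis
  proof (rule exI[of _ s0], intro conjI allI impI s0(2))
    fix N :: nat assume N: "s0 \<le> real N"
    then have Np: "0 < real N" using s0 by simp
    have "0 < 1 / real N" using Np by simp
    from U_sublinear[OF this] have "\<forall>\<^sub>F r in at_top. U r < 1 / real N * r \<and> s0 \<le> r"
      using eventually_ge_at_top[of s0] by eventually_elim auto
    then obtain R where R: "U R < 1 / real N * R" "s0 \<le> R"
      using eventually_happens[of _ "at_top :: real filter"] by auto
    \<comment> \<open>A change of sign: N U is at least the level at s0, because \<open>U s0\<close>
      is at least 1 and N at least s0, and lies below the level at R by sublinearity.\<close>
    have "\<exists>s\<ge>s0. s \<le> R \<and> s - real N * U s = 0"
    proof (rule IVT')
      have "real N * 1 \<le> real N * U s0" using s0 by (intro mult_left_mono) auto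
      then show "s0 - real N * U s0 \<le> 0" using N by simp
      show "0 \<le> R - real N * U R" using R Np by (simp add: field_simps)
      show "continuous_on {s0..R} (\<lambda>s. s - real N * U s)"
        using s0 by (intro continuous_intros continuous_on_subset[OF U_continuous]) auto
    qed (use R in simp)
    then obtain s where s: "s0 \<le> s" "real N * U s = s" by auto
    have "real N * 1 \<le> real N * U s"
      using s0 s U_mono[of s0 s] by (intro mult_left_mono) auto
    then show "\<exists>s\<ge>real N. real N * U s = s" using s by (intro exI[of _ s]) auto
  qed
qed

text \<open>The first term is the union bound for some weight exceeding s, rewritten by N U(s) = s.
  Otherwise truncation changes nothing, and Chebyshev applies to truncated votes of mean at least m
  / 4 times U(s); the inverse square of m / 4 gives the constant of the second term.\<close>

lemma vote_bound:
  fixes N :: nat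
  assumes s: "0 < s" "real N * U s = s" and VU: "m / 4 * U s \<le> V s" and \<delta>: "0 < \<delta>"
  shows "measure (Pi\<^sub>M {..<N} (\<lambda>_. D)) {S \<in> space (Pi\<^sub>M {..<N} (\<lambda>_. D)). (\<Sum>i<N. Y (S i) * G (S i)) \<le> 0}
     \<le> s * q s / U s + 16 / m\<^sup>2 * (\<delta> + s * q (\<delta> * s) / U s)"
proof -
  let ?P = "Pi\<^sub>M {..<N} (\<lambda>_. D)"
  interpret PP: prob_space ?P by (intro prob_space_PiM prob_space_axioms)
  have N0: "0 < N" using s by (cases N) auto
  have U0: "0 < U s" using s N0 by (metis of_nat_0_less_iff zero_less_mult_pos)
  define W where "W x = Y x * min (G x) s" for x
  have Wm[measurable]: "W \<in> borel_measurable D" unfolding W_def[abs_def] by measurable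
  have W1: "m / 4 * U s \<le> expectation W" using VU by (simp add: V_def W_def[abs_def])
  have mU: "0 < m / 4 * U s" using m U0 by simp
  have W2: "expectation (\<lambda>x. (W x)\<^sup>2) = expectation (\<lambda>x. (min (G x) s)\<^sup>2)"
  proof (rule Bochner_Integration.integral_cong[OF refl])
    fix x assume "x \<in> space D"
    then have "(Y x)\<^sup>2 = 1" using Y_range by (metis power2_abs one_power2)
    then show "(W x)\<^sup>2 = (min (G x) s)\<^sup>2" by (simp add: W_def power_mult_distrib)
  qed
  have comp[measurable]: "(\<lambda>S. S i) \<in> ?P \<rightarrow>\<^sub>M D" if "i < N" for i
    using that by (intro measurable_component_singleton) auto
  let ?B = "\<lambda>i. {S \<in> space ?P. s < G (S i)}"
  let ?C = "{S \<in> space ?P. (\<Sum>i<N. W (S i)) \<le> 0}"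
  have Bs: "?B i \<in> sets ?P" if "i < N" for i
    using measurable_compose[OF comp[OF that] G_meas] by measurable
  have Cs: "?C \<in> sets ?P"
    by (intro borel_measurable_le borel_measurable_sum measurable_compose[OF comp Wm]) auto
  have Bq: "PP.prob (?B i) = q s" if "i < N" for i
  proof -
    have "q s = measure (distr ?P D (\<lambda>S. S i)) {x \<in> space D. s < G x}"
      unfolding q_def by (subst distr_PiM_component) (use that prob_space_axioms in auto)
    also have "\<dots> = PP.prob ((\<lambda>S. S i) -` {x \<in> space D. s < G x} \<inter> space ?P)"
      by (rule measure_distr[OF comp[OF that]]) measurable
    also have "(\<lambda>S. S i) -` {x \<in> space D. s < G x} \<inter> space ?P = ?B i"
      using measurable_space[OF comp[OF that]] by blast
    finally show ?thesis by simp
  qed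
  have "{S \<in> space ?P. (\<Sum>i<N. Y (S i) * G (S i)) \<le> 0} \<subseteq> (\<Union>i<N. ?B i) \<union> ?C"
  proof
    fix S assume S: "S \<in> {S \<in> space ?P. (\<Sum>i<N. Y (S i) * G (S i)) \<le> 0}"
    show "S \<in> (\<Union>i<N. ?B i) \<union> ?C"
    proof (cases "\<exists>i<N. s < G (S i)")
      case False
      then have "(\<Sum>i<N. W (S i)) = (\<Sum>i<N. Y (S i) * G (S i))"
        by (intro sum.cong) (auto simp: W_def)
      then show ?thesis using S by simp
    qed (use S in auto)
  qed
  then have "PP.prob {S \<in> space ?P. (\<Sum>i<N. Y (S i) * G (S i)) \<le> 0} \<le> PP.prob ((\<Union>i<N. ?B i) \<union> ?C)"
    using Bs Cs by (intro PP.finite_measure_mono) auto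
  also have "\<dots> \<le> PP.prob (\<Union>i<N. ?B i) + PP.prob ?C"
    using Bs Cs by (intro measure_Un_le) auto
  also have "PP.prob (\<Union>i<N. ?B i) \<le> (\<Sum>i<N. PP.prob (?B i))"
    using Bs by (intro measure_UNION_le) auto
  also have "(\<Sum>i<N. PP.prob (?B i)) = real N * q s" using Bq by simp
  also have "real N * q s = s * q s / U s" using s(2) U0 by (simp add: field_simps)
  also have "PP.prob ?C \<le> expectation (\<lambda>x. (W x)\<^sup>2) / (real N * (expectation W)\<^sup>2)"
  proof (rule iid_sum_nonpos_prob[OF prob_space_axioms Wm _ N0, where B=s])
    show "\<bar>W x\<bar> \<le> s" if "x \<in> space D" for x
      using Y_range[OF that] G_nonneg[of x] s by (simp add: W_def abs_mult)
    show "0 < expectation W" using W1 mU by simp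
  qed
  also have "\<dots> \<le> (\<delta> * s * U s + s\<^sup>2 * q (\<delta> * s)) / (real N * (m / 4 * U s)\<^sup>2)"
  proof (rule frac_le)
    show "expectation (\<lambda>x. (W x)\<^sup>2) \<le> \<delta> * s * U s + s\<^sup>2 * q (\<delta> * s)"
      unfolding W2 using s \<delta> by (intro second_moment) auto
    show "0 \<le> \<delta> * s * U s + s\<^sup>2 * q (\<delta> * s)" using s \<delta> U0 q_nonneg by simp
    show "0 < real N * (m / 4 * U s)\<^sup>2" using N0 m U0 by (intro mult_pos_pos zero_less_power) auto
    show "real N * (m / 4 * U s)\<^sup>2 \<le> real N * (expectation W)\<^sup>2"
      using W1 mU by (intro mult_left_mono power_mono) auto
  qed
  also have "\<dots> = 16 / m\<^sup>2 * (\<delta> + s * q (\<delta> * s) / U s)"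
  proof -
    have "real N * (m / 4 * U s)\<^sup>2 = m\<^sup>2 / 16 * U s * (real N * U s)"
      by (simp add: power2_eq_square)
    then have "real N * (m / 4 * U s)\<^sup>2 = m\<^sup>2 / 16 * U s * s"
      by (simp only: s(2))
    moreover have "(\<delta> * s * u + s\<^sup>2 * k) / (m\<^sup>2 / 16 * u * s) = 16 / m\<^sup>2 * (\<delta> + s * k / u)" if "0 < u" for u k :: real
      using s(1) m that by (simp add: field_simps power2_eq_square)
    ultimately show ?thesis using U0 by (simp only:)
  qed
  finally show ?thesis by simp
qed

theorem vote_positive:
  "(\<lambda>N. measure (Pi\<^sub>M {..<N} (\<lambda>_. D)) {S \<in> space (Pi\<^sub>M {..<N} (\<lambda>_. D)). (\<Sum>i<N. Y (S i) * G (S i)) \<le> 0}) \<longlonglongrightarrow> 0"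
proof (rule LIMSEQ_I)
  fix e :: real assume e: "0 < e"
  define C where "C = 16 / m\<^sup>2"
  have C: "0 < C" using m by (simp add: C_def)
  \<comment> \<open>The three error terms of \<open>vote_bound\<close> are each to be at most e / 4.
    The constant \<epsilon> is scaled by \<delta> because the tail at \<delta> s is estimated
    through U at \<delta> s, at the cost of a factor 1 / \<delta>.\<close>
  define \<delta> where "\<delta> = min 1 (e / (4 * C))"
  have \<delta>: "0 < \<delta>" "\<delta> \<le> 1" "C * \<delta> \<le> e / 4" using e C by (auto simp: \<delta>_def min_def field_simps)
  define \<epsilon> where "\<epsilon> = min (e / 4) (\<delta> * e / (4 * C))"
  have \<epsilon>: "0 < \<epsilon>" "\<epsilon> \<le> e / 4" "C * (\<epsilon> / \<delta>) \<le> e / 4"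
    using e C \<delta> by (auto simp: \<epsilon>_def min_def field_simps)
  have "filterlim (\<lambda>s. \<delta> * s) at_top at_top"
    using \<delta> by (intro filterlim_tendsto_pos_mult_at_top[OF tendsto_const] filterlim_ident) auto
  then have "\<forall>\<^sub>F s in at_top. \<delta> * s * q (\<delta> * s) \<le> \<epsilon> * U (\<delta> * s)"
    by (rule eventually_compose_filterlim[OF tail_negligible[OF \<epsilon>(1)]])
  then have "\<forall>\<^sub>F s in at_top. s * q s \<le> \<epsilon> * U s \<and> \<delta> * s * q (\<delta> * s) \<le> \<epsilon> * U (\<delta> * s) \<and> m / 4 * U s \<le> V s \<and> 0 < s"
    using tail_negligible[OF \<epsilon>(1)] V_lower eventually_gt_at_top[of 0] by eventually_elim auto
  then obtain s1 where s1: "\<And>s. s1 \<le> s \<Longrightarrow> s * q s \<le> \<epsilon> * U s \<and> \<delta> * s * q (\<delta> * s) \<le> \<epsilon> * U (\<delta> * s) \<and> m / 4 * U s \<le> V s \<and> 0 < s"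
    unfolding eventually_at_top_linorder by blast
  obtain s0 where s0: "\<And>N::nat. s0 \<le> real N \<Longrightarrow> (\<exists>s\<ge>real N. real N * U s = s)"
    using truncation_level by blast
  obtain N0 :: nat where N0: "max s0 s1 \<le> real N0" using real_arch_simple by blast
  show "\<exists>no::nat. \<forall>N\<ge>no. norm (measure (Pi\<^sub>M {..<N} (\<lambda>_. D)) {S \<in> space (Pi\<^sub>M {..<N} (\<lambda>_. D)). (\<Sum>i<N. Y (S i) * G (S i)) \<le> 0} - 0) < e"
  proof (intro exI[of _ N0] allI impI)
    fix N assume N: "N0 \<le> N"
    then have "max s0 s1 \<le> real N" using N0 by simp
    then obtain s where s: "real N \<le> s" "real N * U s = s" "s1 \<le> s" using s0[of N] by auto
    note b = s1[OF s(3)]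
    have U0: "0 < U s" using b s(2) by (metis of_nat_0_le_iff order_le_less zero_less_mult_pos mult_zero_left)
    have "s * q s / U s \<le> \<epsilon>" using b U0 by (simp add: field_simps)
    moreover have "s * q (\<delta> * s) / U s \<le> \<epsilon> / \<delta>"
    proof -
      have "U (\<delta> * s) \<le> U s" using b \<delta> by (intro U_mono) (auto simp: mult_left_le_one_le)
      then have "\<epsilon> * U (\<delta> * s) \<le> \<epsilon> * U s" using \<epsilon> by (intro mult_left_mono) auto
      then have "\<delta> * s * q (\<delta> * s) \<le> \<epsilon> * U s" using b by linarith
      then show ?thesis using U0 \<delta> by (simp add: field_simps)
    qed
    then have "C * (\<delta> + s * q (\<delta> * s) / U s) \<le> C * (\<delta> + \<epsilon> / \<delta>)" using C by (intro mult_left_mono add_left_mono) auto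
    moreover have "C * (\<delta> + \<epsilon> / \<delta>) \<le> e / 4 + e / 4"
      unfolding distrib_left by (rule add_mono[OF \<delta>(3) \<epsilon>(3)])
    ultimately have "s * q s / U s + C * (\<delta> + s * q (\<delta> * s) / U s) < e"
      using \<epsilon>(2) e by linarith
    then show "norm (measure (Pi\<^sub>M {..<N} (\<lambda>_. D)) {S \<in> space (Pi\<^sub>M {..<N} (\<lambda>_. D)). (\<Sum>i<N. Y (S i) * G (S i)) \<le> 0} - 0) < e"
      using vote_bound[of s N \<delta>] b s(2) \<delta>(1) by (simp add: C_def)
  qed
qed

end

section \<open>Lebesgue points on the sphere\<close>

text \<open>The differentiation theorem is applied to |F - q| for every rational q, with a common
  null set; choosing q within \<epsilon> / 4 of F y gives the L1 form. The cubes have y as a corner,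
  which suits the one-sided shells used for caps.\<close>

lemma Lebesgue_points_corner:
  fixes F :: "'a::euclidean_space \<Rightarrow> real"
  assumes F: "integrable lborel F"
  shows "AE y in lborel. \<forall>\<epsilon>>0. \<exists>\<delta>>0. \<forall>h. 0 < h \<and> h < \<delta> \<longrightarrow>
      (\<integral>\<^sup>+w. ennreal \<bar>F w - F y\<bar> * indicator (cbox y (y + h *\<^sub>R One)) w \<partial>lborel) \<le> ennreal (\<epsilon> * h ^ DIM('a))"
proof -
  have Fb: "set_integrable lborel (cbox u v) (\<lambda>w. \<bar>F w - q\<bar>)" for q :: real and u v
  proof -
    have "set_integrable lborel (cbox u v) F"
      using F unfolding set_integrable_def by (intro integrable_mult_indicator) auto
    moreover have "set_integrable lborel (cbox u v) (\<lambda>_. q)"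
      unfolding set_integrable_def by (intro integrable_scaleR_left integrable_real_indicator) (simp_all add: emeasure_lborel_cbox_eq)
    ultimately show ?thesis by (intro set_integrable_abs set_integral_diff(1))
  qed
  have "\<exists>N. negligible N \<and> (\<forall>x e. x \<notin> N \<and> 0 < e \<longrightarrow> (\<exists>d>0. \<forall>h. 0 < h \<and> h < d \<longrightarrow>
        norm (integral (cbox x (x + h *\<^sub>R One)) (\<lambda>w. \<bar>F w - q\<bar>) /\<^sub>R h ^ DIM('a) - \<bar>F x - q\<bar>) < e))" (is "\<exists>N. ?P q N") for q
  proof -
    have "(\<lambda>w. \<bar>F w - q\<bar>) integrable_on cbox u v" for u v
      by (rule set_borel_integral_eq_integral(1)[OF Fb])
    from integrable_ccontinuous_explicit[of "\<lambda>w. \<bar>F w - q\<bar>", OF this]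
    obtain N where "negligible N" "\<And>x e. x \<notin> N \<Longrightarrow> 0 < e \<Longrightarrow> (\<exists>d>0. \<forall>h. 0 < h \<and> h < d \<longrightarrow>
        norm (integral (cbox x (x + h *\<^sub>R One)) (\<lambda>w. \<bar>F w - q\<bar>) /\<^sub>R h ^ DIM('a) - \<bar>F x - q\<bar>) < e)"
      by metis
    then show "\<exists>N. ?P q N" by (intro exI[of _ N]) simp
  qed
  then obtain N where N: "\<And>q. negligible (N q)"
    and lim: "\<And>q x e. x \<notin> N q \<Longrightarrow> 0 < e \<Longrightarrow> (\<exists>d>0. \<forall>h. 0 < h \<and> h < d \<longrightarrow>
        norm (integral (cbox x (x + h *\<^sub>R One)) (\<lambda>w. \<bar>F w - q\<bar>) /\<^sub>R h ^ DIM('a) - \<bar>F x - q\<bar>) < e)"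
    by metis
  have "negligible (\<Union>q\<in>\<rat>. N q)"
    by (intro negligible_countable_Union[of "N ` \<rat>", simplified]) (auto simp: N countable_rat)
  then have "AE y in lebesgue. y \<notin> (\<Union>q\<in>\<rat>. N q)"
    by (intro AE_not_in) (simp only: negligible_iff_null_sets)
  then have "AE y in lborel. y \<notin> (\<Union>q\<in>\<rat>. N q)" by (simp add: AE_completion_iff)
  then show ?thesis
  proof eventually_elim
    case (elim y)
    show ?case
    proof (intro allI impI)
      fix \<epsilon> :: real assume e: "0 < \<epsilon>"
      obtain q where q: "q \<in> \<rat>" "F y - \<epsilon> / 4 < q" "q < F y"
        using Rats_dense_in_real[of "F y - \<epsilon> / 4" "F y"] e by auto
      obtain d where d: "d > 0" "\<And>h. 0 < h \<Longrightarrow> h < d \<Longrightarrow>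
        norm (integral (cbox y (y + h *\<^sub>R One)) (\<lambda>w. \<bar>F w - q\<bar>) /\<^sub>R h ^ DIM('a) - \<bar>F y - q\<bar>) < \<epsilon> / 4"
        using lim[of y q "\<epsilon> / 4"] elim q(1) e by auto
      show "\<exists>\<delta>>0. \<forall>h. 0 < h \<and> h < \<delta> \<longrightarrow>
      (\<integral>\<^sup>+w. ennreal \<bar>F w - F y\<bar> * indicator (cbox y (y + h *\<^sub>R One)) w \<partial>lborel) \<le> ennreal (\<epsilon> * h ^ DIM('a))"
      proof (intro exI[of _ d] conjI allI impI d(1))
        fix h assume h: "0 < h \<and> h < d"
        let ?B = "cbox y (y + h *\<^sub>R One)"
        have hp: "0 < h ^ DIM('a)" using h by simp
        have content: "emeasure lborel ?B = ennreal (h ^ DIM('a))"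
          using h by (subst emeasure_lborel_cbox) (auto simp: inner_add_left inner_Basis prod_constant inner_sum_left)
        have I: "integral ?B (\<lambda>w. \<bar>F w - q\<bar>) \<le> \<epsilon> / 2 * h ^ DIM('a)"
        proof -
          have "integral ?B (\<lambda>w. \<bar>F w - q\<bar>) /\<^sub>R h ^ DIM('a) < \<epsilon> / 2"
            using d(2)[of h] h q by (auto simp: abs_if split: if_splits)
          then show ?thesis using hp by (simp add: field_simps)
        qed
        have nnI: "(\<integral>\<^sup>+w. ennreal \<bar>F w - q\<bar> * indicator ?B w \<partial>lborel) = ennreal (integral ?B (\<lambda>w. \<bar>F w - q\<bar>))"
        proof -
          have "(\<integral>\<^sup>+w. ennreal \<bar>F w - q\<bar> * indicator ?B w \<partial>lborel) = (\<integral>\<^sup>+w. ennreal (indicator ?B w *\<^sub>R \<bar>F w - q\<bar>) \<partial>lborel)"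
            by (intro nn_integral_cong) (auto simp: indicator_def)
          also have "\<dots> = ennreal (\<integral>w. indicator ?B w *\<^sub>R \<bar>F w - q\<bar> \<partial>lborel)"
            using Fb[of y "y + h *\<^sub>R One" q] unfolding set_integrable_def
            by (intro nn_integral_eq_integral) auto
          also have "(\<integral>w. indicator ?B w *\<^sub>R \<bar>F w - q\<bar> \<partial>lborel) = integral ?B (\<lambda>w. \<bar>F w - q\<bar>)"
            using set_borel_integral_eq_integral(2)[OF Fb[of y "y + h *\<^sub>R One" q]]
            by (simp add: set_lebesgue_integral_def)
          finally show ?thesis .
        qed
        have [measurable]: "F \<in> borel_measurable borel" using F by auto
        have "(\<integral>\<^sup>+w. ennreal \<bar>F w - F y\<bar> * indicator ?B w \<partial>lborel)
          \<le> (\<integral>\<^sup>+w. ennreal \<bar>F w - q\<bar> * indicator ?B w + ennreal (\<epsilon> / 4) * indicator ?B w \<partial>lborel)"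
        proof (intro nn_integral_mono)
          fix w
          have "\<bar>F w - F y\<bar> \<le> \<bar>F w - q\<bar> + \<epsilon> / 4" using q by linarith
          then have "ennreal \<bar>F w - F y\<bar> \<le> ennreal \<bar>F w - q\<bar> + ennreal (\<epsilon> / 4)"
            using e by (simp add: ennreal_plus[symmetric] del: ennreal_plus)
          then show "ennreal \<bar>F w - F y\<bar> * indicator ?B w
              \<le> ennreal \<bar>F w - q\<bar> * indicator ?B w + ennreal (\<epsilon> / 4) * indicator ?B w"
            by (auto simp: indicator_def)
        qed
        also have "\<dots> = ennreal (integral ?B (\<lambda>w. \<bar>F w - q\<bar>)) + ennreal (\<epsilon> / 4) * ennreal (h ^ DIM('a))"
          unfolding nnI[symmetric] content[symmetric]
          by (subst nn_integral_add) (auto simp: nn_integral_cmult_indicator)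
        also have "\<dots> \<le> ennreal (\<epsilon> / 2 * h ^ DIM('a)) + ennreal (\<epsilon> / 4 * h ^ DIM('a))"
        proof (rule add_mono)
          show "ennreal (integral ?B (\<lambda>w. \<bar>F w - q\<bar>)) \<le> ennreal (\<epsilon> / 2 * h ^ DIM('a))" by (rule ennreal_leI[OF I])
          show "ennreal (\<epsilon> / 4) * ennreal (h ^ DIM('a)) \<le> ennreal (\<epsilon> / 4 * h ^ DIM('a))"
            using e hp by (simp only: ennreal_mult[of "\<epsilon> / 4" "h ^ DIM('a)"] less_imp_le order_refl zero_less_divide_iff zero_less_numeral simp_thms)
        qed
        also have "\<dots> = ennreal (\<epsilon> / 2 * h ^ DIM('a) + \<epsilon> / 4 * h ^ DIM('a))"
          using e hp by (intro ennreal_plus[symmetric]) auto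
        also have "\<dots> \<le> ennreal (\<epsilon> * h ^ DIM('a))"
          using e hp by (intro ennreal_leI) (simp add: field_simps)
        finally show "(\<integral>\<^sup>+w. ennreal \<bar>F w - F y\<bar> * indicator ?B w \<partial>lborel) \<le> ennreal (\<epsilon> * h ^ DIM('a))" .
      qed
    qed
  qed
qed

lemma nn_integral_lborel_scaleR:
  fixes u :: "'a::euclidean_space \<Rightarrow> ennreal"
  assumes [measurable]: "u \<in> borel_measurable borel" and c: "0 < c"
  shows "(\<integral>\<^sup>+w. u w \<partial>lborel) = ennreal (c ^ DIM('a)) * (\<integral>\<^sup>+w. u (c *\<^sub>R w) \<partial>lborel)"
proof -
  have "(\<integral>\<^sup>+w. u w \<partial>lborel) = (\<integral>\<^sup>+w. u w \<partial>density (distr lborel borel (\<lambda>x. 0 + c *\<^sub>R x)) (\<lambda>_. ennreal (\<bar>c\<bar> ^ DIM('a))))"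
    using lborel_affine[of c "0::'a"] c by simp
  also have "\<dots> = ennreal (c ^ DIM('a)) * (\<integral>\<^sup>+w. u (c *\<^sub>R w) \<partial>lborel)"
    using c by (simp add: nn_integral_density nn_integral_distr nn_integral_cmult)
  finally show ?thesis .
qed

lemma nn_integral_homogeneous:
  fixes u :: "'a::euclidean_space \<Rightarrow> ennreal"
  assumes [measurable]: "u \<in> borel_measurable borel" and c: "0 < c"
    and hom: "\<And>w. u (c *\<^sub>R w) = u w"
  shows "(\<integral>\<^sup>+w. u w * indicator (cball 0 c) w \<partial>lborel)
    = ennreal (c ^ DIM('a)) * (\<integral>\<^sup>+w. u w * indicator (cball 0 1) w \<partial>lborel)"
proof -
  have "indicator (cball 0 c) (c *\<^sub>R w) = (indicator (cball 0 1) w :: ennreal)" for w :: 'a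
    using c by (auto simp: indicator_def)
  moreover have "(\<lambda>w. u w * indicator (cball 0 c) w) \<in> borel_measurable borel"
  proof -
    have [measurable]: "cball (0::'a) c \<in> sets borel" by (rule borel_closed) simp
    show ?thesis by measurable
  qed
  ultimately show ?thesis
    by (simp only: nn_integral_lborel_scaleR[OF _ c] hom)
qed

section \<open>Surface measure of the sphere\<close>

lemma sgn_measurable[measurable]: "(sgn :: real^'k \<Rightarrow> real^'k) \<in> borel_measurable borel"
  unfolding sgn_div_norm[abs_def] by measurable

lemma sets_sphere[simp, measurable_cong]: "sets (sphere_surface_measure :: (real^'k) measure) = sets borel"
  and space_sphere[simp]: "space (sphere_surface_measure :: (real^'k) measure) = UNIV"
  by (simp_all add: sphere_surface_measure_def)

lemma nn_integral_sphere:
  fixes f :: "real^'k \<Rightarrow> ennreal"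
  assumes [measurable]: "f \<in> borel_measurable borel"
  shows "(\<integral>\<^sup>+x. f x \<partial>sphere_surface_measure)
    = of_nat CARD('k) * (\<integral>\<^sup>+w. f (sgn w) * indicator (cball 0 1) w \<partial>lborel)"
proof -
  have [measurable]: "cball (0::real^'k) 1 \<in> sets borel" by (rule borel_closed) simp
  have "(\<integral>\<^sup>+x. f x \<partial>sphere_surface_measure)
      = (\<integral>\<^sup>+w. of_nat CARD('k) * indicator (cball 0 1) w * f (sgn w) \<partial>lborel)"
    unfolding sphere_surface_measure_def
    by (subst nn_integral_distr, simp, simp, rule nn_integral_density; measurable)
  also have "\<dots> = of_nat CARD('k) * (\<integral>\<^sup>+w. f (sgn w) * indicator (cball 0 1) w \<partial>lborel)"
    by (subst nn_integral_cmult[symmetric]) (auto intro!: nn_integral_cong simp: mult_ac)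
  finally show ?thesis .
qed

lemma emeasure_sphere:
  fixes A :: "(real^'k) set"
  assumes [measurable]: "A \<in> sets borel"
  shows "emeasure sphere_surface_measure A
    = of_nat CARD('k) * emeasure lborel {w \<in> cball 0 1. sgn w \<in> A}"
proof -
  have "emeasure sphere_surface_measure A = (\<integral>\<^sup>+x. indicator A x \<partial>sphere_surface_measure)" by simp
  also have "\<dots> = of_nat CARD('k) * (\<integral>\<^sup>+w. indicator {w \<in> cball 0 1. sgn w \<in> A} w \<partial>lborel)"
    unfolding nn_integral_sphere[OF borel_measurable_indicator[OF assms]]
    by (intro arg_cong2[where f="(*)"] refl nn_integral_cong) (auto split: split_indicator)
  also have "(\<integral>\<^sup>+w. indicator {w \<in> cball 0 1. sgn w \<in> A} w \<partial>lborel) = emeasure lborel {w \<in> cball 0 1. sgn w \<in> A}"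
  proof (rule nn_integral_indicator)
    have "{w \<in> cball 0 1. sgn w \<in> A} = cball (0::real^'k) 1 \<inter> (sgn -` A \<inter> space borel)" by auto
    then show "{w \<in> cball 0 1. sgn w \<in> A} \<in> sets lborel"
      using measurable_sets[OF sgn_measurable assms] borel_closed[OF closed_cball[of "0::real^'k" 1]] by simp
  qed
  finally show ?thesis .
qed

lemma finite_sphere: "finite_measure (sphere_surface_measure :: (real^'k) measure)"
proof (rule finite_measureI)
  have "{w \<in> cball (0::real^'k) 1. sgn w \<in> UNIV} = cball 0 1" by blast
  then have "emeasure (sphere_surface_measure :: (real^'k) measure) UNIV = of_nat CARD('k) * emeasure lborel (cball (0::real^'k) 1)"
    using emeasure_sphere[of "UNIV :: (real^'k) set"] by simp
  then show "emeasure (sphere_surface_measure :: (real^'k) measure) (space sphere_surface_measure) \<noteq> \<infinity>"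
    using emeasure_lborel_cball_finite[of "0::real^'k" 1] by (auto simp: ennreal_mult_eq_top_iff)
qed

text \<open>The preimage of \<open>P\<close> contains a \<open>\<sigma>\<close>-compact set of full measure; its radial projection is again
  \<open>\<sigma>\<close>-compact, hence a Borel set on which \<open>P\<close> holds.\<close>

lemma AE_sphereI:
  fixes P :: "real^'k \<Rightarrow> bool"
  assumes "AE w in lborel. w \<noteq> 0 \<longrightarrow> norm w < 1 \<longrightarrow> P (sgn w)"
  shows "AE x in sphere_surface_measure. P x"
proof -
  obtain Z where Z: "{w \<in> space lborel. \<not> (w \<noteq> 0 \<longrightarrow> norm w < 1 \<longrightarrow> P (sgn w))} \<subseteq> Z" "emeasure lborel Z = 0" "Z \<in> sets lborel"
    using AE_E[OF assms] by blast
  define S where "S = ball (0::real^'k) 1 - Z - {0}"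
  have "S \<in> sets lebesgue" using Z(3) by (simp add: S_def)
  from lebesgue_set_almost_fsigma[OF this]
  obtain C T where CT: "fsigma C" "T \<in> null_sets lebesgue" "C \<union> T = S" by metis
  obtain K :: "nat \<Rightarrow> (real^'k) set" where K': "range K \<subseteq> Collect compact" "C = \<Union> (range K)"
    using CT(1) fsigma_Union_compact by metis
  then have K: "\<And>i. compact (K i)" "C = \<Union> (range K)" by auto
  have KS: "K i \<subseteq> S" for i using K(2) CT(3) by blast
  have "compact (sgn ` K i)" for i
  proof (rule compact_continuous_image[OF _ K(1)])
    show "continuous_on (K i) sgn"
      using KS[of i] unfolding S_def sgn_div_norm[abs_def] by (intro continuous_intros) auto
  qed
  then have "sgn ` K i \<in> sets borel" for i by (rule borel_compact)
  then have B: "(\<Union>i. sgn ` K i) \<in> sets borel" by (intro sets.countable_UN) blast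
  define B where "B = (\<Union>i. sgn ` K i)"
  have [measurable]: "B \<in> sets borel" using B by (simp add: B_def)
  \<comment> \<open>The unit sphere appears because the hypothesis covers the open ball, whereas
    \<open>emeasure_sphere\<close> uses the closed one.\<close>
  have "{w \<in> cball 0 1. sgn w \<in> - B} \<subseteq> Z \<union> {0} \<union> T \<union> sphere 0 1"
  proof
    fix w assume "w \<in> {w \<in> cball 0 1. sgn w \<in> - B}"
    then have w: "w \<in> cball 0 1" "w \<notin> C" using K(2) by (auto simp: B_def)
    have "w \<in> S \<or> w \<in> Z \<or> w = 0 \<or> w \<in> sphere 0 1"
      using w(1) by (auto simp: S_def)
    moreover have "w \<in> S \<Longrightarrow> w \<in> T" using w(2) CT(3) by blast
    ultimately show "w \<in> Z \<union> {0} \<union> T \<union> sphere 0 1" by blast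
  qed
  moreover have "Z \<in> null_sets lebesgue" using Z(2,3) by (auto intro!: null_sets_completionI)
  then have "Z \<union> {0} \<union> T \<union> sphere 0 1 \<in> null_sets lebesgue"
    using CT(2) negligible_sphere[of "0::real^'k" 1] by (intro null_sets.Un) (auto simp: negligible_iff_null_sets)
  ultimately have "{w \<in> cball 0 1. sgn w \<in> - B} \<in> null_sets lebesgue"
    by (rule null_sets_completion_subset)
  moreover have "{w \<in> cball 0 1. sgn w \<in> - B} \<in> sets lborel" by measurable
  ultimately have "emeasure lborel {w \<in> cball 0 1. sgn w \<in> - B} = 0"
    by (auto simp: null_sets_def)
  then have "emeasure sphere_surface_measure (- B) = 0"
    by (subst emeasure_sphere) auto
  then have "AE x in sphere_surface_measure. x \<in> B"
    by (intro AE_I[of _ _ "- B"]) auto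
  moreover have "P x" if "x \<in> B" for x
  proof -
    obtain i y where y: "y \<in> K i" "x = sgn y" using \<open>x \<in> B\<close> by (auto simp: B_def)
    have "y \<in> S" using KS y(1) by blast
    then have "y \<noteq> 0" "norm y < 1" "y \<notin> Z" by (auto simp: S_def)
    then show ?thesis using Z(1) y(2) by auto
  qed
  ultimately show ?thesis by (auto elim!: eventually_mono)
qed

lemma nonneg_sphere_closed: "closed (nonneg_sphere :: (real^'k) set)"
proof -
  have eq: "nonneg_sphere = (\<Inter>i. {x :: real^'k. 0 \<le> x $ i}) \<inter> {x. norm x = 1}"
    by (auto simp: nonneg_sphere_def)
  show ?thesis unfolding eq
    by (intro closed_Int closed_INT ballI closed_Collect_le closed_Collect_eq continuous_intros)
qed

lemma nonneg_sphere_borel[measurable]: "(nonneg_sphere :: (real^'k) set) \<in> sets borel"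
  by (rule borel_closed[OF nonneg_sphere_closed])

lemma AE_sphere_coordinates_nonzero: "AE x in (sphere_surface_measure :: (real^'k) measure). \<forall>i. x $ i \<noteq> 0"
proof (rule AE_sphereI)
  have "AE w in lborel. (w :: real^'k) $ i \<noteq> 0" for i
  proof -
    have "negligible {w :: real^'k. axis i 1 \<bullet> w = 0}"
      by (rule negligible_hyperplane) (auto simp: axis_eq_0_iff)
    then have "AE w in lebesgue. w \<notin> {w :: real^'k. axis i 1 \<bullet> w = 0}"
      by (intro AE_not_in) (simp only: negligible_iff_null_sets)
    then have "AE w in lborel. w \<notin> {w :: real^'k. axis i 1 \<bullet> w = 0}" by (simp add: AE_completion_iff)
    then show ?thesis by (simp add: inner_axis')
  qed
  then have "AE w in lborel. \<forall>i\<in>UNIV. (w :: real^'k) $ i \<noteq> 0"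
    by (intro eventually_ball_finite) auto
  then show "AE w in lborel. w \<noteq> 0 \<longrightarrow> norm w < 1 \<longrightarrow> (\<forall>i. (sgn w :: real^'k) $ i \<noteq> 0)"
    by eventually_elim (auto simp: sgn_div_norm)
qed

section \<open>Area of small spherical caps\<close>

lemma cball_borel[measurable]: "cball (x :: 'a :: metric_space) r \<in> sets borel"
  by (rule borel_closed) simp

text \<open>On the unit sphere 1 - t is the cosine of the angular radius, so the chord radius is
  sqrt (2 t); this is the source of the powers of \<open>sqrt t\<close>.\<close>

definition cap :: "real^'k \<Rightarrow> real \<Rightarrow> (real^'k) set" where
  "cap x t = {x'. 1 - t < inner x' x}"

lemma cap_borel[measurable]: "cap x t \<in> sets borel"
  unfolding cap_def by (intro borel_open open_Collect_less continuous_intros)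

text \<open>Vitali's theorem fills an open set up to a null set with disjoint balls, and an
  orthogonal map sends balls to balls of the same radius, still disjoint.\<close>

lemma emeasure_orthogonal_le:
  fixes f :: "'a::euclidean_space \<Rightarrow> 'a"
  assumes f: "orthogonal_transformation f" and U: "open U"
  shows "emeasure lborel U \<le> emeasure lborel (f ` U)"
proof -
  define K where "K = {(a, r). 0 < r \<and> ball a r \<subseteq> U}"
  have cov: "\<exists>i. i \<in> K \<and> x \<in> ball (fst i) (snd i) \<and> snd i < d" if "x \<in> U" "0 < d" for x d
  proof -
    note xU = that(1)
    obtain e where e: "e > 0" "ball x e \<subseteq> U" by (rule openE[OF U xU])
    define r where "r = min e (d / 2)"
    have r: "0 < r" "r \<le> e" "r < d" using e(1) that(2) by (auto simp: r_def)
    have "ball x r \<subseteq> U" using subset_ball[OF r(2)] e(2) by (rule order_trans)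
    then have "(x, r) \<in> K" using r(1) by (simp add: K_def)
    then show ?thesis using r by (intro exI[of _ "(x, r)"]) simp
  qed
  obtain C where C: "countable C" "C \<subseteq> K"
    "pairwise (\<lambda>i j. disjnt (ball (fst i) (snd i)) (ball (fst j) (snd j))) C"
    "negligible (U - (\<Union>i \<in> C. ball (fst i) (snd i)))"
    using Vitali_covering_theorem_balls[of U K fst snd] cov by blast
  have finj: "inj f" using f by (rule orthogonal_transformation_inj)
  let ?B = "\<lambda>i. ball (fst i) (snd i)"
  have fB: "f ` ?B i = ball (f (fst i)) (snd i)" for i
    by (rule image_orthogonal_transformation_ball[OF f])
  have disj: "disjoint_family_on ?B C"
    using C(3) by (auto simp: disjoint_family_on_def pairwise_def disjnt_def)
  then have disj': "disjoint_family_on (\<lambda>i. f ` ?B i) C"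
    unfolding disjoint_family_on_def using finj by (metis image_Int image_empty)
  have "U - (\<Union>i \<in> C. ?B i) \<in> null_sets lborel"
  proof -
    have "U - (\<Union>i \<in> C. ?B i) \<in> sets lborel"
      using U C(1) by (intro sets.Diff sets.countable_UN') auto
    from null_sets_completion_iff[OF this] show ?thesis
      using C(4) by (simp only: negligible_iff_null_sets)
  qed
  then have "emeasure lborel U \<le> emeasure lborel (\<Union>i\<in>C. ?B i)"
  proof -
    assume n: "U - (\<Union>i \<in> C. ?B i) \<in> null_sets lborel"
    have "emeasure lborel U \<le> emeasure lborel ((\<Union>i\<in>C. ?B i) \<union> (U - (\<Union>i\<in>C. ?B i)))"
    proof (rule emeasure_mono)
      show "(\<Union>i\<in>C. ?B i) \<union> (U - (\<Union>i\<in>C. ?B i)) \<in> sets lborel"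
        using U C(1) by (intro sets.Un sets.Diff sets.countable_UN') auto
    qed auto
    also have "\<dots> = emeasure lborel (\<Union>i\<in>C. ?B i)"
      using n C(1) by (intro emeasure_Un_null_set sets.countable_UN') auto
    finally show ?thesis .
  qed
  also have "\<dots> = (\<integral>\<^sup>+i. emeasure lborel (?B i) \<partial>count_space C)"
    using C(1) disj by (intro emeasure_UN_countable) auto
  also have "\<dots> = (\<integral>\<^sup>+i. emeasure lborel (f ` ?B i) \<partial>count_space C)"
  proof (rule nn_integral_cong)
    fix i assume "i \<in> space (count_space C)"
    then have "0 \<le> snd i" using C(2) by (auto simp: K_def)
    then show "emeasure lborel (?B i) = emeasure lborel (f ` ?B i)"
      unfolding fB by (simp add: emeasure_ball)
  qed
  also have "\<dots> = emeasure lborel (\<Union>i\<in>C. f ` ?B i)"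
    using C(1) disj' by (intro emeasure_UN_countable[symmetric]) (auto simp: fB)
  also have "\<dots> \<le> emeasure lborel (f ` U)"
  proof (rule emeasure_mono)
    show "(\<Union>i\<in>C. f ` ?B i) \<subseteq> f ` U" using C(2) by (fastforce simp: K_def)
    have "open (f ` U)"
      using U finj f by (intro open_surjective_linear_image) (auto simp: orthogonal_transformation_linear orthogonal_transformation_surj)
    then show "f ` U \<in> sets lborel" by simp
  qed
  finally show ?thesis .
qed

lemma emeasure_orthogonal_image:
  fixes f :: "'a::euclidean_space \<Rightarrow> 'a"
  assumes f: "orthogonal_transformation f" and U: "open U"
  shows "emeasure lborel (f ` U) = emeasure lborel U"
proof (rule antisym[OF _ emeasure_orthogonal_le[OF f U]])
  have "open (f ` U)"
    using U f by (intro open_surjective_linear_image) (auto simp: orthogonal_transformation_linear orthogonal_transformation_surj)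
  from emeasure_orthogonal_le[OF orthogonal_transformation_inv[OF f] this]
  show "emeasure lborel (f ` U) \<le> emeasure lborel U"
    using orthogonal_transformation_inj[OF f] by (simp add: image_inv_f_f)
qed

text \<open>Truncated by the height along the axis rather than by the norm, so that changing the
  aperture \<tau> is a linear stretch transverse to the axis.\<close>

definition axial_cone :: "'a::euclidean_space \<Rightarrow> real \<Rightarrow> real \<Rightarrow> 'a set" where
  "axial_cone x \<tau> s = {y. 0 < inner y x \<and> inner y x < s \<and> norm (y - inner y x *\<^sub>R x) < \<tau> * inner y x}"

lemma axial_cone_open: "open (axial_cone x \<tau> s)"
  unfolding axial_cone_def by (intro open_Collect_conj open_Collect_less continuous_intros)

lemma axial_cone_borel[measurable]: "axial_cone x \<tau> s \<in> sets borel"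
  by (rule borel_open[OF axial_cone_open])

lemma axial_cone_bounded:
  assumes "norm x = 1" "0 < \<tau>"
  shows "axial_cone x \<tau> s \<subseteq> cball 0 ((1 + \<tau>) * s)"
proof
  fix y assume y: "y \<in> axial_cone x \<tau> s"
  have "norm y \<le> norm (y - inner y x *\<^sub>R x) + norm (inner y x *\<^sub>R x)"
    by (metis diff_add_cancel norm_triangle_ineq)
  also have "\<dots> \<le> \<tau> * s + s"
  proof (rule add_mono)
    have "norm (y - inner y x *\<^sub>R x) \<le> \<tau> * inner y x" using y by (simp add: axial_cone_def)
    also have "\<dots> \<le> \<tau> * s" using y assms by (intro mult_left_mono) (auto simp: axial_cone_def)
    finally show "norm (y - inner y x *\<^sub>R x) \<le> \<tau> * s" .
    show "norm (inner y x *\<^sub>R x) \<le> s" using y assms by (simp add: axial_cone_def)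
  qed
  finally show "y \<in> cball 0 ((1 + \<tau>) * s)" by (simp add: algebra_simps)
qed

lemma emeasure_axial_cone_scale:
  fixes x :: "'a::euclidean_space"
  assumes s: "0 < s"
  shows "emeasure lborel (axial_cone x \<tau> s) = ennreal (s ^ DIM('a)) * emeasure lborel (axial_cone x \<tau> 1)"
proof -
  have "s *\<^sub>R w \<in> axial_cone x \<tau> s \<longleftrightarrow> w \<in> axial_cone x \<tau> 1" for w
  proof -
    have "norm (s *\<^sub>R w - inner (s *\<^sub>R w) x *\<^sub>R x) = s * norm (w - inner w x *\<^sub>R x)"
      using s by (metis (no_types, lifting) abs_of_pos inner_scaleR_left norm_scaleR scaleR_right_diff_distrib scaleR_scaleR)
    then show ?thesis
      using s by (simp add: axial_cone_def zero_less_mult_iff mult.left_commute[of \<tau> s])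
  qed
  then have "indicator (axial_cone x \<tau> s) (s *\<^sub>R w) = (indicator (axial_cone x \<tau> 1) w :: ennreal)" for w
    by (simp add: indicator_def)
  then show ?thesis
    using nn_integral_lborel_scaleR[of "indicator (axial_cone x \<tau> s)", OF _ s] by simp
qed

text \<open>A rotation moves the axis onto a coordinate axis, where stretching the remaining
  \<open>CARD('k) - 1\<close> coordinates by \<tau> maps the cone of aperture 1 onto the one of
  aperture \<tau>.\<close>

lemma emeasure_axial_cone:
  fixes x :: "real^'k"
  assumes x: "norm x = 1" and \<tau>: "0 < \<tau>"
  shows "emeasure lborel (axial_cone x \<tau> 1) = ennreal (\<tau> ^ (CARD('k) - 1)) * emeasure lborel (axial_cone (axis k 1 :: real^'k) 1 1)"
proof -
  define e where "e = (axis k 1 :: real^'k)"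
  have e: "norm e = 1" by (simp add: e_def)
  have ie: "inner y e = y $ k" for y by (simp add: e_def inner_axis)
  obtain f where f: "orthogonal_transformation f" "f e = x"
    using orthogonal_transformation_exists_1[OF e x] by blast
  have "f ` axial_cone e \<tau> 1 = axial_cone x \<tau> 1"
  proof -
    have fi: "inner (f y) x = inner y e" for y using f by (metis orthogonal_transformation_def)
    have fn: "norm (f y - inner (f y) x *\<^sub>R x) = norm (y - inner y e *\<^sub>R e)" for y
    proof -
      interpret linear f using f(1) by (rule orthogonal_transformation_linear)
      have "f y - inner (f y) x *\<^sub>R x = f (y - inner y e *\<^sub>R e)"
        unfolding fi using f(2) by (simp add: diff scale)
      then show ?thesis using f(1) by (simp add: orthogonal_transformation_norm)
    qed
    have "f y \<in> axial_cone x \<tau> 1 \<longleftrightarrow> y \<in> axial_cone e \<tau> 1" for y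
      unfolding axial_cone_def mem_Collect_eq fn unfolding fi ..
    moreover have "surj f" using f(1) by (rule orthogonal_transformation_surj)
    ultimately show ?thesis by (auto simp: image_iff surj_def) metis
  qed
  then have 1: "emeasure lborel (axial_cone x \<tau> 1) = emeasure lborel (axial_cone e \<tau> 1)"
    using emeasure_orthogonal_image[OF f(1) axial_cone_open] by metis
  define m where "m i = (if i = k then 1 else \<tau>)" for i
  have lm: "axial_cone e \<tau>' 1 \<in> lmeasurable" if "0 < \<tau>'" for \<tau>'
    using bounded_subset[OF bounded_cball axial_cone_bounded[OF e that]]
    by (intro bounded_set_imp_lmeasurable) auto
  have norm_stretch: "norm ((\<chi> i. m i * y $ i) - y $ k *\<^sub>R e) = \<tau> * norm (y - y $ k *\<^sub>R e)" for y
  proof -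
    have "(\<chi> i. m i * y $ i) - y $ k *\<^sub>R e = \<tau> *\<^sub>R (y - y $ k *\<^sub>R e)"
      by (auto simp: Finite_Cartesian_Product.vec_eq_iff m_def e_def axis_def)
    then show ?thesis using \<tau> by simp
  qed
  have "(\<lambda>y. \<chi> i. m i * y $ i) ` axial_cone e 1 1 = axial_cone e \<tau> 1"
  proof -
    have "(\<chi> i. m i * y $ i) \<in> axial_cone e \<tau> 1 \<longleftrightarrow> y \<in> axial_cone e 1 1" for y
      using norm_stretch[of y] \<tau> by (simp add: axial_cone_def ie m_def)
    moreover have "\<exists>y. w = (\<chi> i. m i * y $ i)" for w :: "real^'k"
      using \<tau> by (intro exI[of _ "\<chi> i. w $ i / m i"]) (auto simp: Finite_Cartesian_Product.vec_eq_iff m_def)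
    ultimately show ?thesis by (auto simp: image_iff) metis
  qed
  then have "measure lebesgue (axial_cone e \<tau> 1) = \<bar>prod m UNIV\<bar> * measure lebesgue (axial_cone e 1 1)"
    using measure_stretch[OF lm[of 1], of m] by simp
  moreover have "prod m UNIV = \<tau> ^ (CARD('k) - 1)"
  proof -
    have "prod m UNIV = m k * prod m (UNIV - {k})" by (rule prod.remove) auto
    also have "prod m (UNIV - {k}) = (\<Prod>i\<in>UNIV - {k}. \<tau>)" by (intro prod.cong) (auto simp: m_def)
    finally show ?thesis by (simp add: m_def card_Diff_singleton)
  qed
  ultimately have "measure lebesgue (axial_cone e \<tau> 1) = \<tau> ^ (CARD('k) - 1) * measure lebesgue (axial_cone e 1 1)"
    using \<tau> by simp
  then have "ennreal (measure lebesgue (axial_cone e \<tau> 1)) = ennreal (\<tau> ^ (CARD('k) - 1)) * ennreal (measure lebesgue (axial_cone e 1 1))"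
    using \<tau> by (simp add: ennreal_mult)
  then have "emeasure lebesgue (axial_cone e \<tau> 1) = ennreal (\<tau> ^ (CARD('k) - 1)) * emeasure lebesgue (axial_cone e 1 1)"
    using lm[OF \<tau>] lm[of 1] by (simp add: emeasure_eq_measure2)
  then show ?thesis unfolding 1 e_def[symmetric] by simp
qed

lemma square_less_square_iff: "0 \<le> u \<Longrightarrow> 0 \<le> v \<Longrightarrow> u\<^sup>2 < v\<^sup>2 \<longleftrightarrow> u < (v::real)"
  using power_mono_iff[of v u 2] by (simp add: not_le[symmetric])

text \<open>By Pythagoras the bound on the angle becomes a bound on transverse length over height.
  The aperture is the tangent of the angle with cosine 1 - t.\<close>

lemma cap_cone:
  fixes w x :: "real^'k"
  assumes x: "norm x = 1" and t: "0 < t" "t < 1"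
  shows "sgn w \<in> cap x t \<longleftrightarrow> 0 < inner w x \<and> norm (w - inner w x *\<^sub>R x) < sqrt (1 - (1 - t)\<^sup>2) / (1 - t) * inner w x"
proof (cases "0 < inner w x")
  case True
  then have w: "0 < norm w" by auto
  define c where "c = 1 - t"
  have c: "0 < c" "c < 1" using t by (auto simp: c_def)
  have c2: "c\<^sup>2 < 1" using c by (simp add: power_less_one_iff abs_square_less_1)
  have pyth: "(norm (w - inner w x *\<^sub>R x))\<^sup>2 = (norm w)\<^sup>2 - (inner w x)\<^sup>2"
  proof -
    have "inner x x = 1" using x by (simp add: norm_eq_1)
    then have "inner (w - inner w x *\<^sub>R x) (w - inner w x *\<^sub>R x) = inner w w - (inner w x)\<^sup>2"
      by (simp add: inner_diff_left inner_diff_right inner_commute[of x w] power2_eq_square)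
    then show ?thesis by (simp only: power2_norm_eq_inner)
  qed
  have "sgn w \<in> cap x t \<longleftrightarrow> c * norm w < inner w x"
    using w by (simp add: cap_def c_def sgn_div_norm field_simps)
  also have "\<dots> \<longleftrightarrow> (c * norm w)\<^sup>2 < (inner w x)\<^sup>2"
    using True c by (intro square_less_square_iff[symmetric]) auto
  also have "\<dots> \<longleftrightarrow> (norm w)\<^sup>2 - (inner w x)\<^sup>2 < (1 - c\<^sup>2) / c\<^sup>2 * (inner w x)\<^sup>2"
    using c by (simp add: field_simps)
  also have "\<dots> \<longleftrightarrow> (norm (w - inner w x *\<^sub>R x))\<^sup>2 < (sqrt (1 - c\<^sup>2) / c * inner w x)\<^sup>2"
    using c2 by (simp add: pyth power_mult_distrib power_divide)
  also have "\<dots> \<longleftrightarrow> norm (w - inner w x *\<^sub>R x) < sqrt (1 - c\<^sup>2) / c * inner w x"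
    using True c c2 by (intro square_less_square_iff) auto
  finally show ?thesis using True by (simp add: c_def)
next
  case False
  then have "inner (sgn w) x \<le> 0" by (simp add: sgn_div_norm mult_nonneg_nonpos divide_nonpos_nonneg not_less)
  then show ?thesis using False t by (simp add: cap_def)
qed

text \<open>The part of the cone over the cap inside the unit ball lies between the axial cones of
  heights 1 - t and 1 + t with the same aperture, which is asymptotic to sqrt (2 t).\<close>

lemma cap_measure_asymptotics:
  obtains c where "0 < c" "\<And>x :: real^'k. norm x = 1 \<Longrightarrow>
    ((\<lambda>t. measure sphere_surface_measure (cap x t) / sqrt t ^ (CARD('k) - 1)) \<longlongrightarrow> c) (at_right 0)"
proof -
  obtain k :: 'k where True by blast
  let ?N = "CARD('k)"
  define e where "e = (axis k 1 :: real^'k)"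
  define V where "V = measure lborel (axial_cone e 1 1)"
  have e: "norm e = 1" by (simp add: e_def)
  have fin: "emeasure lborel (axial_cone e 1 1) < \<infinity>"
    using emeasure_mono[OF axial_cone_bounded[OF e, of 1 1], of lborel] emeasure_lborel_cball_finite[of "0::real^'k"]
    by (auto intro: le_less_trans)
  then have V: "emeasure lborel (axial_cone e 1 1) = ennreal V" by (simp add: V_def emeasure_eq_ennreal_measure)
  have "V \<noteq> 0"
  proof
    assume "V = 0"
    then have "negligible (axial_cone e 1 1)" using V by (simp add: negligible_iff_emeasure0)
    moreover have "(1 / 2) *\<^sub>R e \<in> axial_cone e 1 1" using e by (simp add: axial_cone_def norm_eq_1)
    ultimately show False using open_not_negligible[OF axial_cone_open] by blast
  qed
  then have Vpos: "0 < V" using V_def measure_nonneg by (metis less_eq_real_def)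
  show ?thesis
  \<comment> \<open>The power of 1 keeps the constant in the form in which both sandwich limits are
    computed.\<close>
  proof (rule that[of "real ?N * (1 ^ ?N * sqrt 2 ^ (?N - 1) * V)"])
    show "0 < real ?N * (1 ^ ?N * sqrt 2 ^ (?N - 1) * V)" using Vpos by simp
    fix x :: "real^'k" assume x: "norm x = 1"
    let ?m = "\<lambda>t. measure sphere_surface_measure (cap x t)"
    define \<tau> where "\<tau> t = sqrt (1 - (1 - t)\<^sup>2) / (1 - t)" for t :: real
    have bounds: "real ?N * ((1 - t) ^ ?N * \<tau> t ^ (?N - 1) * V) \<le> ?m t \<and> ?m t \<le> real ?N * ((1 + t) ^ ?N * \<tau> t ^ (?N - 1) * V)"
      if t: "0 < t" "t < 1" for t
    proof -
      have tau: "0 < \<tau> t" using t by (simp add: \<tau>_def power_less_one_iff)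
      let ?K = "{w \<in> cball 0 1. sgn w \<in> cap x t}"
      have cm: "emeasure lborel (axial_cone x (\<tau> t) s) = ennreal (s ^ ?N * \<tau> t ^ (?N - 1) * V)" if "0 < s" for s
        using emeasure_axial_cone_scale[OF that, of x "\<tau> t"] emeasure_axial_cone[OF x tau, of k] that tau Vpos
        by (simp add: V[unfolded e_def] ennreal_mult mult_ac)
      have ix: "inner w x \<le> norm w" for w using norm_cauchy_schwarz[of w x] x by simp
      have "?K \<subseteq> axial_cone x (\<tau> t) (1 + t)"
      proof
        fix w assume w: "w \<in> ?K"
        then have "inner w x < 1 + t" using ix[of w] t by auto
        then show "w \<in> axial_cone x (\<tau> t) (1 + t)" using w cap_cone[OF x t, of w] by (simp add: axial_cone_def \<tau>_def)
      qed
      then have "emeasure lborel ?K \<le> ennreal ((1 + t) ^ ?N * \<tau> t ^ (?N - 1) * V)"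
        using cm[of "1 + t"] emeasure_mono[of ?K "axial_cone x (\<tau> t) (1 + t)" lborel] t by simp
      moreover have "axial_cone x (\<tau> t) (1 - t) \<subseteq> ?K"
      proof
        fix w assume w: "w \<in> axial_cone x (\<tau> t) (1 - t)"
        then have s: "sgn w \<in> cap x t" using cap_cone[OF x t, of w] by (simp add: axial_cone_def \<tau>_def)
        have "norm w \<noteq> 0" using w by (auto simp: axial_cone_def)
        then have "(1 - t) * norm w < inner w x" using s by (simp add: cap_def sgn_div_norm field_simps)
        also have "\<dots> < (1 - t) * 1" using w by (simp add: axial_cone_def)
        finally have "norm w < 1" using t by (subst (asm) mult_less_cancel_left_pos) auto
        then show "w \<in> ?K" using s by simp
      qed
      then have "ennreal ((1 - t) ^ ?N * \<tau> t ^ (?N - 1) * V) \<le> emeasure lborel ?K"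
        using t by (subst cm[symmetric]) (auto intro!: emeasure_mono)
      moreover have "emeasure sphere_surface_measure (cap x t) = of_nat ?N * emeasure lborel ?K"
        by (rule emeasure_sphere) simp
      moreover have "emeasure sphere_surface_measure (cap x t) = ennreal (?m t)"
        by (rule finite_measure.emeasure_eq_measure[OF finite_sphere])
      ultimately have "ennreal (real ?N) * ennreal ((1 - t) ^ ?N * \<tau> t ^ (?N - 1) * V) \<le> ennreal (?m t)"
        "ennreal (?m t) \<le> ennreal (real ?N) * ennreal ((1 + t) ^ ?N * \<tau> t ^ (?N - 1) * V)"
        by (auto simp: ennreal_of_nat_eq_real_of_nat intro: mult_left_mono)
      then show ?thesis using t tau Vpos by (simp add: ennreal_mult[symmetric] ennreal_le_iff)
    qed
    have \<tau>lim: "((\<lambda>t. \<tau> t / sqrt t) \<longlongrightarrow> sqrt 2) (at_right 0)"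
    proof (rule Lim_transform_eventually)
      show "((\<lambda>t. sqrt (2 - t) / (1 - t)) \<longlongrightarrow> sqrt 2) (at_right (0::real))"
        by (auto intro!: tendsto_eq_intros)
      show "\<forall>\<^sub>F t in at_right (0::real). sqrt (2 - t) / (1 - t) = \<tau> t / sqrt t"
      proof (rule eventually_at_rightI[of 0 1])
        fix t :: real assume t: "t \<in> {0<..<1}"
        have "1 - (1 - t)\<^sup>2 = t * (2 - t)" by (simp add: power2_eq_square algebra_simps)
        then show "sqrt (2 - t) / (1 - t) = \<tau> t / sqrt t" using t by (simp add: \<tau>_def real_sqrt_mult)
      qed simp
    qed
    show "((\<lambda>t. ?m t / sqrt t ^ (?N - 1)) \<longlongrightarrow> real ?N * (1 ^ ?N * sqrt 2 ^ (?N - 1) * V)) (at_right 0)"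
    proof (rule tendsto_sandwich)
      show "\<forall>\<^sub>F t in at_right 0. real ?N * ((1 - t) ^ ?N * (\<tau> t / sqrt t) ^ (?N - 1) * V) \<le> ?m t / sqrt t ^ (?N - 1)"
      proof (rule eventually_at_rightI[of 0 1])
        fix t :: real assume t: "t \<in> {0<..<1}"
        then have "real ?N * ((1 - t) ^ ?N * \<tau> t ^ (?N - 1) * V) / sqrt t ^ (?N - 1) \<le> ?m t / sqrt t ^ (?N - 1)"
          using bounds[of t] by (intro divide_right_mono) auto
        then show "real ?N * ((1 - t) ^ ?N * (\<tau> t / sqrt t) ^ (?N - 1) * V) \<le> ?m t / sqrt t ^ (?N - 1)"
          by (simp add: power_divide)
      qed simp
      show "\<forall>\<^sub>F t in at_right 0. ?m t / sqrt t ^ (?N - 1) \<le> real ?N * ((1 + t) ^ ?N * (\<tau> t / sqrt t) ^ (?N - 1) * V)"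
      proof (rule eventually_at_rightI[of 0 1])
        fix t :: real assume t: "t \<in> {0<..<1}"
        then have "?m t / sqrt t ^ (?N - 1) \<le> real ?N * ((1 + t) ^ ?N * \<tau> t ^ (?N - 1) * V) / sqrt t ^ (?N - 1)"
          using bounds[of t] by (intro divide_right_mono) auto
        then show "?m t / sqrt t ^ (?N - 1) \<le> real ?N * ((1 + t) ^ ?N * (\<tau> t / sqrt t) ^ (?N - 1) * V)"
          by (simp add: power_divide)
      qed simp
      have l1: "((\<lambda>t. 1 - t) \<longlongrightarrow> 1) (at_right (0::real))" "((\<lambda>t. 1 + t) \<longlongrightarrow> 1) (at_right (0::real))"
        by (auto intro!: tendsto_eq_intros)
      show "((\<lambda>t. real ?N * ((1 - t) ^ ?N * (\<tau> t / sqrt t) ^ (?N - 1) * V)) \<longlongrightarrow> real ?N * (1 ^ ?N * sqrt 2 ^ (?N - 1) * V)) (at_right 0)"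
        by (intro tendsto_intros \<tau>lim l1)
      show "((\<lambda>t. real ?N * ((1 + t) ^ ?N * (\<tau> t / sqrt t) ^ (?N - 1) * V)) \<longlongrightarrow> real ?N * (1 ^ ?N * sqrt 2 ^ (?N - 1) * V)) (at_right 0)"
        by (intro tendsto_intros \<tau>lim l1)
    qed
  qed
qed

text \<open>The part over the cap of a thin spherical shell just beyond the Lebesgue point \<open>r x\<close> lies in
  a cube with corner \<open>r x\<close>, because \<open>x\<close> has positive coordinates.\<close>

lemma cap_shell_in_cube:
  fixes x w :: "real^'k"
  assumes x: "norm x = 1" and m: "0 < m" "\<And>i. m \<le> x $ i" and r: "0 < r" and t: "0 < t" "t < 1"
    and s: "s = 2 * sqrt (2 * t) / m" and s1: "r + s < 1"
    and w: "r + s - s * (m / 2) < norm w" "norm w \<le> r + s" and cap: "sgn w \<in> cap x t"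
  shows "w \<in> cbox (r *\<^sub>R x) (r *\<^sub>R x + (2 * s) *\<^sub>R One)"
proof -
  have sm: "s * m = 2 * sqrt (2 * t)" using m by (simp add: s)
  have s0: "0 < s" using m t by (simp add: s)
  have xi: "x $ i \<le> 1" for i using component_le_norm_cart[of x i] x by simp
  have m1: "m \<le> 1" by (rule order_trans[OF m(2) xi])
  have w0: "w \<noteq> 0" using cap t by (auto simp: cap_def)
  have "(norm (sgn w - x))\<^sup>2 = 2 - 2 * inner (sgn w) x"
  proof -
    have "inner x x = 1" using x by (simp add: norm_eq_1)
    moreover have "inner (sgn w) (sgn w) = 1" using w0 by (simp add: norm_eq_1[symmetric] norm_sgn)
    moreover have "(norm (sgn w - x))\<^sup>2 = inner (sgn w) (sgn w) - 2 * inner (sgn w) x + inner x x"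
      unfolding power2_norm_eq_inner by (simp add: inner_diff_left inner_diff_right inner_commute[of x "sgn w"])
    ultimately show ?thesis by simp
  qed
  then have "(norm (sgn w - x))\<^sup>2 \<le> 2 * t" using cap by (simp add: cap_def)
  then have n1: "norm (sgn w - x) \<le> sqrt (2 * t)" by (rule real_le_rsqrt)
  \<comment> \<open>An angular and a radial displacement, each at most \<open>sqrt (2 * t)\<close>,
    add up to s m by the choice of s. As s m is at most s times each coordinate of x, no coordinate
    of w falls below that of the corner.\<close>
  have "norm (w - (r + s) *\<^sub>R x) \<le> norm (norm w *\<^sub>R (sgn w - x)) + norm ((norm w - (r + s)) *\<^sub>R x)"
  proof -
    have "w - (r + s) *\<^sub>R x = norm w *\<^sub>R (sgn w - x) + (norm w - (r + s)) *\<^sub>R x"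
      using w0 by (simp add: scaleR_right_diff_distrib scaleR_left_diff_distrib sgn_div_norm)
    then show ?thesis by (metis norm_triangle_ineq)
  qed
  also have "\<dots> \<le> 1 * sqrt (2 * t) + s * (m / 2)"
  proof (rule add_mono)
    have "norm w * norm (sgn w - x) \<le> 1 * sqrt (2 * t)"
      using w s1 n1 by (intro mult_mono) auto
    then show "norm (norm w *\<^sub>R (sgn w - x)) \<le> 1 * sqrt (2 * t)" by simp
    show "norm ((norm w - (r + s)) *\<^sub>R x) \<le> s * (m / 2)" using w x by simp
  qed
  also have "\<dots> = s * m" using sm by simp
  finally have d: "\<bar>w $ i - (r + s) * x $ i\<bar> \<le> s * m" for i
    using component_le_norm_cart[of "w - (r + s) *\<^sub>R x" i] by simp
  show ?thesis
    unfolding mem_box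
  proof
    fix b :: "real^'k" assume "b \<in> Basis"
    then obtain i where b: "b = axis i 1" by (auto simp: Basis_vec_def)
    have lo: "r * x $ i \<le> w $ i"
    proof -
      have "s * m \<le> s * x $ i" using m(2) s0 by simp
      then show ?thesis using d[of i] by (simp add: algebra_simps abs_le_iff)
    qed
    have hi: "w $ i \<le> r * x $ i + 2 * s"
    proof -
      have "s * m \<le> s * 1" "s * x $ i \<le> s * 1" using m1 xi s0 by (simp_all add: mult_left_mono del: mult_1_right)
      then show ?thesis using d[of i] by (simp add: algebra_simps abs_le_iff)
    qed
    have hi_corner: "inner (r *\<^sub>R x + (2 * s) *\<^sub>R One) b = r * x $ i + 2 * s"
    proof -
      have "inner One b = 1" using \<open>b \<in> Basis\<close> by simp
      moreover have "inner x b = x $ i" by (simp add: b inner_axis)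
      ultimately show ?thesis by (simp only: inner_add_left inner_scaleR_left mult_1_right)
    qed
    show "inner (r *\<^sub>R x) b \<le> inner w b \<and> inner w b \<le> inner (r *\<^sub>R x + (2 * s) *\<^sub>R One) b"
      unfolding hi_corner using lo hi by (simp add: b inner_axis)
  qed
qed

text \<open>The integrand over the cone is homogeneous of degree 0, so its integral over a thin
  shell determines the integral over the unit ball. The shell fits into a cube with side of order
  \<open>sqrt t\<close>; its thickness, of the same order, is divided out and leaves the power
  \<open>CARD('k) - 1\<close>.\<close>

theorem Lebesgue_points_caps:
  fixes h :: "real^'k \<Rightarrow> real"
  assumes h: "integrable sphere_surface_measure h"
  shows "AE x in sphere_surface_measure. norm x = 1 \<and> (\<forall>i. 0 < x $ i) \<longrightarrow>
    (\<forall>\<epsilon>>0. \<forall>\<^sub>F t in at_right 0. (\<integral>\<^sup>+x'. ennreal \<bar>h x' - h x\<bar> * indicator (cap x t) x' \<partial>sphere_surface_measure)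
       \<le> ennreal (\<epsilon> * sqrt t ^ (CARD('k) - 1)))"
proof -
  let ?N = "CARD('k)"
  let ?\<sigma> = "sphere_surface_measure :: (real^'k) measure"
  have [measurable]: "h \<in> borel_measurable borel"
    using borel_measurable_integrable[OF h] by (simp cong: measurable_cong_sets)
  define F where "F w = h (sgn w) * indicator (cball 0 1) w" for w
  have [measurable]: "cball (0::real^'k) 1 \<in> sets borel" by (rule borel_closed) simp
  have [measurable]: "F \<in> borel_measurable borel" unfolding F_def[abs_def] by measurable
  have "(\<integral>\<^sup>+w. ennreal (norm (F w)) \<partial>lborel) = (\<integral>\<^sup>+w. ennreal (norm (h (sgn w))) * indicator (cball 0 1) w \<partial>lborel)"
    by (intro nn_integral_cong) (auto simp: F_def indicator_def)
  moreover have "of_nat ?N * (\<integral>\<^sup>+w. ennreal (norm (h (sgn w))) * indicator (cball 0 1) w \<partial>lborel) = (\<integral>\<^sup>+x. ennreal (norm (h x)) \<partial>?\<sigma>)"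
    by (subst nn_integral_sphere) auto
  moreover have "(\<integral>\<^sup>+x. ennreal (norm (h x)) \<partial>?\<sigma>) < \<infinity>" using h by (simp add: integrable_iff_bounded)
  ultimately have "of_nat ?N * (\<integral>\<^sup>+w. ennreal (norm (F w)) \<partial>lborel) < \<infinity>" by simp
  then have "(\<integral>\<^sup>+w. ennreal (norm (F w)) \<partial>lborel) < \<infinity>" by (auto simp: ennreal_mult_less_top)
  then have "integrable lborel F" by (intro integrableI_bounded) auto
  note LP = Lebesgue_points_corner[OF this]
  show ?thesis
  proof (rule AE_sphereI, use LP in eventually_elim, intro impI allI)
    fix y :: "real^'k" and \<epsilon> :: real
    assume L: "\<forall>\<epsilon>>0. \<exists>\<delta>>0. \<forall>h. 0 < h \<and> h < \<delta> \<longrightarrow>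
      (\<integral>\<^sup>+w. ennreal \<bar>F w - F y\<bar> * indicator (cbox y (y + h *\<^sub>R One)) w \<partial>lborel) \<le> ennreal (\<epsilon> * h ^ DIM(real^'k))"
      and y: "y \<noteq> 0" "norm y < 1" and pos: "norm (sgn y) = 1 \<and> (\<forall>i. 0 < sgn y $ i)" and \<epsilon>: "0 < \<epsilon>"
    define x where "x = sgn y"
    define r where "r = norm y"
    have x: "norm x = 1" and r: "0 < r" "r < 1" and yx: "y = r *\<^sub>R x"
      using y by (auto simp: x_def r_def norm_sgn sgn_div_norm)
    define m where "m = Min (range (\<lambda>i. x $ i))"
    have m: "0 < m" "m \<le> x $ i" for i
      using pos by (auto simp: m_def x_def)
    define q where "q = 2 * sqrt 2 / m"
    have q: "0 < q" using m by (simp add: q_def)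
    \<comment> \<open>Solved backwards from the last estimate: m / 2 and the power of r come from
      the volume of the shell, the powers of 2 and q from the side of the cube.\<close>
    define \<epsilon>' where "\<epsilon>' = \<epsilon> * (m / 2) * r ^ (?N - 1) / (real ?N * 2 ^ ?N * q ^ (?N - 1))"
    have \<epsilon>': "0 < \<epsilon>'" using \<epsilon> m r q by (simp add: \<epsilon>'_def)
    obtain \<delta> where \<delta>: "\<delta> > 0" "\<And>h. 0 < h \<Longrightarrow> h < \<delta> \<Longrightarrow>
      (\<integral>\<^sup>+w. ennreal \<bar>F w - F y\<bar> * indicator (cbox y (y + h *\<^sub>R One)) w \<partial>lborel) \<le> ennreal (\<epsilon>' * h ^ ?N)"
      using L \<epsilon>' by auto
    have "((\<lambda>t. 2 * (q * sqrt t)) \<longlongrightarrow> 2 * (q * sqrt 0)) (at_right 0)"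
      by (intro tendsto_intros)
    then have "((\<lambda>t. 2 * (q * sqrt t)) \<longlongrightarrow> 0) (at_right 0)" by simp
    then have "\<forall>\<^sub>F t in at_right 0. 2 * (q * sqrt t) < min \<delta> (1 - r)"
      using \<delta>(1) r by (intro order_tendstoD) auto
    moreover have "\<forall>\<^sub>F t in at_right (0::real). 0 < t \<and> t < 1"
      by (rule eventually_at_rightI[of 0 1]) auto
    ultimately have "\<forall>\<^sub>F t in at_right 0. (\<integral>\<^sup>+x'. ennreal \<bar>h x' - h x\<bar> * indicator (cap x t) x' \<partial>?\<sigma>)
       \<le> ennreal (\<epsilon> * sqrt t ^ (?N - 1))"
    proof eventually_elim
      case (elim t)
      then have t: "0 < t" "t < 1" by auto
      define s where "s = q * sqrt t"
      have s: "s = 2 * sqrt (2 * t) / m" by (simp add: s_def q_def real_sqrt_mult)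
      have s0: "0 < s" using q t by (simp add: s_def)
      have s1: "r + s < 1" "2 * s < \<delta>" using elim s0 by (auto simp: s_def[symmetric])
      define u where "u w = ennreal \<bar>h (sgn w) - h x\<bar> * indicator (cap x t) (sgn w)" for w
      have [measurable]: "u \<in> borel_measurable borel" unfolding u_def[abs_def] by measurable
      have hom: "u (c *\<^sub>R w) = u w" if "0 < c" for c w using that by (simp add: u_def sgn_scaleR)
      define J where "J = (\<integral>\<^sup>+w. u w * indicator (cball 0 1) w \<partial>lborel)"
      have \<sigma>J: "(\<integral>\<^sup>+x'. ennreal \<bar>h x' - h x\<bar> * indicator (cap x t) x' \<partial>?\<sigma>) = of_nat ?N * J"
        unfolding J_def u_def by (subst nn_integral_sphere) auto
      interpret \<sigma>: finite_measure ?\<sigma> by (rule finite_sphere)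
      have "(\<integral>\<^sup>+x'. ennreal \<bar>h x' - h x\<bar> * indicator (cap x t) x' \<partial>?\<sigma>) \<le> (\<integral>\<^sup>+x'. ennreal (norm (h x' - h x)) \<partial>?\<sigma>)"
        by (intro nn_integral_mono) (auto simp: indicator_def)
      also have "\<dots> < \<infinity>"
      proof -
        have "integrable ?\<sigma> (\<lambda>x'. h x' - h x)" using h by (intro Bochner_Integration.integrable_diff) auto
        then show ?thesis by (simp add: integrable_iff_bounded)
      qed
      \<comment> \<open>Finiteness allows the two ball integrals to be subtracted as real
        numbers.\<close>
      finally have "J < \<infinity>" unfolding \<sigma>J by (auto simp: ennreal_mult_less_top)
      then obtain j where j: "J = ennreal j" "0 \<le> j" by (cases J) auto
      define \<rho>1 \<rho>0 where "\<rho>1 = r + s" and "\<rho>0 = r + s - s * (m / 2)"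
      have xi: "x $ i \<le> 1" for i using component_le_norm_cart[of x i] x by simp
      have m1: "m \<le> 1" by (rule order_trans[OF m(2) xi])
      have \<rho>: "r \<le> \<rho>0" "0 < \<rho>0" "\<rho>0 \<le> \<rho>1" "\<rho>1 - \<rho>0 = s * (m / 2)"
      proof -
        have "s * (m / 2) \<le> s * 1" using m1 s0 by (intro mult_left_mono) auto
        then show "r \<le> \<rho>0" by (simp add: \<rho>0_def)
        then show "0 < \<rho>0" using r by simp
        have "0 \<le> s * (m / 2)" using s0 m by simp
        then show "\<rho>0 \<le> \<rho>1" by (simp add: \<rho>0_def \<rho>1_def)
      qed (simp add: \<rho>0_def \<rho>1_def)
      have Jc: "(\<integral>\<^sup>+w. u w * indicator (cball 0 c) w \<partial>lborel) = ennreal (c ^ ?N * j)" if "0 < c" for c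
        using nn_integral_homogeneous[of u c, OF _ that hom[OF that]] that j
        by (simp add: J_def[symmetric] ennreal_mult)
      define R where "R = (\<integral>\<^sup>+w. u w * indicator (cball 0 \<rho>1 - cball 0 \<rho>0) w \<partial>lborel)"
      have "(\<integral>\<^sup>+w. u w * indicator (cball 0 \<rho>1) w \<partial>lborel)
          = (\<integral>\<^sup>+w. u w * indicator (cball 0 \<rho>0) w + u w * indicator (cball 0 \<rho>1 - cball 0 \<rho>0) w \<partial>lborel)"
        using \<rho>(3) by (intro nn_integral_cong) (auto simp: indicator_def)
      also have "\<dots> = (\<integral>\<^sup>+w. u w * indicator (cball 0 \<rho>0) w \<partial>lborel) + R"
        unfolding R_def by (rule nn_integral_add) measurable
      finally have split: "ennreal (\<rho>1 ^ ?N * j) = ennreal (\<rho>0 ^ ?N * j) + R"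
        using Jc[of \<rho>1] Jc[of \<rho>0] \<rho> by simp
      have "R \<le> (\<integral>\<^sup>+w. ennreal \<bar>F w - F y\<bar> * indicator (cbox y (y + (2 * s) *\<^sub>R One)) w \<partial>lborel)"
        unfolding R_def
      proof (intro nn_integral_mono)
        fix w
        show "u w * indicator (cball 0 \<rho>1 - cball 0 \<rho>0) w \<le> ennreal \<bar>F w - F y\<bar> * indicator (cbox y (y + (2 * s) *\<^sub>R One)) w"
        proof (cases "w \<in> cball 0 \<rho>1 - cball 0 \<rho>0 \<and> sgn w \<in> cap x t")
          case True
          then have w: "r + s - s * (m / 2) < norm w" "norm w \<le> r + s"
            by (auto simp: \<rho>0_def \<rho>1_def)
          have "w \<in> cbox y (y + (2 * s) *\<^sub>R One)"
            unfolding yx by (rule cap_shell_in_cube[OF x m r(1) t s s1(1) w]) (use True in auto)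
          moreover have "F w = h (sgn w)" using w s1 by (simp add: F_def)
          moreover have "F y = h x" using y by (simp add: F_def x_def)
          ultimately show ?thesis by (simp add: u_def indicator_def)
        qed (auto simp: u_def indicator_def)
      qed
      also have "\<dots> \<le> ennreal (\<epsilon>' * (2 * s) ^ ?N)" using \<delta>(2)[of "2 * s"] s0 s1 by simp
      finally have "ennreal (\<rho>1 ^ ?N * j) \<le> ennreal (\<rho>0 ^ ?N * j) + ennreal (\<epsilon>' * (2 * s) ^ ?N)"
        unfolding split by (intro add_left_mono)
      then have le: "\<rho>1 ^ ?N * j \<le> \<rho>0 ^ ?N * j + \<epsilon>' * (2 * s) ^ ?N"
        using j \<rho> \<epsilon>' s0 by (simp add: ennreal_plus[symmetric] ennreal_le_iff del: ennreal_plus)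
      obtain n where n: "?N = Suc n" by (metis card_gt_0_iff finite UNIV_not_empty gr0_implies_Suc)
      have "s * (m / 2) * r ^ n \<le> (\<rho>1 - \<rho>0) * \<rho>0 ^ n"
        unfolding \<rho>(4) using s0 m r \<rho> by (intro mult_left_mono power_mono) auto
      also have "\<dots> \<le> \<rho>1 ^ Suc n - \<rho>0 ^ Suc n"
        using \<rho> mult_left_mono[OF power_mono[of \<rho>0 \<rho>1 n], of \<rho>1] by (simp add: algebra_simps)
      finally have "s * (m / 2) * r ^ n * j \<le> (\<rho>1 ^ ?N - \<rho>0 ^ ?N) * j"
        using j unfolding n by (intro mult_right_mono)
      also have "\<dots> \<le> \<epsilon>' * (2 * s) ^ ?N" using le by (simp add: algebra_simps)
      finally have "s * (m / 2) * r ^ n * j \<le> \<epsilon>' * (2 * s) ^ Suc n" unfolding n .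
      then have "s * ((m / 2) * r ^ n * j) \<le> s * (\<epsilon>' * 2 ^ Suc n * s ^ n)"
        by (simp add: power_mult_distrib algebra_simps)
      then have "(m / 2) * r ^ n * j \<le> \<epsilon>' * 2 ^ Suc n * s ^ n" using s0 by simp
      then have "real ?N * ((m / 2) * r ^ n * j) \<le> real ?N * (\<epsilon>' * 2 ^ Suc n * s ^ n)"
        by (intro mult_left_mono) auto
      also have "\<dots> = \<epsilon> * (m / 2) * r ^ n * sqrt t ^ n"
        using q by (simp add: \<epsilon>'_def n s_def power_mult_distrib del: of_nat_Suc)
      finally have "((m / 2) * r ^ n) * (real ?N * j) \<le> ((m / 2) * r ^ n) * (\<epsilon> * sqrt t ^ n)"
        by (simp add: mult_ac)
      then have "real ?N * j \<le> \<epsilon> * sqrt t ^ n" using m r by (subst (asm) mult_le_cancel_left_pos) auto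
      then show ?case unfolding \<sigma>J j using n j
        by (simp add: ennreal_of_nat_eq_real_of_nat ennreal_mult[symmetric] ennreal_leI del: of_nat_Suc)
    qed
    then show "\<forall>\<^sub>F t in at_right 0. (\<integral>\<^sup>+x'. ennreal \<bar>h x' - h (sgn y)\<bar> * indicator (cap (sgn y) t) x' \<partial>?\<sigma>)
       \<le> ennreal (\<epsilon> * sqrt t ^ (?N - 1))" by (simp add: x_def)
  qed
qed

lemma cap_average:
  fixes h :: "real^'k \<Rightarrow> real"
  assumes h: "integrable sphere_surface_measure h"
    and lim: "((\<lambda>t. measure sphere_surface_measure (cap x t) / sqrt t ^ (CARD('k) - 1)) \<longlongrightarrow> c) (at_right 0)"
    and leb: "\<And>\<epsilon>. 0 < \<epsilon> \<Longrightarrow> \<forall>\<^sub>F t in at_right 0.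
      (\<integral>\<^sup>+x'. ennreal \<bar>h x' - h x\<bar> * indicator (cap x t) x' \<partial>sphere_surface_measure) \<le> ennreal (\<epsilon> * sqrt t ^ (CARD('k) - 1))"
  shows "((\<lambda>t. (\<integral>x'. h x' * indicator (cap x t) x' \<partial>sphere_surface_measure) / sqrt t ^ (CARD('k) - 1)) \<longlongrightarrow> h x * c) (at_right 0)"
proof -
  let ?\<sigma> = "sphere_surface_measure :: (real^'k) measure"
  let ?n = "CARD('k) - 1"
  interpret finite_measure ?\<sigma> by (rule finite_sphere)
  define R where "R t = (\<integral>x'. (h x' - h x) * indicator (cap x t) x' \<partial>?\<sigma>)" for t
  have capi: "integrable ?\<sigma> (indicator (cap x t) :: _ \<Rightarrow> real)" for t
    by (intro integrable_real_indicator) (auto simp: emeasure_eq_measure)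
  have hi: "integrable ?\<sigma> (\<lambda>x'. h x' * indicator (cap x t) x')" for t
    using integrable_mult_indicator[OF _ h, of "cap x t"] by (simp add: mult.commute)
  have Ri: "integrable ?\<sigma> (\<lambda>x'. (h x' - h x) * indicator (cap x t) x')" for t
    unfolding left_diff_distrib using hi capi by (intro Bochner_Integration.integrable_diff integrable_mult_right)
  have split: "(\<integral>x'. h x' * indicator (cap x t) x' \<partial>?\<sigma>) = R t + h x * measure ?\<sigma> (cap x t)" for t
  proof -
    have "(\<integral>x'. h x' * indicator (cap x t) x' \<partial>?\<sigma>)
        = (\<integral>x'. (h x' - h x) * indicator (cap x t) x' + h x * indicator (cap x t) x' \<partial>?\<sigma>)"
      by (intro Bochner_Integration.integral_cong) (auto simp: algebra_simps)
    also have "\<dots> = R t + h x * measure ?\<sigma> (cap x t)"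
      unfolding R_def using Ri capi by simp
    finally show ?thesis .
  qed
  have Rabs: "ennreal \<bar>R t\<bar> \<le> (\<integral>\<^sup>+x'. ennreal \<bar>h x' - h x\<bar> * indicator (cap x t) x' \<partial>?\<sigma>)" for t
  proof -
    have "ennreal \<bar>R t\<bar> \<le> ennreal (\<integral>x'. \<bar>(h x' - h x) * indicator (cap x t) x'\<bar> \<partial>?\<sigma>)"
      unfolding R_def by (intro ennreal_leI integral_abs_bound)
    also have "\<dots> = (\<integral>\<^sup>+x'. ennreal \<bar>(h x' - h x) * indicator (cap x t) x'\<bar> \<partial>?\<sigma>)"
      using Ri by (intro nn_integral_eq_integral[symmetric] integrable_abs) auto
    also have "\<dots> = (\<integral>\<^sup>+x'. ennreal \<bar>h x' - h x\<bar> * indicator (cap x t) x' \<partial>?\<sigma>)"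
      by (intro nn_integral_cong) (auto split: split_indicator)
    finally show ?thesis .
  qed
  have pos: "\<forall>\<^sub>F t in at_right (0::real). 0 < t" by (simp add: eventually_at_right_less)
  have "((\<lambda>t. R t / sqrt t ^ ?n) \<longlongrightarrow> 0) (at_right 0)"
  proof (rule tendstoI)
    fix e :: real assume e: "0 < e"
    have e2: "0 < e / 2" using e by simp
    show "\<forall>\<^sub>F t in at_right 0. dist (R t / sqrt t ^ ?n) 0 < e"
      using leb[OF e2] pos
    proof eventually_elim
      case (elim t)
      have p: "0 < sqrt t ^ ?n" using elim by simp
      have "ennreal \<bar>R t\<bar> \<le> ennreal (e / 2 * sqrt t ^ ?n)" using Rabs[of t] elim(1) by (rule order_trans)
      then have "\<bar>R t\<bar> \<le> e / 2 * sqrt t ^ ?n" using e p by (simp add: ennreal_le_iff)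
      also have "\<dots> < e * sqrt t ^ ?n" using e p by simp
      finally have "\<bar>R t\<bar> / sqrt t ^ ?n < e" using p by (simp add: pos_divide_less_eq)
      moreover have "\<bar>R t / sqrt t ^ ?n\<bar> = \<bar>R t\<bar> / sqrt t ^ ?n" unfolding abs_divide using p by simp
      ultimately show ?case by (simp only: dist_real_def diff_0_right)
    qed
  qed
  from tendsto_add[OF this tendsto_mult_left[OF lim, of "h x"]]
  show ?thesis unfolding split by (simp add: add_divide_distrib)
qed

section \<open>Null sets of the sphere\<close>

lemma sphere_point_null:
  fixes x :: "real^'k"
  assumes x: "norm x = 1" and k: "2 \<le> CARD('k)"
  shows "AE x' in sphere_surface_measure. x' \<noteq> x"
proof -
  let ?\<sigma> = "sphere_surface_measure :: (real^'k) measure"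
  interpret finite_measure ?\<sigma> by (rule finite_sphere)
  obtain c where lim: "((\<lambda>t. measure ?\<sigma> (cap x t) / sqrt t ^ (CARD('k) - 1)) \<longlongrightarrow> c) (at_right 0)"
    using cap_measure_asymptotics x by blast
  have n: "0 < CARD('k) - 1" using k by simp
  have "((\<lambda>t. measure ?\<sigma> (cap x t) / sqrt t ^ (CARD('k) - 1) * sqrt t ^ (CARD('k) - 1)) \<longlongrightarrow> c * sqrt 0 ^ (CARD('k) - 1)) (at_right 0)"
    by (intro tendsto_intros lim)
  moreover have "c * sqrt 0 ^ (CARD('k) - 1) = 0" using n by simp
  ultimately have l0: "((\<lambda>t. measure ?\<sigma> (cap x t) / sqrt t ^ (CARD('k) - 1) * sqrt t ^ (CARD('k) - 1)) \<longlongrightarrow> 0) (at_right 0)"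
    by (simp only:)
  \<comment> \<open>The point lies in all caps around it, whose area tends to 0 since the sphere has
    positive dimension.\<close>
  have "measure ?\<sigma> {x} \<le> 0"
  proof (rule tendsto_lowerbound[OF l0])
    have pos: "\<forall>\<^sub>F t in at_right (0::real). 0 < t" by (simp add: eventually_at_right_less)
    then show "\<forall>\<^sub>F t in at_right 0. measure ?\<sigma> {x} \<le> measure ?\<sigma> (cap x t) / sqrt t ^ (CARD('k) - 1) * sqrt t ^ (CARD('k) - 1)"
    proof eventually_elim
      case (elim t)
      have "inner x x = 1" using x by (simp add: norm_eq_1)
      then have "measure ?\<sigma> {x} \<le> measure ?\<sigma> (cap x t)"
        using elim by (intro finite_measure_mono) (auto simp: cap_def)
      then show ?case using elim by simp
    qed
  qed simp
  then have "emeasure ?\<sigma> {x} = 0" by (simp add: emeasure_eq_measure measure_le_0_iff)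
  then show ?thesis by (intro AE_I[of _ _ "{x}"]) auto
qed

text \<open>For \<open>z < 1\<close> the cone over a level set of \<open>x' \<mapsto> x' \<bullet> x\<close> is contained in the frontier of a
  convex cone.\<close>

lemma sphere_level_null:
  fixes x :: "real^'k"
  assumes x: "norm x = 1" and z: "0 \<le> z" "z < 1"
  shows "AE x' in sphere_surface_measure. inner x' x \<noteq> z"
proof (rule AE_sphereI)
  define C where "C = {w :: real^'k. z * norm w \<le> inner w x}"
  have "convex C"
  proof (rule convexI)
    fix v w :: "real^'k" and p q :: real
    assume vw: "v \<in> C" "w \<in> C" and pq: "0 \<le> p" "0 \<le> q" "p + q = 1"
    have "z * norm (p *\<^sub>R v + q *\<^sub>R w) \<le> z * (p * norm v + q * norm w)"
      using norm_triangle_ineq[of "p *\<^sub>R v" "q *\<^sub>R w"] pq z by (intro mult_left_mono) auto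
    also have "\<dots> = p * (z * norm v) + q * (z * norm w)" by (simp add: algebra_simps)
    also have "\<dots> \<le> p * inner v x + q * inner w x"
      using vw pq by (intro add_mono mult_left_mono) (auto simp: C_def)
    finally show "p *\<^sub>R v + q *\<^sub>R w \<in> C" by (simp add: C_def inner_add_left)
  qed
  then have "negligible (frontier C)" by (rule negligible_convex_frontier)
  then have "AE w in lebesgue. w \<notin> frontier C"
    by (intro AE_not_in) (simp only: negligible_iff_null_sets)
  then have "AE w in lborel. w \<notin> frontier C" by (simp add: AE_completion_iff)
  then show "AE w in lborel. w \<noteq> 0 \<longrightarrow> norm w < 1 \<longrightarrow> inner (sgn w) x \<noteq> z"
  proof eventually_elim
    case (elim w)
    show ?case
    proof (intro impI notI)
      assume w: "w \<noteq> 0" "inner (sgn w) x = z"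
      then have wz: "inner w x = z * norm w" by (simp add: sgn_div_norm field_simps)
      then have "w \<in> C" by (simp add: C_def)
      moreover have "w \<notin> interior C"
      proof
        assume "w \<in> interior C"
        then obtain e where e: "0 < e" "cball w e \<subseteq> C"
          by (meson mem_interior_cball)
        \<comment> \<open>A move against x by e lowers the inner product by e but z times the norm
          by at most z e, which for z < 1 leads out of C.\<close>
        have "w - e *\<^sub>R x \<in> cball w e" using e x by (simp add: dist_norm)
        then have "w - e *\<^sub>R x \<in> C" using e(2) by blast
        then have "z * norm (w - e *\<^sub>R x) \<le> inner (w - e *\<^sub>R x) x" by (simp add: C_def)
        also have "\<dots> = z * norm w - e"
          using x wz by (simp add: inner_diff_left norm_eq_1)
        finally have 1: "z * norm (w - e *\<^sub>R x) \<le> z * norm w - e" .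
        have "norm w - e \<le> norm (w - e *\<^sub>R x)"
          using norm_triangle_ineq2[of w "e *\<^sub>R x"] x e by simp
        then have "z * (norm w - e) \<le> z * norm (w - e *\<^sub>R x)" using z by (intro mult_left_mono) auto
        then have "e \<le> z * e" using 1 by (simp add: algebra_simps)
        then show False using e z by (simp add: mult_le_cancel_right1)
      qed
      ultimately show False using elim closure_subset[of C] by (auto simp: frontier_def)
    qed
  qed
qed

lemma nonneg_sphere_inner:
  fixes x y :: "real^'k"
  assumes "x \<in> nonneg_sphere" "y \<in> nonneg_sphere"
  shows "0 \<le> inner x y" "inner x y \<le> 1" "inner x x = 1" "inner x y = 1 \<longleftrightarrow> x = y"
proof -
  show "0 \<le> inner x y"
    using assms by (auto simp: nonneg_sphere_def inner_vec_def intro!: sum_nonneg)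
  have n: "norm x = 1" "norm y = 1" using assms by (auto simp: nonneg_sphere_def)
  show "inner x y \<le> 1" using norm_cauchy_schwarz[of x y] n by simp
  show "inner x x = 1" using n by (simp add: norm_eq_1)
  show "inner x y = 1 \<longleftrightarrow> x = y" using norm_cauchy_schwarz_eq[of x y] n by auto
qed

section \<open>The data distribution\<close>

lemma space_nonneg_sphere[simp]: "space (nonneg_sphere_measure :: (real^'k) measure) = nonneg_sphere"
  by (simp add: nonneg_sphere_measure_def space_restrict_space)

lemma measurable_nonneg_sphere_borel: "(\<lambda>x. x) \<in> nonneg_sphere_measure \<rightarrow>\<^sub>M (borel :: (real^'k) measure)"
  unfolding nonneg_sphere_measure_def by (intro measurable_restrict_space1 measurable_ident_sets) simp

lemma nonneg_sphere_Int: "(nonneg_sphere :: (real^'k) set) \<inter> space sphere_surface_measure \<in> sets sphere_surface_measure"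
  by simp

locale data_distribution = prob_space D
  for D :: "((real^'k) \<times> real) measure" +
  fixes p :: "real^'k \<Rightarrow> ennreal" and \<eta> :: "real \<Rightarrow> real^'k \<Rightarrow> real"
  assumes sets_D: "sets D = sets data_space"
    and dens: "distributed D nonneg_sphere_measure fst p"
    and post: "is_label_posterior D \<eta>"
    and dim: "2 \<le> CARD('k)"
begin

abbreviation "\<sigma> \<equiv> (sphere_surface_measure :: (real^'k) measure)"
abbreviation "\<sigma>p \<equiv> (nonneg_sphere_measure :: (real^'k) measure)"

lemma space_D: "space D = nonneg_sphere \<times> {-1, 1}"
  using sets_eq_imp_space_eq[OF sets_D] by (simp add: data_space_def space_pair_measure)

lemma fst_D: "fst \<in> D \<rightarrow>\<^sub>M \<sigma>p"
  using dens by (simp add: distributed_def)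

lemma fst_borel[measurable]: "fst \<in> borel_measurable D"
  using measurable_compose[OF fst_D measurable_nonneg_sphere_borel] by simp

lemma snd_borel[measurable]: "snd \<in> borel_measurable D"
proof -
  have "snd \<in> D \<rightarrow>\<^sub>M count_space {-1, 1}"
    unfolding measurable_cong_sets[OF sets_D refl] data_space_def by (rule measurable_snd)
  moreover have "(\<lambda>x. x) \<in> count_space {-1, 1 :: real} \<rightarrow>\<^sub>M borel" by simp
  ultimately show ?thesis using measurable_compose by blast
qed

lemma p_measurable[measurable]: "p \<in> borel_measurable \<sigma>p"
  using dens by (simp add: distributed_def)

text \<open>The density is finite almost everywhere by \<open>p_finite\<close>, so this real version
  still represents the marginal and can be multiplied with signed functions.\<close>

definition dens_real :: "real^'k \<Rightarrow> real" where "dens_real x = enn2real (p x)"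

lemma p_finite: "AE x in \<sigma>p. p x \<noteq> \<infinity>"
proof (rule nn_integral_PInf_AE)
  have "(\<integral>\<^sup>+x. p x \<partial>\<sigma>p) = emeasure (density \<sigma>p p) (space \<sigma>p)"
    unfolding emeasure_density[OF p_measurable sets.top] by (intro nn_integral_cong) simp
  also have "density \<sigma>p p = distr D \<sigma>p fst" using dens by (simp add: distributed_def)
  also have "emeasure \<dots> (space \<sigma>p) = 1"
    using prob_space.emeasure_space_1[OF prob_space_distr[OF fst_D]] by simp
  finally show "(\<integral>\<^sup>+x. p x \<partial>\<sigma>p) \<noteq> \<infinity>" by simp
qed simp

lemma dens_real_distributed: "distributed D \<sigma>p fst (\<lambda>x. ennreal (dens_real x))"
proof -
  have [measurable]: "dens_real \<in> borel_measurable \<sigma>p" unfolding dens_real_def[abs_def] by measurable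
  have "density \<sigma>p p = density \<sigma>p (\<lambda>x. ennreal (dens_real x))"
    by (rule density_cong) (use p_finite in \<open>auto simp: dens_real_def less_top elim!: eventually_mono\<close>)
  then show ?thesis using dens by (auto simp: distributed_def)
qed

lemma integral_fst:
  fixes g :: "real^'k \<Rightarrow> real"
  assumes "g \<in> borel_measurable \<sigma>p"
  shows "(\<integral>s. g (fst s) \<partial>D) = (\<integral>x. indicator nonneg_sphere x * (dens_real x * g x) \<partial>\<sigma>)"
    and "integrable D (\<lambda>s. g (fst s)) \<longleftrightarrow> integrable \<sigma> (\<lambda>x. indicator nonneg_sphere x * (dens_real x * g x))"
proof -
  have "(\<integral>s. g (fst s) \<partial>D) = (\<integral>x. dens_real x * g x \<partial>\<sigma>p)"
    by (rule distributed_integral[OF dens_real_distributed assms, symmetric]) (simp add: dens_real_def)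
  then show "(\<integral>s. g (fst s) \<partial>D) = (\<integral>x. indicator nonneg_sphere x * (dens_real x * g x) \<partial>\<sigma>)"
    unfolding nonneg_sphere_measure_def integral_restrict_space[OF nonneg_sphere_Int] by simp
  have "integrable D (\<lambda>s. g (fst s)) \<longleftrightarrow> integrable \<sigma>p (\<lambda>x. dens_real x * g x)"
    by (rule distributed_integrable[OF dens_real_distributed assms, symmetric]) (simp add: dens_real_def)
  then show "integrable D (\<lambda>s. g (fst s)) \<longleftrightarrow> integrable \<sigma> (\<lambda>x. indicator nonneg_sphere x * (dens_real x * g x))"
    unfolding nonneg_sphere_measure_def integrable_restrict_space[OF nonneg_sphere_Int] by simp
qed

lemma AE_fst:
  assumes "AE x in \<sigma>. P x"
  shows "AE s in D. P (fst s)"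
proof -
  have "AE x in \<sigma>p. P x"
    unfolding nonneg_sphere_measure_def using assms
    by (subst AE_restrict_space_iff[OF nonneg_sphere_Int]) (auto elim: eventually_mono)
  then have "AE x in density \<sigma>p p. P x" by (subst AE_density) (auto elim: eventually_mono)
  moreover have "distr D \<sigma>p fst = density \<sigma>p p" using dens by (simp add: distributed_def)
  ultimately have "AE x in distr D \<sigma>p fst. P x" by (simp only:)
  then show ?thesis by (rule AE_distrD[OF fst_D])
qed

section \<open>Conditional label probabilities and regular query points\<close>

definition label_mean :: "real^'k \<Rightarrow> real" where "label_mean x = \<eta> 1 x - \<eta> (-1) x"

text \<open>The defining property of the conditional expectation, tested on preimages under
  \<open>fst\<close>, which form the conditioning sigma-algebra.\<close>

lemma posterior:
  assumes l: "l \<in> {-1, 1}" and C: "C \<in> sets \<sigma>p"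
  shows "integrable D (\<lambda>s. indicator C (fst s) * \<eta> l (fst s))"
    and "(\<integral>s. indicator C (fst s) * \<eta> l (fst s) \<partial>D) = (\<integral>s. indicator C (fst s) * indicator {s. snd s = l} s \<partial>D)"
proof -
  define F where "F = vimage_algebra (space D) fst \<sigma>p"
  have fs: "fst \<in> space D \<rightarrow> space \<sigma>p" using measurable_space[OF fst_D] by blast
  have sub: "subalgebra D F"
    unfolding subalgebra_def F_def sets_vimage_algebra2[OF fs]
    using measurable_sets[OF fst_D] by auto
  interpret F: finite_measure_subalgebra D F
    by (simp add: finite_measure_subalgebra_def finite_measure_subalgebra_axioms_def sub finite_measure_axioms)
  have fF: "fst \<in> F \<rightarrow>\<^sub>M \<sigma>p"
    unfolding F_def using measurable_space[OF fst_D] by (intro measurable_vimage_algebra1) auto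
  have iF: "(\<lambda>s. indicator C (fst s) :: real) \<in> borel_measurable F"
    using measurable_compose[OF fF borel_measurable_indicator[OF C]] .
  have iD: "(\<lambda>s. indicator C (fst s) :: real) \<in> borel_measurable D"
    using measurable_compose[OF fst_D borel_measurable_indicator[OF C]] .
  have lD: "(\<lambda>s. indicator {s. snd s = l} s :: real) \<in> borel_measurable D"
  proof -
    have "(\<lambda>s. indicator {l} (snd s) :: real) \<in> borel_measurable D" by measurable
    then show ?thesis by (simp add: indicator_def)
  qed
  have ig: "integrable D (\<lambda>s. indicator C (fst s) * indicator {s. snd s = l} s :: real)"
    by (rule integrable_const_bound[where B=1]) (use iD lD in \<open>auto simp: indicator_def\<close>)
  note * = F.real_cond_exp_intg[OF ig iF lD]
  have ae: "AE s in D. real_cond_exp D F (indicator {s. snd s = l}) s = \<eta> l (fst s)"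
    using post l unfolding is_label_posterior_def F_def by auto
  have \<eta>m: "(\<lambda>s. \<eta> l (fst s)) \<in> borel_measurable D"
    using post l measurable_compose[OF fst_D] unfolding is_label_posterior_def by blast
  have rm: "real_cond_exp D F (indicator {s. snd s = l}) \<in> borel_measurable D" by simp
  show "integrable D (\<lambda>s. indicator C (fst s) * \<eta> l (fst s))"
    by (rule integrable_cong_AE_imp[OF *(1)])
       (use iD \<eta>m ae in \<open>auto elim!: eventually_mono\<close>)
  show "(\<integral>s. indicator C (fst s) * \<eta> l (fst s) \<partial>D) = (\<integral>s. indicator C (fst s) * indicator {s. snd s = l} s \<partial>D)"
    unfolding *(2)[symmetric]
    by (rule integral_cong_AE) (use iD \<eta>m rm ae in \<open>auto elim!: eventually_mono\<close>)
qed

lemma label_mean_measurable: "label_mean \<in> borel_measurable \<sigma>p"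
  using post unfolding is_label_posterior_def label_mean_def[abs_def] by (intro borel_measurable_diff) auto

lemma label_mean_integral:
  assumes C: "C \<in> sets \<sigma>p"
  shows "integrable D (\<lambda>s. indicator C (fst s) * label_mean (fst s))"
    and "(\<integral>s. indicator C (fst s) * label_mean (fst s) \<partial>D) = (\<integral>s. snd s * indicator C (fst s) \<partial>D)"
proof -
  note p1 = posterior[of 1, OF _ C] and p2 = posterior[of "-1", OF _ C]
  show "integrable D (\<lambda>s. indicator C (fst s) * label_mean (fst s))"
    unfolding label_mean_def right_diff_distrib using p1(1) p2(1) by (intro Bochner_Integration.integrable_diff) auto
  have iD: "(\<lambda>s. indicator C (fst s) :: real) \<in> borel_measurable D"
    using measurable_compose[OF fst_D borel_measurable_indicator[OF C]] .
  have lD: "(\<lambda>s. indicator {s. snd s = l} s :: real) \<in> borel_measurable D" for l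
  proof -
    have "(\<lambda>s. indicator {l} (snd s) :: real) \<in> borel_measurable D" by measurable
    then show ?thesis by (simp add: indicator_def)
  qed
  have ig: "integrable D (\<lambda>s. indicator C (fst s) * indicator {s. snd s = l} s :: real)" for l
    by (rule integrable_const_bound[where B=1]) (use iD lD in \<open>auto simp: indicator_def\<close>)
  have "(\<integral>s. indicator C (fst s) * label_mean (fst s) \<partial>D)
      = (\<integral>s. indicator C (fst s) * \<eta> 1 (fst s) \<partial>D) - (\<integral>s. indicator C (fst s) * \<eta> (-1) (fst s) \<partial>D)"
    unfolding label_mean_def right_diff_distrib using p1(1) p2(1) by (intro Bochner_Integration.integral_diff) auto
  also have "\<dots> = (\<integral>s. indicator C (fst s) * indicator {s. snd s = 1} s - indicator C (fst s) * indicator {s. snd s = -1} s \<partial>D)"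
    using p1(2) p2(2) ig by simp
  also have "\<dots> = (\<integral>s. snd s * indicator C (fst s) \<partial>D)"
    by (intro Bochner_Integration.integral_cong) (auto simp: space_D indicator_def)
  finally show "(\<integral>s. indicator C (fst s) * label_mean (fst s) \<partial>D) = (\<integral>s. snd s * indicator C (fst s) \<partial>D)" .
qed

text \<open>The form in which \<open>vote_distribution\<close> needs the Lebesgue point property. In
  \<open>AE_regular_point\<close> the constant c is the density at x times the area constant of
  caps.\<close>

definition regular_point :: "real^'k \<Rightarrow> real \<Rightarrow> bool" where
  "regular_point x c \<longleftrightarrow> x \<in> nonneg_sphere \<and> 0 < c \<and>
     ((\<lambda>t. prob {s \<in> space D. 1 - t < inner (fst s) x} / sqrt t ^ (CARD('k) - 1)) \<longlongrightarrow> c) (at_right 0) \<and>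
     ((\<lambda>t. expectation (\<lambda>s. snd s * indicator {z. 1 - t < z} (inner (fst s) x)) / sqrt t ^ (CARD('k) - 1))
        \<longlongrightarrow> label_mean x * c) (at_right 0)"

text \<open>The density and its product with the label mean, extended by 0 to the whole sphere, are
  averaged over full caps. Points with a vanishing coordinate are null on the sphere, and points of
  density 0 are null for the marginal.\<close>

theorem AE_regular_point: "AE x in input_marginal D. \<exists>c. regular_point x c"
proof -
  let ?n = "CARD('k) - 1"
  define h1 where "h1 x = indicator nonneg_sphere x * (dens_real x * 1)" for x
  define h2 where "h2 x = indicator nonneg_sphere x * (dens_real x * label_mean x)" for x
  have h1: "integrable \<sigma> h1"
    unfolding h1_def[abs_def] by (subst integral_fst(2)[symmetric]) auto
  have h2: "integrable \<sigma> h2"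
  proof -
    have "integrable D (\<lambda>s. indicator nonneg_sphere (fst s) * label_mean (fst s))"
      by (rule label_mean_integral(1)) (use sets.top[of \<sigma>p] in simp)
    moreover have "integrable D (\<lambda>s. indicator nonneg_sphere (fst s) * label_mean (fst s))
        \<longleftrightarrow> integrable D (\<lambda>s. label_mean (fst s))"
      by (rule Bochner_Integration.integrable_cong) (auto simp: space_D)
    ultimately have "integrable D (\<lambda>s. label_mean (fst s))" by simp
    then show ?thesis
      unfolding h2_def[abs_def] by (subst integral_fst(2)[symmetric]) (rule label_mean_measurable)
  qed
  obtain c0 where c0: "0 < c0" "\<And>x :: real^'k. norm x = 1 \<Longrightarrow>
    ((\<lambda>t. measure \<sigma> (cap x t) / sqrt t ^ ?n) \<longlongrightarrow> c0) (at_right 0)"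
    using cap_measure_asymptotics by metis
  have capS: "cap x t \<inter> nonneg_sphere \<in> sets \<sigma>p" for x t
    unfolding nonneg_sphere_measure_def by (simp add: sets_restrict_space_iff)
  have ind: "indicator (cap x t \<inter> nonneg_sphere) (fst s) = (indicator {z. 1 - t < z} (inner (fst s) x) :: real)"
    if "s \<in> space D" for x t s
    using that by (auto simp: indicator_def cap_def space_D)
  have Q1: "prob {s \<in> space D. 1 - t < inner (fst s) x} = (\<integral>x'. h1 x' * indicator (cap x t) x' \<partial>\<sigma>)" for x t
  proof -
    have "prob {s \<in> space D. 1 - t < inner (fst s) x} = (\<integral>s. indicator {s \<in> space D. 1 - t < inner (fst s) x} s \<partial>D)"
      using Int_absorb2[of "{s \<in> space D. 1 - t < inner (fst s) x}" "space D"] by auto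
    also have "\<dots> = (\<integral>s. indicator (cap x t \<inter> nonneg_sphere) (fst s) \<partial>D)"
      by (intro Bochner_Integration.integral_cong refl) (simp add: ind, simp add: indicator_def)
    also have "\<dots> = (\<integral>x'. indicator nonneg_sphere x' * (dens_real x' * indicator (cap x t \<inter> nonneg_sphere) x') \<partial>\<sigma>)"
      by (rule integral_fst(1)) (rule borel_measurable_indicator[OF capS])
    also have "\<dots> = (\<integral>x'. h1 x' * indicator (cap x t) x' \<partial>\<sigma>)"
      by (intro Bochner_Integration.integral_cong refl) (auto simp: h1_def indicator_def)
    finally show ?thesis .
  qed
  have Q2: "expectation (\<lambda>s. snd s * indicator {z. 1 - t < z} (inner (fst s) x)) = (\<integral>x'. h2 x' * indicator (cap x t) x' \<partial>\<sigma>)" for x t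
  proof -
    have "expectation (\<lambda>s. snd s * indicator {z. 1 - t < z} (inner (fst s) x))
        = expectation (\<lambda>s. snd s * indicator (cap x t \<inter> nonneg_sphere) (fst s))"
      by (intro Bochner_Integration.integral_cong refl) (simp add: ind)
    also have "\<dots> = expectation (\<lambda>s. indicator (cap x t \<inter> nonneg_sphere) (fst s) * label_mean (fst s))"
      by (rule label_mean_integral(2)[OF capS, symmetric])
    also have "\<dots> = (\<integral>x'. indicator nonneg_sphere x' * (dens_real x' * (indicator (cap x t \<inter> nonneg_sphere) x' * label_mean x')) \<partial>\<sigma>)"
      by (rule integral_fst(1)) (intro borel_measurable_times borel_measurable_indicator capS label_mean_measurable)
    also have "\<dots> = (\<integral>x'. h2 x' * indicator (cap x t) x' \<partial>\<sigma>)"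
      by (intro Bochner_Integration.integral_cong refl) (auto simp: h2_def indicator_def)
    finally show ?thesis .
  qed
  have "AE x in \<sigma>. x \<in> nonneg_sphere \<longrightarrow> 0 < dens_real x \<longrightarrow> regular_point x (dens_real x * c0)"
    using Lebesgue_points_caps[OF h1] Lebesgue_points_caps[OF h2] AE_sphere_coordinates_nonzero
  proof eventually_elim
    case (elim x)
    show ?case
    proof (intro impI)
      assume x: "x \<in> nonneg_sphere" and d: "0 < dens_real x"
      have nx: "norm x = 1" using x by (simp add: nonneg_sphere_def)
      have "0 < x $ i" for i using x elim(3) by (auto simp: nonneg_sphere_def less_le)
      then have pos: "norm x = 1 \<and> (\<forall>i. 0 < x $ i)" using nx by simp
      have "((\<lambda>t. (\<integral>x'. h1 x' * indicator (cap x t) x' \<partial>\<sigma>) / sqrt t ^ ?n) \<longlongrightarrow> h1 x * c0) (at_right 0)"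
        by (rule cap_average[OF h1 c0(2)[OF nx]]) (use elim(1) pos in blast)
      moreover have "((\<lambda>t. (\<integral>x'. h2 x' * indicator (cap x t) x' \<partial>\<sigma>) / sqrt t ^ ?n) \<longlongrightarrow> h2 x * c0) (at_right 0)"
        by (rule cap_average[OF h2 c0(2)[OF nx]]) (use elim(2) pos in blast)
      ultimately show "regular_point x (dens_real x * c0)"
        unfolding regular_point_def Q1 Q2 using x d c0(1) by (simp add: h1_def h2_def mult_ac)
    qed
  qed
  then have "AE x in \<sigma>p. 0 < dens_real x \<longrightarrow> regular_point x (dens_real x * c0)"
    unfolding nonneg_sphere_measure_def by (subst AE_restrict_space_iff[OF nonneg_sphere_Int]) auto
  then have "AE x in \<sigma>p. 0 < p x \<longrightarrow> (\<exists>c. regular_point x c)"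
    using p_finite
  proof eventually_elim
    case (elim x)
    then show ?case by (auto simp: dens_real_def enn2real_positive_iff less_top)
  qed
  then have "AE x in density \<sigma>p p. \<exists>c. regular_point x c"
    by (subst AE_density) auto
  moreover have "distr D \<sigma>p fst = density \<sigma>p p" using dens by (simp add: distributed_def)
  ultimately show ?thesis by (simp only: input_marginal_def)
qed

text \<open>Below 1 this is the nullity of level sets; overlap 1 occurs only at the point x itself,
  and larger values not at all.\<close>

lemma no_atom:
  assumes x: "x \<in> nonneg_sphere" and z: "0 \<le> z"
  shows "AE s in D. inner (fst s) x \<noteq> z"
proof -
  have nx: "norm x = 1" using x by (simp add: nonneg_sphere_def)
  show ?thesis
  proof (cases "z < 1")
    case True
    show ?thesis by (rule AE_fst[OF sphere_level_null[OF nx z True]])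
  next
    case False
    show ?thesis using AE_fst[OF sphere_point_null[OF nx dim]] AE_space
    proof eventually_elim
      case (elim s)
      then have "fst s \<in> nonneg_sphere" by (auto simp: space_D)
      then show ?case using nonneg_sphere_inner[of "fst s" x] x elim(1) False by force
    qed
  qed
qed

end

section \<open>Consistency\<close>

locale trained_classifier = dual_iteration \<phi> a b + data_distribution D p \<eta>
  for \<phi> a b and D :: "((real^'k) \<times> real) measure" and p \<eta> +
  assumes ab: "a * sqrt b ^ (CARD('k) - 1) = 1"
begin

section \<open>Null events of the training sample\<close>

abbreviation sample :: "nat \<Rightarrow> (nat \<Rightarrow> (real^'k) \<times> real) measure" where
  "sample N \<equiv> Pi\<^sub>M {..<N} (\<lambda>_. D)"

lemma sample_component: "i < N \<Longrightarrow> (\<lambda>S. S i) \<in> sample N \<rightarrow>\<^sub>M D"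
  by (intro measurable_component_singleton) simp

lemma sample_space:
  assumes "S \<in> space (sample N)" "i < N"
  shows "S i \<in> space D" "fst (S i) \<in> nonneg_sphere" "snd (S i) \<in> {-1, 1}"
  using measurable_space[OF sample_component[OF assms(2)] assms(1)] by (auto simp: space_D mem_Times_iff)

lemma sample_fst: "i < N \<Longrightarrow> (\<lambda>S. fst (S i)) \<in> borel_measurable (sample N)"
  using measurable_compose[OF sample_component fst_borel] .

lemma sample_snd: "i < N \<Longrightarrow> (\<lambda>S. snd (S i)) \<in> borel_measurable (sample N)"
  using measurable_compose[OF sample_component snd_borel] .

lemma overlap_measurable: "i < N \<Longrightarrow> (\<lambda>S. inner (fst (S i)) x) \<in> borel_measurable (sample N)"
  by (intro borel_measurable_inner sample_fst) auto

lemma vote_measurable: "(\<lambda>S. vote N S x) \<in> borel_measurable (sample N)"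
  unfolding vote_def
  by (intro borel_measurable_sum borel_measurable_times sample_snd
      measurable_compose[OF overlap_measurable koenigs_measurable]) auto

text \<open>Fubini in a single coordinate, with all other examples frozen; it reduces statements
  about the sample to the absence of atoms for one example.\<close>

lemma null_by_coordinate:
  assumes i: "i < N" and A: "A \<in> sets (sample N)"
    and null: "\<And>S. S \<in> space (Pi\<^sub>M ({..<N} - {i}) (\<lambda>_. D)) \<Longrightarrow> AE y in D. S(i := y) \<notin> A"
  shows "A \<in> null_sets (sample N)"
proof -
  interpret product_sigma_finite "\<lambda>_::nat. D" by standard
  have I: "insert i ({..<N} - {i}) = {..<N}" using i by auto
  have "emeasure (sample N) A = (\<integral>\<^sup>+S. indicator A S \<partial>sample N)" using A by simp
  also have "\<dots> = (\<integral>\<^sup>+S. (\<integral>\<^sup>+y. indicator A (S(i := y)) \<partial>D) \<partial>Pi\<^sub>M ({..<N} - {i}) (\<lambda>_. D))"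
    using product_nn_integral_insert[of "{..<N} - {i}" i "indicator A"] A unfolding I by simp
  also have "\<dots> = (\<integral>\<^sup>+S. 0 \<partial>Pi\<^sub>M ({..<N} - {i}) (\<lambda>_. D))"
  proof (rule nn_integral_cong)
    fix S assume "S \<in> space (Pi\<^sub>M ({..<N} - {i}) (\<lambda>_. D))"
    from null[OF this] have "(\<integral>\<^sup>+y. indicator A (S(i := y)) \<partial>D) = (\<integral>\<^sup>+y. 0 \<partial>D)"
      by (intro nn_integral_cong_AE) (auto elim!: eventually_mono)
    then show "(\<integral>\<^sup>+y. indicator A (S(i := y)) \<partial>D) = 0" by simp
  qed
  finally show ?thesis using A by (auto simp: null_sets_def)
qed

lemma AE_distinct:
  assumes ij: "i < N" "j < N" "i \<noteq> j"
  shows "AE S in sample N. inner (fst (S i)) (fst (S j)) \<noteq> 1"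
proof -
  let ?A = "{S \<in> space (sample N). inner (fst (S i)) (fst (S j)) = 1}"
  have "?A \<in> null_sets (sample N)"
  proof (rule null_by_coordinate[OF ij(1)])
    show "?A \<in> sets (sample N)"
      using ij by (intro borel_measurable_eq borel_measurable_inner sample_fst) auto
    fix S assume S: "S \<in> space (Pi\<^sub>M ({..<N} - {i}) (\<lambda>_. D))"
    then have "S j \<in> space D" using ij by (auto simp: space_PiM PiE_iff)
    then have "fst (S j) \<in> nonneg_sphere" by (auto simp: space_D)
    from no_atom[OF this, of 1] show "AE y in D. S(i := y) \<notin> ?A"
      using ij by (auto elim!: eventually_mono)
  qed
  from AE_not_in[OF this] show ?thesis
    using AE_space by eventually_elim auto
qed

text \<open>Injectivity of \<open>koenigs\<close> on {0..<1} turns a value into at most one overlap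
  there, and overlaps have no atoms.\<close>

lemma koenigs_no_atom:
  assumes x: "x \<in> nonneg_sphere"
  shows "AE s in D. koenigs (inner (fst s) x) \<noteq> v"
proof (cases "\<exists>z. 0 \<le> z \<and> z < 1 \<and> koenigs z = v")
  case True
  then obtain z where z: "0 \<le> z" "z < 1" "koenigs z = v" by blast
  show ?thesis using no_atom[OF x z(1)] no_atom[OF x zero_le_one] AE_space
  proof eventually_elim
    case (elim s)
    then have "0 \<le> inner (fst s) x" "inner (fst s) x < 1"
      using nonneg_sphere_inner(1,2)[of "fst s" x] x by (auto simp: space_D less_le)
    then show ?case using koenigs_inj[of "inner (fst s) x" z] z elim(1) by auto
  qed
next
  case False
  show ?thesis using no_atom[OF x zero_le_one] AE_space
  proof eventually_elim
    case (elim s)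
    then have "0 \<le> inner (fst s) x" "inner (fst s) x < 1"
      using nonneg_sphere_inner(1,2)[of "fst s" x] x by (auto simp: space_D less_le)
    then show ?case using False by blast
  qed
qed

lemma AE_vote_nonzero:
  assumes x: "x \<in> nonneg_sphere" and N: "0 < N"
  shows "AE S in sample N. vote N S x \<noteq> 0"
proof -
  let ?A = "{S \<in> space (sample N). vote N S x = 0}"
  obtain i where i: "i < N" using N by blast
  have "?A \<in> null_sets (sample N)"
  proof (rule null_by_coordinate[OF i])
    show "?A \<in> sets (sample N)" using vote_measurable by (intro borel_measurable_eq) auto
    fix S assume "S \<in> space (Pi\<^sub>M ({..<N} - {i}) (\<lambda>_. D))"
    define R where "R = (\<Sum>k\<in>{..<N} - {i}. snd (S k) * koenigs (inner (fst (S k)) x))"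
    have split: "vote N (S(i := y)) x = snd y * koenigs (inner (fst y) x) + R" for y
    proof -
      have "vote N (S(i := y)) x = snd y * koenigs (inner (fst y) x)
          + (\<Sum>k\<in>{..<N} - {i}. snd ((S(i := y)) k) * koenigs (inner (fst ((S(i := y)) k)) x))"
        unfolding vote_def using i by (subst sum.remove[of "{..<N}" i]) auto
      also have "(\<Sum>k\<in>{..<N} - {i}. snd ((S(i := y)) k) * koenigs (inner (fst ((S(i := y)) k)) x)) = R"
        unfolding R_def by (intro sum.cong) auto
      finally show ?thesis .
    qed
    show "AE y in D. S(i := y) \<notin> ?A"
      \<comment> \<open>The label of the remaining example may be 1 or -1, so its weight must avoid
        both -R and R.\<close>
      using koenigs_no_atom[OF x, of R] koenigs_no_atom[OF x, of "- R"] AE_space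
    proof eventually_elim
      case (elim y)
      then have "snd y = 1 \<or> snd y = -1" by (auto simp: space_D)
      then show ?case using elim split[of y] by auto
    qed
  qed
  from AE_not_in[OF this] show ?thesis
    using AE_space by eventually_elim auto
qed

lemma AE_classifier:
  assumes x: "x \<in> nonneg_sphere" and N: "0 < N"
  shows "AE S in sample N. deep_classifier_defined \<phi> N S x \<and> deep_classifier \<phi> N S x = sgn (vote N S x) \<and> vote N S x \<noteq> 0"
proof -
  have "AE S in sample N. \<forall>i\<in>{..<N}. inner (fst (S i)) x \<noteq> 1"
    using AE_PiM_component[of "{..<N}" "\<lambda>_. D"] no_atom[OF x zero_le_one] prob_space_axioms
    by (intro eventually_ball_finite) auto
  moreover have "AE S in sample N. \<forall>i\<in>{..<N}. \<forall>j\<in>{..<N}. i \<noteq> j \<longrightarrow> inner (fst (S i)) (fst (S j)) \<noteq> 1"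
  proof (intro eventually_ball_finite ballI)
    fix i j assume "i \<in> {..<N}" "j \<in> {..<N}"
    then show "AE S in sample N. i \<noteq> j \<longrightarrow> inner (fst (S i)) (fst (S j)) \<noteq> 1"
      using AE_distinct[of i N j] by (cases "i = j") auto
  qed auto
  ultimately show ?thesis using AE_vote_nonzero[OF x N] AE_space
  proof eventually_elim
    case (elim S)
    have sp: "fst (S i) \<in> nonneg_sphere" if "i < N" for i using sample_space(2)[OF elim(4) that] .
    have 1: "0 \<le> inner (fst (S i)) x \<and> inner (fst (S i)) x < 1" if "i < N" for i
      using nonneg_sphere_inner(1,2)[OF sp[OF that] x] elim(1) that by (auto simp: less_le)
    have 2: "inner (fst (S i)) (fst (S i)) = 1" if "i < N" for i
      using nonneg_sphere_inner(3)[OF sp[OF that] sp[OF that]] .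
    have 3: "0 \<le> inner (fst (S i)) (fst (S j)) \<and> inner (fst (S i)) (fst (S j)) < 1" if "i < N" "j < N" "i \<noteq> j" for i j
      using nonneg_sphere_inner(1,2)[OF sp[OF that(1)] sp[OF that(2)]] elim(2) that by (auto simp: less_le)
    show ?case using deep_classifier_vote[OF 1 2 3 elim(3)] elim(3) by simp
  qed
qed

section \<open>Measurability of the error event\<close>

lemma ntk_compose_measurable:
  assumes h: "h \<in> borel_measurable M" and r: "\<And>S. S \<in> space M \<Longrightarrow> 0 \<le> h S \<and> h S \<le> 1"
  shows "(\<lambda>S. ntk \<phi> L (h S)) \<in> borel_measurable M"
proof -
  have "(\<lambda>z. indicator {0..1} z *\<^sub>R ntk \<phi> L z) \<in> borel_measurable borel"
    by (rule borel_measurable_continuous_on_indicator[OF _ ntk_cont]) simp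
  from measurable_compose[OF h this]
  have "(\<lambda>S. indicator {0..1} (h S) *\<^sub>R ntk \<phi> L (h S)) \<in> borel_measurable M" .
  then show ?thesis by (rule measurable_cong[THEN iffD1, rotated]) (use r in auto)
qed

lemma gram_measurable:
  assumes "i < N" "j < N"
  shows "(\<lambda>S. gram L S (i, j)) \<in> borel_measurable (sample N)"
  unfolding gram_def prod.case
proof (rule ntk_compose_measurable)
  show "(\<lambda>S. inner (fst (S i)) (fst (S j))) \<in> borel_measurable (sample N)"
    using assms by (intro borel_measurable_inner sample_fst)
  show "0 \<le> inner (fst (S i)) (fst (S j)) \<and> inner (fst (S i)) (fst (S j)) \<le> 1" if "S \<in> space (sample N)" for S
    using nonneg_sphere_inner(1,2)[OF sample_space(2)[OF that assms(1)] sample_space(2)[OF that assms(2)]] by simp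
qed

text \<open>Where the kernel matrix is eventually invertible, the predictor can be replaced by Cramer's
  rule, which is measurable in the sample, without changing the limit.\<close>

lemma error_event_measurable:
  assumes x: "x \<in> nonneg_sphere"
  shows "error_event \<phi> D \<eta> N x \<epsilon> \<in> sets (training_measure D N)"
proof -
  define d where "d L S = Determinant.det (mat N N (gram L S))" for L and S :: "nat \<Rightarrow> (real^'k) \<times> real"
  define c where "c L S = cramer_form N (gram L S) (\<lambda>i. ntk \<phi> L (overlap S i x)) (\<lambda>i. snd (S i))"
    for L and S :: "nat \<Rightarrow> (real^'k) \<times> real"
  define B where "B = bayes_labels \<eta> x"
  define evinv where "evinv S \<longleftrightarrow> (\<exists>L0. \<forall>L\<ge>L0. d L S \<noteq> 0)" for S
  have [measurable]: "d L \<in> borel_measurable (sample N)" for L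
    unfolding d_def[abs_def] by (intro borel_measurable_det gram_measurable)
  have [measurable]: "c L \<in> borel_measurable (sample N)" for L
    unfolding c_def[abs_def]
  proof (intro borel_measurable_cramer_form gram_measurable sample_snd)
    fix j assume j: "j < N"
    show "(\<lambda>S. ntk \<phi> L (overlap S j x)) \<in> borel_measurable (sample N)"
      using nonneg_sphere_inner(1,2)[OF sample_space(2)[OF _ j] x]
      by (intro ntk_compose_measurable overlap_measurable[OF j]) auto
  qed
  have [measurable]: "(sgn :: real \<Rightarrow> real) \<in> borel_measurable borel"
    unfolding sgn_if[abs_def] by measurable
  have [measurable]: "(\<lambda>v. infdist v B) \<in> borel_measurable borel"
    by (intro borel_measurable_continuous_onI continuous_on_infdist continuous_on_id)
  have evinv_iff: "evinv S \<longleftrightarrow> (\<forall>\<^sub>F L in sequentially. invertible_mat (ntk_matrix \<phi> L N S))" for S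
  proof -
    have "invertible_mat (ntk_matrix \<phi> L N S) \<longleftrightarrow> d L S \<noteq> 0" for L
      using invertible_mat_iff_det[of "ntk_matrix \<phi> L N S" N] by (simp add: ntk_matrix_def gram_def d_def)
    then show ?thesis by (simp add: evinv_def eventually_sequentially)
  qed
  have lims: "convergent (\<lambda>L. sgn (ntk_predictor \<phi> L N S x)) \<longleftrightarrow> Cauchy (\<lambda>L. sgn (c L S))"
    "deep_classifier \<phi> N S x = lim (\<lambda>L. sgn (c L S))" if "evinv S" for S
  proof -
    have ev: "\<forall>\<^sub>F L in sequentially. sgn (ntk_predictor \<phi> L N S x) = sgn (c L S)"
      using that unfolding evinv_iff by eventually_elim (simp add: ntk_predictor_cramer c_def)
    \<comment> \<open>\<open>lim\<close> is a definite description of the limit, so the equivalence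
      for every l identifies the two values even where no limit exists.\<close>
    have "(\<lambda>L. sgn (ntk_predictor \<phi> L N S x)) \<longlonglongrightarrow> l \<longleftrightarrow> (\<lambda>L. sgn (c L S)) \<longlonglongrightarrow> l" for l
      by (rule tendsto_cong[OF ev])
    then show "convergent (\<lambda>L. sgn (ntk_predictor \<phi> L N S x)) \<longleftrightarrow> Cauchy (\<lambda>L. sgn (c L S))"
      "deep_classifier \<phi> N S x = lim (\<lambda>L. sgn (c L S))"
      by (simp_all add: Cauchy_convergent_iff convergent_def deep_classifier_def lim_def)
  qed
  have "error_event \<phi> D \<eta> N x \<epsilon> =
     {S \<in> space (sample N). evinv S \<and> Cauchy (\<lambda>L. sgn (c L S)) \<longrightarrow> infdist (lim (\<lambda>L. sgn (c L S))) B > \<epsilon>}"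
    unfolding error_event_def training_measure_def deep_classifier_defined_def evinv_iff[symmetric] B_def
    using lims by auto
  also have "\<dots> \<in> sets (sample N)"
  proof -
    have "{S \<in> space (sample N). evinv S} \<in> sets (sample N)" unfolding evinv_def by measurable
    then have "Measurable.pred (sample N) evinv" by (simp add: pred_def)
    moreover have "Measurable.pred (sample N) (\<lambda>S. Cauchy (\<lambda>L. sgn (c L S)))"
      using sets_Collect_Cauchy[of "\<lambda>L S. sgn (c L S)" "sample N"] by (simp add: pred_def)
    moreover have "(\<lambda>S. lim (\<lambda>L. sgn (c L S))) \<in> borel_measurable (sample N)" by measurable
    then have "(\<lambda>S. infdist (lim (\<lambda>L. sgn (c L S))) B) \<in> borel_measurable (sample N)"
      by (rule measurable_compose) measurable
    ultimately show ?thesis by measurable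
  qed
  finally show ?thesis by (simp add: training_measure_def)
qed

text \<open>If the label mean vanishes, both labels are optimal and any nonzero vote is correct.
  Otherwise all labels are multiplied by the Bayes label s0, which reduces the claim to positivity
  of the vote.\<close>

lemma error_tendsto:
  assumes reg: "regular_point x r" and \<epsilon>: "0 < \<epsilon>"
  shows "(\<lambda>N. measure (training_measure D N) (error_event \<phi> D \<eta> N x \<epsilon>)) \<longlonglongrightarrow> 0"
proof -
  have x: "x \<in> nonneg_sphere" and r: "0 < r"
    and tail: "((\<lambda>t. prob {s \<in> space D. 1 - t < inner (fst s) x} / sqrt t ^ (CARD('k) - 1)) \<longlongrightarrow> r) (at_right 0)"
    and ltail: "((\<lambda>t. expectation (\<lambda>s. snd s * indicator {z. 1 - t < z} (inner (fst s) x)) / sqrt t ^ (CARD('k) - 1))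
        \<longlongrightarrow> label_mean x * r) (at_right 0)"
    using reg by (auto simp: regular_point_def)
  have err: "\<not> S \<in> error_event \<phi> D \<eta> N x \<epsilon>"
    if "deep_classifier_defined \<phi> N S x" "deep_classifier \<phi> N S x \<in> bayes_labels \<eta> x" for S N
    using that \<epsilon> by (simp add: error_event_def)
  show ?thesis
  proof (cases "label_mean x = 0")
    case True
    then have B: "bayes_labels \<eta> x = {-1, 1}"
      by (auto simp: bayes_labels_def is_arg_max_def label_mean_def)
    have "measure (training_measure D N) (error_event \<phi> D \<eta> N x \<epsilon>) = 0" if N: "0 < N" for N
    proof -
      have "AE S in sample N. S \<notin> error_event \<phi> D \<eta> N x \<epsilon>"
        using AE_classifier[OF x N] by eventually_elim (use err B in \<open>auto simp: sgn_if\<close>)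
      then have "error_event \<phi> D \<eta> N x \<epsilon> \<in> null_sets (sample N)"
        using error_event_measurable[OF x, of N \<epsilon>]
        by (subst (asm) AE_iff_null_sets[symmetric]) (auto simp: training_measure_def)
      then show ?thesis by (simp add: training_measure_def measure_eq_0_null_sets)
    qed
    then have "\<forall>\<^sub>F N in sequentially. measure (training_measure D N) (error_event \<phi> D \<eta> N x \<epsilon>) = 0"
      using eventually_gt_at_top[of "0::nat"] by (rule eventually_mono[rotated])
    then show ?thesis by (rule tendsto_eventually)
  next
    case False
    define s0 where "s0 = sgn (label_mean x)"
    have s0: "s0 = 1 \<or> s0 = -1" "s0 * label_mean x = \<bar>label_mean x\<bar>" "\<bar>s0\<bar> = 1"
      using False by (auto simp: s0_def sgn_if)
    have s0B: "s0 \<in> bayes_labels \<eta> x"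
      using False by (auto simp: s0_def bayes_labels_def is_arg_max_def label_mean_def sgn_if)
    interpret V: vote_distribution \<phi> a b D "\<lambda>s. inner (fst s) x" "\<lambda>s. s0 * snd s" "CARD('k) - 1" r "\<bar>label_mean x\<bar>"
    proof
      show "(\<lambda>s. inner (fst s) x) \<in> borel_measurable D" "(\<lambda>s. s0 * snd s) \<in> borel_measurable D" by measurable
      show "0 \<le> inner (fst s) x \<and> inner (fst s) x \<le> 1" if "s \<in> space D" for s
        using that nonneg_sphere_inner(1,2)[of "fst s" x] x by (auto simp: space_D)
      show "\<bar>s0 * snd s\<bar> = 1" if "s \<in> space D" for s
        using that s0(3) by (auto simp: space_D abs_mult)
      show "AE s in D. inner (fst s) x \<noteq> z" if "0 \<le> z" for z using no_atom[OF x that] .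
      show "a * sqrt b ^ (CARD('k) - 1) = 1" by (rule ab)
      have "((\<lambda>t. s0 * (expectation (\<lambda>s. snd s * indicator {z. 1 - t < z} (inner (fst s) x)) / sqrt t ^ (CARD('k) - 1)))
        \<longlongrightarrow> s0 * (label_mean x * r)) (at_right 0)"
        by (intro tendsto_intros ltail)
      then show "((\<lambda>t. expectation (\<lambda>s. s0 * snd s * indicator {z. 1 - t < z} (inner (fst s) x)) / sqrt t ^ (CARD('k) - 1))
        \<longlongrightarrow> \<bar>label_mean x\<bar> * r) (at_right 0)"
        by (simp add: s0(2)[symmetric] mult.assoc)
    qed (use r tail False in auto)
    let ?W = "\<lambda>N. {S \<in> space (sample N). (\<Sum>i<N. s0 * snd (S i) * V.G (S i)) \<le> 0}"
    have W: "(\<Sum>i<N. s0 * snd (S i) * V.G (S i)) = s0 * vote N S x" for S N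
      by (simp add: vote_def V.G_def sum_distrib_left mult.assoc)
    have le: "measure (training_measure D N) (error_event \<phi> D \<eta> N x \<epsilon>) \<le> measure (sample N) (?W N)" if N: "0 < N" for N
    proof -
      interpret PN: prob_space "sample N" by (intro prob_space_PiM prob_space_axioms)
      show ?thesis
        unfolding training_measure_def
      proof (rule PN.finite_measure_mono_AE)
        show "AE S in sample N. S \<in> error_event \<phi> D \<eta> N x \<epsilon> \<longrightarrow> S \<in> ?W N"
          using AE_classifier[OF x N] AE_space
        proof (eventually_elim, intro impI)
          fix S assume S: "deep_classifier_defined \<phi> N S x \<and> deep_classifier \<phi> N S x = sgn (vote N S x) \<and> vote N S x \<noteq> 0"
            "S \<in> space (sample N)" and e: "S \<in> error_event \<phi> D \<eta> N x \<epsilon>"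
          have "sgn (vote N S x) \<noteq> s0" using err[of N S] S e s0B by auto
          then have "s0 * vote N S x \<le> 0" using s0(1) S by (auto simp: sgn_if split: if_splits)
          then show "S \<in> ?W N" using S(2) W by simp
        qed
        show "?W N \<in> sets (sample N)"
          unfolding W using vote_measurable[of N x] by measurable
      qed
    qed
    show ?thesis
    proof (rule tendsto_sandwich[OF _ _ tendsto_const])
      show "(\<lambda>N. measure (sample N) (?W N)) \<longlonglongrightarrow> 0" by (rule V.vote_positive)
      show "\<forall>\<^sub>F N in sequentially. measure (training_measure D N) (error_event \<phi> D \<eta> N x \<epsilon>) \<le> measure (sample N) (?W N)"
        using eventually_gt_at_top[of 0] by eventually_elim (rule le)
    qed simp
  qed
qed

end

theorem theorem2:
  fixes \<phi> \<phi>' :: "real \<Rightarrow> real" and A A' B' :: real and d :: nat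
    and D :: "((real^'k) \<times> real) measure"
    and p :: "real^'k \<Rightarrow> ennreal"
    and \<eta> :: "real \<Rightarrow> real^'k \<Rightarrow> real"
  assumes "d \<ge> 1" and "CARD('k) = d + 1"
    and "normalized_activation \<phi> \<phi>'"
    and "A = (\<integral>z. \<phi> z \<partial>std_normal_distribution)"
    and "A' = (\<integral>z. \<phi>' z \<partial>std_normal_distribution)"
    and "B' = (\<integral>z. (\<phi>' z)\<^sup>2 \<partial>std_normal_distribution)"
    and "A = 0" and "A' \<noteq> 0" and "- (ln (A'\<^sup>2) / ln B') = real d / 2"
    and "prob_space D" and "sets D = sets data_space"
    and "distributed D nonneg_sphere_measure fst p"
    and "is_label_posterior D \<eta>"
  shows "AE x in input_marginal D. \<forall>\<epsilon>>0.
           (\<forall>n. error_event \<phi> D \<eta> n x \<epsilon> \<in> sets (training_measure D n)) \<and>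
           (\<lambda>n. measure (training_measure D n) (error_event \<phi> D \<eta> n x \<epsilon>)) \<longlonglongrightarrow> 0"
proof -
  have d2: "0 < real d / 2" using assms(1) by simp
  note it = normalized_activation_dual_iteration[OF assms(3) assms(4)[symmetric, unfolded assms(7)]
      assms(8)[unfolded assms(5)] d2 assms(9)[unfolded assms(5,6)], folded assms(5,6)]
  interpret I: dual_iteration \<phi> "A'\<^sup>2" B' by (rule it(1))
  interpret DD: data_distribution D p \<eta>
    using assms by (simp add: data_distribution_def data_distribution_axioms_def)
  \<comment> \<open>The logarithmic hypothesis in multiplicative form, with d the dimension of the
    sphere.\<close>
  have "A'\<^sup>2 * sqrt B' ^ d = 1"
  proof -
    have "sqrt B' ^ d = B' powr (real d / 2)"
      using I.b by (simp add: powr_half_sqrt[symmetric] powr_realpow[symmetric] powr_powr)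
    then show ?thesis using it(2) I.b by (simp add: powr_add[symmetric])
  qed
  then interpret T: trained_classifier \<phi> "A'\<^sup>2" B' D p \<eta>
    by unfold_locales (simp add: assms(2))
  show ?thesis
    using DD.AE_regular_point
  proof eventually_elim
    case (elim x)
    then obtain r where r: "DD.regular_point x r" by blast
    then have "x \<in> nonneg_sphere" by (simp add: DD.regular_point_def)
    then show ?case using T.error_event_measurable T.error_tendsto[OF r] by blast
  qed
qed

end
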